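(* Let $n,m,k$ be positive integers with $k\le m$. For any $p,q\in[0,1]$, any $s\in[0,\frac{1}{p+q}]$ and any $K\in\mathbb{C}^{n\times m}$, the function $$(A,B)\ \longmapsto\ \phi\big((B^{\frac q2}K^*A^pKB^{\frac q2})^s\big)$$ is jointly concave on $\mathbf{H}_n^+\times\mathbf{H}_m^+$.
   Context: $\mathbf{H}_n^+$ is the convex cone of $n\times n$ Hermitian positive semidefinite matrices. For a square matrix $X$ of size at least $k$, $\mathrm{Tr}_k[X]$ denotes the $k$-th elementary symmetric polynomial of the eigenvalues of $X$ (equivalently, the sum of all $k\times k$ principal minors of $X$), and $\phi(X)=(\mathrm{Tr}_k[X])^{1/k}$ for the fixed integer $k$. Powers of positive semidefinite matrices are defined by the spectral functional calculus. Conventions: when $p+q=0$ the interval $[0,\frac{1}{p+q}]$ is read as $[0,+\infty)$, and $X^0=I$ for positive semidefinite $X$. *)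

theory Defs
  imports "HOL-Analysis.Analysis" "HOL-Computational_Algebra.Polynomial"
begin

text \<open>A matrix with entries in \<^typ>\<open>complex\<close>, rows indexed by \<open>'r\<close> and columns by \<open>'c\<close>, has type
  \<open>complex^'c^'r\<close>.\<close>

definition conj_transpose :: "complex^'c^'r \<Rightarrow> complex^'r^'c" where
  "conj_transpose X = (\<chi> i j. cnj (X $ j $ i))"

definition hermitian :: "complex^'n^'n \<Rightarrow> bool" where
  "hermitian X \<longleftrightarrow> conj_transpose X = X"

definition unitary :: "complex^'n^'n \<Rightarrow> bool" where
  "unitary U \<longleftrightarrow> conj_transpose U ** U = mat 1 \<and> U ** conj_transpose U = mat 1"

text \<open>For a Hermitian matrix the sesquilinear form below takes real values, so nothing is lost by
  taking the real part.\<close>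

definition pos_semidef :: "complex^'n^'n \<Rightarrow> bool" where
  "pos_semidef X \<longleftrightarrow> hermitian X \<and> (\<forall>v. 0 \<le> Re (\<Sum>i\<in>UNIV. cnj (v $ i) * (X *v v) $ i))"

definition real_diag :: "('n \<Rightarrow> real) \<Rightarrow> complex^'n^'n" where
  "real_diag d = (\<chi> i j. if i = j then complex_of_real (d i) else 0)"

text \<open>Spectral functional calculus, for Hermitian \<open>X\<close>: if \<open>X = U diag(d) U\<^sup>*\<close> with \<open>U\<close> unitary,
  then \<open>f(X) = U diag(f \<circ> d) U\<^sup>*\<close>; \<open>spectral_fun_eq\<close> below shows that the choice of \<open>U\<close> and \<open>d\<close>
  does not matter.\<close>

definition spectral_fun :: "(real \<Rightarrow> real) \<Rightarrow> complex^'n^'n \<Rightarrow> complex^'n^'n" where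
  "spectral_fun f X = (THE Y. \<exists>U d. unitary U
      \<and> X = U ** real_diag d ** conj_transpose U
      \<and> Y = U ** real_diag (\<lambda>i. f (d i)) ** conj_transpose U)"

text \<open>\<^const>\<open>powr\<close> has \<open>0 powr 0 = 0\<close>, whereas \<open>X\<^sup>0 = I\<close> is required for singular \<open>X\<close> too.\<close>

definition psd_power :: "complex^'n^'n \<Rightarrow> real \<Rightarrow> complex^'n^'n" where
  "psd_power X p = spectral_fun (\<lambda>t. if p = 0 then 1 else t powr p) X"

definition charpoly :: "complex^'n^'n \<Rightarrow> complex poly" where
  "charpoly X = det (\<chi> i j. (if i = j then [:0, 1:] else 0) - [:X $ i $ j:])"

text \<open>An enumeration of the eigenvalues, repeated according to algebraic multiplicity. Only symmetric
  functions of it are independent of the choice.\<close>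

definition eigenvalues :: "complex^'n^'n \<Rightarrow> 'n \<Rightarrow> complex" where
  "eigenvalues X = (SOME l. charpoly X = (\<Prod>i\<in>UNIV. [:- l i, 1:]))"

definition Tr_k :: "nat \<Rightarrow> complex^'n^'n \<Rightarrow> complex" where
  "Tr_k k X = (\<Sum>I | card I = k. \<Prod>i\<in>I. eigenvalues X i)"

text \<open>Used only for positive semidefinite \<open>X\<close>, where \<open>Tr_k k X\<close> is a nonnegative real.\<close>

definition phi :: "nat \<Rightarrow> complex^'n^'n \<Rightarrow> real" where
  "phi k X = root k (Re (Tr_k k X))"

lemma spectral_fun_eq:
  assumes U: "unitary U" and X: "X = U ** real_diag d ** conj_transpose U"
  shows "spectral_fun f X = U ** real_diag (\<lambda>i. f (d i)) ** conj_transpose U"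
  unfolding spectral_fun_def
proof (rule the_equality)
  fix Y assume "\<exists>V e. unitary V \<and> X = V ** real_diag e ** conj_transpose V
      \<and> Y = V ** real_diag (\<lambda>i. f (e i)) ** conj_transpose V"
  then obtain V e where V: "unitary V" and XV: "X = V ** real_diag e ** conj_transpose V"
    and Y: "Y = V ** real_diag (\<lambda>i. f (e i)) ** conj_transpose V" by blast
  define W where "W = conj_transpose V ** U"
  have VV: "conj_transpose V ** V = mat 1" "V ** conj_transpose V = mat 1"
    and UU: "conj_transpose U ** U = mat 1" "U ** conj_transpose U = mat 1"
    using U V by (auto simp: unitary_def)
  have "conj_transpose V ** X ** U = W ** real_diag d"
    unfolding W_def X by (metis UU(1) matrix_mul_assoc matrix_mul_rid)
  moreover have "conj_transpose V ** X ** U = real_diag e ** W"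
    unfolding W_def XV by (metis VV(1) matrix_mul_assoc matrix_mul_lid)
  ultimately have eq: "real_diag e ** W = W ** real_diag d" by simp
  have l: "(real_diag g ** W) $ i $ j = of_real (g i) * W $ i $ j" for g i j
    by (simp add: matrix_matrix_mult_def real_diag_def if_distrib [where f = "\<lambda>x. x * _"]
        cong: if_cong)
  have r: "(W ** real_diag g) $ i $ j = W $ i $ j * of_real (g j)" for g i j
    by (simp add: matrix_matrix_mult_def real_diag_def if_distrib [where f = "\<lambda>x. _ * x"]
        cong: if_cong)
  have "real_diag (\<lambda>i. f (e i)) ** W = W ** real_diag (\<lambda>i. f (d i))"
  proof -
    have "of_real (f (e i)) * W $ i $ j = W $ i $ j * of_real (f (d j))" for i j
    proof -
      have "of_real (e i) * W $ i $ j = W $ i $ j * of_real (d j)"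
        using eq l r by metis
      then have "W $ i $ j = 0 \<or> e i = d j" by (auto simp: mult.commute)
      then show ?thesis by auto
    qed
    then show ?thesis by (simp add: vec_eq_iff l r)
  qed
  then have "V ** (real_diag (\<lambda>i. f (e i)) ** W) ** conj_transpose U
      = V ** (W ** real_diag (\<lambda>i. f (d i))) ** conj_transpose U" by simp
  moreover have "V ** (real_diag (\<lambda>i. f (e i)) ** W) ** conj_transpose U = Y"
    unfolding W_def Y by (metis UU(2) matrix_mul_assoc matrix_mul_rid)
  moreover have "V ** (W ** real_diag (\<lambda>i. f (d i))) ** conj_transpose U
      = U ** real_diag (\<lambda>i. f (d i)) ** conj_transpose U"
    unfolding W_def by (metis VV(2) matrix_mul_assoc matrix_mul_lid)
  ultimately show "Y = U ** real_diag (\<lambda>i. f (d i)) ** conj_transpose U" by simp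
qed (use assms in blast)

end

theory Submission
  imports Defs
begin

text \<open>Write \<open>M = K\<^sup>* A\<^sup>p K\<close> and \<open>Y = B\<^bsup>q/2\<^esup>\<close>. For all matrices \<open>Z\<close>, \<open>V\<close> and diagonal \<open>D\<close> with \<open>Z D V = 1\<close>, the
  inequality of Horn bounds the singular values of \<open>M\<^bsup>1/2\<^esup> Y = (M\<^bsup>1/2\<^esup> Z) D (V Y)\<close> in the sense of weak log
  majorization. As \<open>Tr\<^sub>k\<close> is convex and increasing in the logarithms of the eigenvalues, while its \<open>k\<close>-th
  root is concave in the eigenvalues, this yields an upper bound
  \<open>\<phi>((Y M Y)\<^sup>s) \<le> s p tr (Z\<^sup>* M Z)\<^bsup>1/p\<^esup> + s q tr (V Y\<^sup>2 V\<^sup>* )\<^bsup>1/q\<^esup> + (1 - s (p + q)) c\<close>,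
  where \<open>Z\<close>, \<open>V\<close>, \<open>c\<close> can be chosen to make it sharp at any prescribed \<open>(A, B)\<close>. By Epstein's theorem the two
  traces are concave in \<open>A\<close> and in \<open>B\<close>, so \<open>\<phi>\<close> is an infimum of jointly concave functions. Epstein's theorem
  follows from Lieb's, since \<open>tr P\<^bsup>1/p\<^esup>\<close> is the supremum over \<open>T\<close> of \<open>(tr P T\<^bsup>1-p\<^esup> - (1 - p) tr T) / p\<close>, and
  Lieb's theorem is an integral of parallel sums of quadratic forms. Singular matrices are reached by a
  limit.\<close>

section \<open>Matrices and positivity\<close>

text \<open>The obstacle is that \<open>A\<close> and \<open>B\<close> enter through one
  noncommutative product. Horn's inequality separates them, but it pairs all eigenvalues in
  decreasing order, so it can be sharp at the base point only if the three factors are ordered alike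
  there. Sharpness dictates the middle factor \<open>d i * d i = g i * w i powr (- (p + q))\<close>,
  with \<open>g\<close> the spectrum of \<open>Y0 M0 Y0\<close>. That it decreases is one of the two
  places where \<open>s * (p + q) \<le> 1\<close> enters; the other is the nonnegativity of the
  weights \<open>s * p\<close>, \<open>s * q\<close>, \<open>1 - s * (p + q)\<close> in the
  arithmetic-geometric mean inequality. That inequality is applied to
  \<open>a i powr (1 / p) / w i\<close> and \<open>b i powr (1 / q) / w i\<close>. The tangent
  inequality for \<open>phi\<close> then multiplies by \<open>w i\<close>, which cancels: only
  unweighted traces remain, and these no longer see eigenvectors. Their exponents
  \<open>1 / p\<close> and \<open>1 / q\<close> are those of Epstein's theorem. Logarithms and
  inverses require positive definite matrices. The inner matrix is regularised by a multiple of the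
  identity, which turns into an additive constant in Epstein's theorem, and \<open>B\<close> by a
  shift.\<close>

lemma ct_nth [simp]: "conj_transpose X $ i $ j = cnj (X $ j $ i)"
  by (simp add: conj_transpose_def)

lemma ct_ct [simp]: "conj_transpose (conj_transpose X) = X"
  by (simp add: vec_eq_iff)

lemma ct_mult: "conj_transpose (A ** B) = conj_transpose B ** conj_transpose A"
  by (simp add: vec_eq_iff matrix_matrix_mult_def mult.commute)

lemma ct_add: "conj_transpose (A + B) = conj_transpose A + conj_transpose B"
  by (simp add: vec_eq_iff)

lemma ct_diff: "conj_transpose (A - B) = conj_transpose A - conj_transpose B"
  by (simp add: vec_eq_iff)

lemma ct_scaleR: "conj_transpose (r *\<^sub>R A) = r *\<^sub>R conj_transpose A"
  by (simp add: vec_eq_iff scaleR_conv_of_real [where ?'a = complex])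

lemma ct_mat_1 [simp]: "conj_transpose (mat 1) = mat 1"
  by (simp add: vec_eq_iff mat_def)

lemma ct_real_diag [simp]: "conj_transpose (real_diag d) = real_diag d"
  by (simp add: vec_eq_iff real_diag_def)

lemma real_diag_mult: "real_diag a ** real_diag b = real_diag (\<lambda>i. a i * b i)"
  by (simp add: vec_eq_iff real_diag_def matrix_matrix_mult_def if_distrib [where f = "\<lambda>x. x * _"]
        cong: if_cong)

lemma real_diag_add: "real_diag a + real_diag b = real_diag (\<lambda>i. a i + b i)"
  by (simp add: vec_eq_iff real_diag_def)

lemma real_diag_diff: "real_diag a - real_diag b = real_diag (\<lambda>i. a i - b i)"
  by (simp add: vec_eq_iff real_diag_def)

lemma real_diag_scaleR: "r *\<^sub>R real_diag a = real_diag (\<lambda>i. r * a i)"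
  by (simp add: vec_eq_iff real_diag_def scaleR_conv_of_real [where ?'a = complex])

lemma real_diag_1 [simp]: "real_diag (\<lambda>i. 1) = mat 1"
  by (simp add: vec_eq_iff real_diag_def mat_def)

lemma real_diag_nth: "real_diag a $ i $ j = (if i = j then of_real (a i) else 0)"
  by (simp add: real_diag_def)

lemma real_diag_mult_right_nth: "(W ** real_diag g) $ i $ j = W $ i $ j * of_real (g j)"
  by (simp add: matrix_matrix_mult_def real_diag_def if_distrib [where f = "\<lambda>x. _ * x"]
        cong: if_cong)

lemma real_diag_vec: "(real_diag d *v v) $ i = of_real (d i) * v $ i"
  by (simp add: matrix_vector_mult_def real_diag_def if_distrib [where f = "\<lambda>x. x * _"]
        cong: if_cong)

lemma real_diag_inverse:
  assumes "\<And>i. d i \<noteq> 0"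
  shows "real_diag d ** real_diag (\<lambda>i. 1 / d i) = mat 1"
    "real_diag (\<lambda>i. 1 / d i) ** real_diag d = mat 1"
  using assms by (simp_all add: real_diag_mult)

lemma inner_vec_complex: "v \<bullet> w = Re (\<Sum>i\<in>UNIV. cnj (v $ i) * w $ i)"
  by (simp add: inner_vec_def inner_complex_def)

definition cip :: "complex^'n \<Rightarrow> complex^'n \<Rightarrow> complex" where
  "cip u v = (\<Sum>i\<in>UNIV. cnj (u $ i) * v $ i)"

lemma cip_adjoint: "cip (X *v u) v = cip u (conj_transpose X *v v)"
proof -
  have "(\<Sum>i\<in>UNIV. cnj ((X *v u) $ i) * v $ i)
      = (\<Sum>i\<in>UNIV. \<Sum>j\<in>UNIV. cnj (X $ i $ j) * cnj (u $ j) * v $ i)"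
    by (simp add: matrix_vector_mult_def sum_distrib_right)
  also have "\<dots> = (\<Sum>j\<in>UNIV. \<Sum>i\<in>UNIV. cnj (X $ i $ j) * cnj (u $ j) * v $ i)"
    by (rule sum.swap)
  also have "\<dots> = (\<Sum>j\<in>UNIV. cnj (u $ j) * (conj_transpose X *v v) $ j)"
    by (simp add: matrix_vector_mult_def sum_distrib_left mult_ac)
  finally show ?thesis by (simp add: cip_def)
qed

lemma ct_adjoint: "(X *v u) \<bullet> v = u \<bullet> (conj_transpose X *v v)"
  by (simp only: inner_vec_complex cip_adjoint flip: cip_def)

lemma pos_semidef_inner: "pos_semidef X \<longleftrightarrow> hermitian X \<and> (\<forall>v. 0 \<le> v \<bullet> (X *v v))"
  by (simp add: pos_semidef_def inner_vec_complex)

definition pos_def :: "complex^'n^'n \<Rightarrow> bool" where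
  "pos_def X \<longleftrightarrow> hermitian X \<and> (\<forall>v. v \<noteq> 0 \<longrightarrow> 0 < v \<bullet> (X *v v))"

lemma pos_def_imp_psd: "pos_def X \<Longrightarrow> pos_semidef X"
  unfolding pos_def_def pos_semidef_inner by (metis inner_zero_left less_imp_le order_refl)

lemma hermitian_congruence: "hermitian X \<Longrightarrow> hermitian (conj_transpose C ** X ** C)"
  by (simp add: hermitian_def ct_mult matrix_mul_assoc)

lemma congruence_inner: "v \<bullet> ((conj_transpose C ** X ** C) *v v) = (C *v v) \<bullet> (X *v (C *v v))"
  by (metis ct_adjoint ct_ct matrix_vector_mul_assoc)

lemma psd_congruence: "pos_semidef X \<Longrightarrow> pos_semidef (conj_transpose C ** X ** C)"
  by (simp add: pos_semidef_inner hermitian_congruence congruence_inner)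

lemma pos_def_congruence:
  assumes "pos_def X" and inj: "\<And>v. C *v v = 0 \<Longrightarrow> v = 0"
  shows "pos_def (conj_transpose C ** X ** C)"
  using assms by (auto simp: pos_def_def hermitian_congruence congruence_inner)

lemma left_inverse_inj:
  fixes C :: "complex^'c^'r"
  assumes "B ** C = mat 1" "C *v v = 0" shows "v = 0"
  by (metis assms matrix_vector_mul_assoc matrix_vector_mul_lid matrix_vector_mult_0_right)

lemma invertible_inj: "invertible (C :: complex^'n^'n) \<Longrightarrow> C *v v = 0 \<Longrightarrow> v = 0"
  by (meson invertible_def left_inverse_inj)

lemma pos_def_congruence_invertible:
  fixes C :: "complex^'n^'n"
  shows "pos_def X \<Longrightarrow> invertible C \<Longrightarrow> pos_def (conj_transpose C ** X ** C)"
  by (rule pos_def_congruence) (auto intro: invertible_inj)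

lemma hermitian_add: "hermitian X \<Longrightarrow> hermitian Y \<Longrightarrow> hermitian (X + Y)"
  by (simp add: hermitian_def ct_add)

lemma psd_add: "pos_semidef X \<Longrightarrow> pos_semidef Y \<Longrightarrow> pos_semidef (X + Y)"
  by (simp add: pos_semidef_inner hermitian_add matrix_vector_mult_add_rdistrib inner_add_right)

lemma pos_def_add_psd: "pos_def X \<Longrightarrow> pos_semidef Y \<Longrightarrow> pos_def (X + Y)"
  by (simp add: pos_def_def pos_semidef_inner hermitian_add matrix_vector_mult_add_rdistrib
      inner_add_right add_pos_nonneg)

lemma scaleR_mat_vec: "(r *\<^sub>R X) *v v = r *\<^sub>R (X *v (v::complex^'n))"
  by (simp add: vec_eq_iff matrix_vector_mult_def scaleR_sum_right)

lemma scaleR_mat_mult_left: "(r *\<^sub>R X) ** Y = r *\<^sub>R (X ** (Y::complex^'n^'k))"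
  by (simp add: vec_eq_iff matrix_matrix_mult_def scaleR_sum_right)

lemma scaleR_mat_mult_right: "X ** (r *\<^sub>R Y) = r *\<^sub>R (X ** (Y::complex^'n^'k))"
  by (simp add: vec_eq_iff matrix_matrix_mult_def scaleR_sum_right)

lemma psd_scaleR: "pos_semidef X \<Longrightarrow> 0 \<le> r \<Longrightarrow> pos_semidef (r *\<^sub>R X)"
  by (simp add: pos_semidef_inner hermitian_def ct_scaleR scaleR_mat_vec)

lemma pos_def_scaleR: "pos_def X \<Longrightarrow> 0 < r \<Longrightarrow> pos_def (r *\<^sub>R X)"
  by (simp add: pos_def_def hermitian_def ct_scaleR scaleR_mat_vec)

lemma pos_def_mat_1 [simp]: "pos_def (mat 1)"
  by (simp add: pos_def_def hermitian_def)

lemma real_diag_inner: "v \<bullet> (real_diag d *v v) = (\<Sum>i\<in>UNIV. d i * (v $ i \<bullet> v $ i))"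
  by (simp add: inner_vec_def real_diag_vec inner_complex_def algebra_simps)

lemma psd_real_diag: "(\<And>i. 0 \<le> d i) \<Longrightarrow> pos_semidef (real_diag d)"
  by (simp add: pos_semidef_inner hermitian_def real_diag_inner sum_nonneg)

lemma pos_def_real_diag:
  assumes "\<And>i. 0 < d i" shows "pos_def (real_diag d)"
proof -
  have pos: "0 < v \<bullet> (real_diag d *v v)" if v: "v \<noteq> 0" for v
  proof -
    obtain i where i: "v $ i \<noteq> 0" using v by (auto simp: vec_eq_iff)
    show ?thesis unfolding real_diag_inner
      using i assms by (intro sum_pos2 [of _ i]) (auto simp: less_imp_le)
  qed
  then show ?thesis by (simp add: pos_def_def hermitian_def)
qed

lemma unitaryD:
  assumes "unitary U"
  shows "conj_transpose U ** U = mat 1" "U ** conj_transpose U = mat 1"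
  using assms by (auto simp: unitary_def)

lemma unitary_ct: "unitary U \<Longrightarrow> unitary (conj_transpose U)"
  by (auto simp: unitary_def)

lemma unitary_mult: "unitary U \<Longrightarrow> unitary V \<Longrightarrow> unitary (U ** V)"
  unfolding unitary_def ct_mult by (metis matrix_mul_assoc matrix_mul_rid)

lemma unitary_mat_1 [simp]: "unitary (mat 1)"
  by (simp add: unitary_def)

lemma unitary_invertible: "unitary U \<Longrightarrow> invertible U"
  unfolding unitary_def invertible_def by blast

lemma unitary_if_left: "conj_transpose U ** U = mat 1 \<Longrightarrow> unitary U"
  unfolding unitary_def by (simp add: matrix_left_right_inverse)

text \<open>A relation rather than a chosen decomposition, so that one \<open>U\<close> can serve a
  matrix, its powers and its shifts by multiples of the identity.\<close>

definition diagonalizes :: "complex^'n^'n \<Rightarrow> ('n \<Rightarrow> real) \<Rightarrow> complex^'n^'n \<Rightarrow> bool" where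
  "diagonalizes U d X \<longleftrightarrow> unitary U \<and> X = U ** real_diag d ** conj_transpose U"

lemma spectral_fun_diagonalizes:
  "diagonalizes U d X \<Longrightarrow> diagonalizes U (\<lambda>i. f (d i)) (spectral_fun f X)"
  unfolding diagonalizes_def using spectral_fun_eq by blast

lemma diagonalizes_psd:
  assumes "diagonalizes U d X" "\<And>i. 0 \<le> d i" shows "pos_semidef X"
  using assms psd_congruence [OF psd_real_diag, of d "conj_transpose U"]
  by (simp add: diagonalizes_def)

lemma diagonalizes_pos_def:
  assumes "diagonalizes U d X" "\<And>i. 0 < d i" shows "pos_def X"
  using assms pos_def_congruence_invertible [OF pos_def_real_diag, of d "conj_transpose U"]
  by (simp add: diagonalizes_def unitary_invertible unitary_ct)

lemma diagonalizes_eigvec: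
  assumes "diagonalizes U d X"
  shows "(X *v (U *v axis i 1)) = d i *\<^sub>R (U *v axis i 1)" "norm (U *v axis i 1) = 1"
proof -
  have U: "conj_transpose U ** U = mat 1" using assms by (simp add: diagonalizes_def unitaryD)
  have e: "real_diag d *v axis i 1 = d i *\<^sub>R axis i 1"
    by (simp add: vec_eq_iff real_diag_vec axis_def scaleR_conv_of_real [where ?'a = complex])
  have sc: "U *v (r *\<^sub>R v) = r *\<^sub>R (U *v v)" for r v
    by (simp add: vec_eq_iff matrix_vector_mult_def scaleR_sum_right)
  have "X *v (U *v axis i 1) = U *v (real_diag d *v ((conj_transpose U ** U) *v axis i 1))"
    using assms by (simp add: diagonalizes_def matrix_vector_mul_assoc matrix_mul_assoc)
  then show "(X *v (U *v axis i 1)) = d i *\<^sub>R (U *v axis i 1)" by (simp add: U e sc)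
  have "(U *v axis i 1) \<bullet> (U *v axis i 1) = axis i 1 \<bullet> (axis i (1::complex))"
    by (metis U ct_adjoint matrix_vector_mul_assoc matrix_vector_mul_lid)
  then show "norm (U *v axis i 1) = 1" by (simp add: norm_eq_sqrt_inner inner_axis_axis)
qed

lemma diagonalizes_pos:
  assumes "diagonalizes U d X" "pos_def X" shows "0 < d i"
proof -
  let ?v = "U *v axis i 1"
  have n: "norm ?v = 1" and e: "X *v ?v = d i *\<^sub>R ?v" using diagonalizes_eigvec [OF assms(1)] by auto
  then have "0 < ?v \<bullet> (X *v ?v)" using assms(2) unfolding pos_def_def by (metis norm_zero zero_neq_one)
  then show ?thesis using n by (simp add: e dot_square_norm)
qed

lemma diagonalizes_nonneg:
  assumes "diagonalizes U d X" "pos_semidef X" shows "0 \<le> d i"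
proof -
  let ?v = "U *v axis i 1"
  have n: "norm ?v = 1" and e: "X *v ?v = d i *\<^sub>R ?v" using diagonalizes_eigvec [OF assms(1)] by auto
  then have "0 \<le> ?v \<bullet> (X *v ?v)" using assms(2) unfolding pos_semidef_inner by blast
  then show ?thesis using n by (simp add: e dot_square_norm)
qed

lemma pos_def_invertible: "pos_def X \<Longrightarrow> invertible X"
proof -
  assume X: "pos_def X"
  have "X *v v = 0 \<Longrightarrow> v = 0" for v
    using X unfolding pos_def_def by (metis inner_zero_right less_irrefl)
  then have "\<exists>B. B ** X = mat 1" by (subst matrix_left_invertible_ker) blast
  then show ?thesis using matrix_left_right_inverse unfolding invertible_def by blast
qed

section \<open>The spectral theorem\<close>

text \<open>The library inner product is the real one. Since the complex product is recovered from
  it by pairing with \<open>u\<close> and with \<open>\<i> * u\<close>, results on real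
  orthogonality and dimension become applicable.\<close>

lemma cip_real_inner: "cip u v = Complex (u \<bullet> v) ((\<chi> i. \<i> * u $ i) \<bullet> v)"
  by (simp add: complex_eq_iff cip_def inner_vec_def inner_complex_def algebra_simps flip: sum_negf)

lemma cip_cnj: "cnj (cip u v) = cip v u"
  by (simp add: cip_def mult.commute)

lemma cip_simps [simp]:
  "cip u (v + w) = cip u v + cip u w" "cip u (v - w) = cip u v - cip u w" "cip u 0 = 0"
  "cip u (r *\<^sub>R v) = of_real r * cip u v" "cip (r *\<^sub>R u) v = of_real r * cip u v"
  by (simp_all add: cip_def algebra_simps sum.distrib sum_subtractf sum_distrib_left
      scaleR_conv_of_real [where ?'a = complex])

lemma inner_eq_cip: "u \<bullet> v = Re (cip u v)"
  by (simp add: cip_real_inner)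

lemma cip_self: "cip u u = of_real ((norm u)\<^sup>2)"
proof -
  have "Im (cip u u) = 0" using cip_cnj [of u u] by (metis complex_cnj_cancel_iff Reals_cnj_iff complex_is_Real_iff)
  then show ?thesis by (simp add: complex_eq_iff flip: inner_eq_cip) (simp add: dot_square_norm)
qed

text \<open>The maximizer of the quadratic form on the unit sphere of \<open>S\<close> is an
  eigenvector: it is perturbed along its own residual \<open>X v - l v\<close>, which stays in
  \<open>S\<close> by invariance, and maximality forces this residual to vanish.\<close>

lemma rayleigh_eigvec:
  assumes H: "hermitian X" and S: "subspace S" "closed S" and inv: "\<And>v. v \<in> S \<Longrightarrow> X *v v \<in> S"
    and x0: "x0 \<in> S" "x0 \<noteq> 0"
  shows "\<exists>v\<in>S. norm v = 1 \<and> (\<exists>l. X *v v = l *\<^sub>R v)"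
proof -
  let ?f = "\<lambda>v. v \<bullet> (X *v v)"
  have lin: "linear (\<lambda>v. X *v v)"
    by (rule linearI)
      (simp_all add: matrix_vector_right_distrib vec_eq_iff matrix_vector_mult_def scaleR_sum_right
        sum.distrib distrib_left)
  have sym: "(X *v u) \<bullet> v = u \<bullet> (X *v v)" for u v
    using H by (metis ct_adjoint hermitian_def)
  have "compact (S \<inter> sphere 0 1)" using S by (simp add: closed_Int_compact)
  moreover have "S \<inter> sphere 0 1 \<noteq> {}"
    using x0 S subspace_scale [of S x0 "1 / norm x0"] by force
  moreover have "continuous_on (S \<inter> sphere 0 1) ?f"
    by (intro continuous_intros linear_continuous_on linear_conv_bounded_linear [THEN iffD1] lin)
  ultimately obtain v where v: "v \<in> S" "norm v = 1"
    and max: "\<And>u. u \<in> S \<Longrightarrow> norm u = 1 \<Longrightarrow> ?f u \<le> ?f v"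
    using continuous_attains_sup [of "S \<inter> sphere 0 1" ?f] by force
  define l where "l = ?f v"
  have le: "?f u \<le> l * (u \<bullet> u)" if "u \<in> S" for u
  proof (cases "u = 0")
    case False
    let ?w = "(1 / norm u) *\<^sub>R u"
    have "?f ?w \<le> l" unfolding l_def using False that S by (intro max) (auto simp: subspace_scale)
    moreover have "?f ?w = ?f u / (norm u)\<^sup>2"
      unfolding linear_scale [OF lin] by (simp add: power2_eq_square)
    ultimately have "?f u / (norm u)\<^sup>2 \<le> l" by metis
    then show ?thesis using False by (simp add: divide_le_eq dot_square_norm)
  qed simp
  define w where "w = X *v v - l *\<^sub>R v"
  have wS: "w \<in> S" unfolding w_def using v S inv by (simp add: subspace_diff subspace_scale)
  have vv: "v \<bullet> v = 1" using v by (simp add: dot_square_norm)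
  have ineq: "2 * t * (w \<bullet> w) \<le> t\<^sup>2 * (l * (w \<bullet> w) - ?f w)" for t
  proof -
    have "v + t *\<^sub>R w \<in> S" using v wS S by (simp add: subspace_add subspace_scale)
    from le [OF this]
    have "l + 2 * t * (w \<bullet> (X *v v)) + t\<^sup>2 * ?f w \<le> l * (1 + 2 * t * (w \<bullet> v) + t\<^sup>2 * (w \<bullet> w))"
      using sym [of w v] sym [of v w]
      by (simp add: linear_add [OF lin] linear_scale [OF lin] inner_add_left inner_add_right vv
          inner_commute power2_eq_square l_def algebra_simps)
    moreover have "w \<bullet> (X *v v) = w \<bullet> w + l * (w \<bullet> v)"
      by (subst (3) w_def) (simp add: inner_diff_right)
    ultimately show ?thesis by (simp only:) (simp add: algebra_simps)
  qed
  have "w \<bullet> w \<le> 0"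
  proof (rule ccontr)
    assume "\<not> w \<bullet> w \<le> 0"
    then have pos: "0 < w \<bullet> w" by (simp only: not_le)
    define c where "c = \<bar>l * (w \<bullet> w) - ?f w\<bar> + 1"
    have c: "0 < c" by (simp add: c_def)
    \<comment> \<open>Any positive \<open>t\<close> below \<open>2 * (w \<bullet> w) / c\<close>
      contradicts \<open>ineq\<close>; this is half of that bound.\<close>
    define t where "t = (w \<bullet> w) / c"
    have t: "0 < t" using pos c by (simp add: t_def)
    have "2 * t * (w \<bullet> w) \<le> t\<^sup>2 * c"
      by (rule order_trans [OF ineq mult_left_mono]) (auto simp: c_def)
    then have "2 * (w \<bullet> w) \<le> t * c" using t by (simp add: power2_eq_square)
    then show False using pos c by (simp add: t_def)
  qed
  then have "w = 0" by (metis inner_gt_zero_iff not_le)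
  then show ?thesis using v by (auto simp: w_def)
qed

text \<open>Complex orthogonality to \<open>u i\<close> means real orthogonality to
  \<open>u i\<close> and \<open>\<i> * u i\<close>, that is, to at most \<open>2 * card I\<close>
  vectors in a space of real dimension \<open>2 * CARD('n)\<close>.\<close>

lemma cip_orthogonal_exists:
  fixes u :: "'n::finite \<Rightarrow> complex^'n"
  assumes "I \<noteq> UNIV"
  shows "\<exists>v. v \<noteq> 0 \<and> (\<forall>i\<in>I. cip (u i) v = 0)"
proof -
  let ?T = "u ` I \<union> (\<lambda>i. \<chi> j. \<i> * u i $ j) ` I"
  have "dim ?T \<le> card ?T" by (rule dim_le_card') simp
  also have "\<dots> \<le> card (u ` I) + card ((\<lambda>i. \<chi> j. \<i> * u i $ j) ` I)" by (rule card_Un_le)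
  also have "\<dots> \<le> card I + card I" by (intro add_mono card_image_le) simp_all
  also have "\<dots> < 2 * CARD('n)" using psubset_card_mono [of UNIV I] assms by (simp add: psubset_eq)
  also have "\<dots> = DIM(complex^'n)" by simp
  finally obtain v where v: "v \<noteq> 0" "\<And>y. y \<in> span ?T \<Longrightarrow> orthogonal v y"
    by (rule orthogonal_to_subspace_exists) (auto intro: that)
  have "cip (u i) v = 0" if "i \<in> I" for i
    using v(2) [of "u i"] v(2) [of "\<chi> j. \<i> * u i $ j"] that
    by (simp add: cip_real_inner complex_eq_iff span_base orthogonal_def inner_commute)
  with v(1) show ?thesis by blast
qed

text \<open>Induction on the index set: the orthogonal complement of the eigenvectors found so far
  is nonzero, and invariant because \<open>X\<close> is Hermitian, so it contains the next
  one.\<close>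

lemma hermitian_eigenbasis:
  fixes X :: "complex^'n^'n" and I :: "'n set"
  assumes H: "hermitian X"
  shows "\<exists>u d. (\<forall>i\<in>I. \<forall>j\<in>I. cip (u i) (u j) = (if i = j then 1 else 0))
    \<and> (\<forall>i\<in>I. X *v u i = d i *\<^sub>R u i)"
proof -
  have "finite I" by simp
  then show ?thesis
  proof (induction I rule: finite_induct)
    case (insert a I)
    then obtain u and d :: "'n \<Rightarrow> real"
      where "\<forall>i\<in>I. \<forall>j\<in>I. cip (u i) (u j) = (if i = j then 1 else 0)"
        and "\<forall>i\<in>I. X *v u i = d i *\<^sub>R u i" by blast
    then have on: "\<And>i j. i \<in> I \<Longrightarrow> j \<in> I \<Longrightarrow> cip (u i) (u j) = (if i = j then 1 else 0)"
      and ev: "\<And>i. i \<in> I \<Longrightarrow> X *v u i = d i *\<^sub>R u i" by blast+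
    define S where "S = {v. \<forall>i\<in>I. cip (u i) v = 0}"
    have sub: "subspace S" by (auto simp: S_def subspace_def)
    then have cl: "closed S" by (rule closed_subspace)
    have inv: "X *v v \<in> S" if "v \<in> S" for v
      using that H unfolding S_def mem_Collect_eq
      by (metis cip_adjoint ev hermitian_def cip_simps(5) mult_zero_right)
    obtain x0 where "x0 \<in> S" "x0 \<noteq> 0"
      using cip_orthogonal_exists [of I u] insert.hyps unfolding S_def by blast
    from rayleigh_eigvec [OF H sub cl inv this]
    obtain v l where v: "v \<in> S" "norm v = 1" "X *v v = l *\<^sub>R v" by blast
    have o1: "cip (u i) v = 0" if "i \<in> I" for i using v that by (simp add: S_def)
    have o2: "cip v (u i) = 0" if "i \<in> I" for i using o1 [OF that] by (metis cip_cnj complex_cnj_zero)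
    have vv: "cip v v = 1" using v by (simp add: cip_self)
    show ?case
      by (rule exI [of _ "u(a := v)"], rule exI [of _ "d(a := l)"])
        (use insert.hyps on ev v o1 o2 vv in auto)
  qed simp
qed

theorem hermitian_diagonalizes:
  fixes X :: "complex^'n^'n"
  assumes "hermitian X"
  shows "\<exists>U d. diagonalizes U d X"
proof -
  obtain u and d :: "'n \<Rightarrow> real"
    where on: "\<And>i j. cip (u i) (u j) = (if i = j then 1 else 0)"
      and ev: "\<And>i. X *v u i = d i *\<^sub>R u i"
    using hermitian_eigenbasis [OF assms, of UNIV] by auto
  define U :: "complex^'n^'n" where "U = (\<chi> i j. u j $ i)"
  have UU: "conj_transpose U ** U = mat 1"
    by (simp add: vec_eq_iff U_def matrix_matrix_mult_def mat_def flip: cip_def) (simp add: on)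
  have U: "unitary U" using UU by (rule unitary_if_left)
  have "X ** U = U ** real_diag d"
  proof -
    have "(X ** U) $ i $ j = (X *v u j) $ i" for i j
      by (simp add: U_def matrix_matrix_mult_def matrix_vector_mult_def)
    then show ?thesis
      by (simp add: vec_eq_iff real_diag_mult_right_nth ev U_def
          scaleR_conv_of_real [where ?'a = complex])
  qed
  then have "X = U ** real_diag d ** conj_transpose U"
    by (metis U matrix_mul_assoc matrix_mul_rid unitaryD(2))
  with U show ?thesis unfolding diagonalizes_def by blast
qed

lemma diagonalizes_permute:
  fixes X :: "complex^'n^'n"
  assumes X: "diagonalizes U d X" and s: "bij s"
  shows "diagonalizes (\<chi> i j. U $ i $ s j) (d \<circ> s) X"
proof -
  let ?V = "\<chi> i j. U $ i $ s j"
  have re: "(\<Sum>k\<in>UNIV. f (s k)) = sum f UNIV" for f :: "'n \<Rightarrow> complex"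
    using s by (rule sum.reindex_bij_betw)
  have U: "unitary U" using X by (simp add: diagonalizes_def)
  have "?V ** conj_transpose ?V = U ** conj_transpose U"
    by (simp add: vec_eq_iff matrix_matrix_mult_def re [of "\<lambda>k. U $ _ $ k * cnj (U $ _ $ k)"])
  then have "?V ** conj_transpose ?V = mat 1" using U by (simp add: unitaryD)
  then have "unitary ?V" by (simp add: unitary_def matrix_left_right_inverse)
  moreover have "?V ** real_diag (d \<circ> s) ** conj_transpose ?V = U ** real_diag d ** conj_transpose U"
    by (simp add: vec_eq_iff matrix_matrix_mult_def [of "_ ** _"] real_diag_mult_right_nth
        re [of "\<lambda>k. U $ _ $ k * of_real (d k) * cnj (U $ _ $ k)"])
  ultimately show ?thesis using X by (simp add: diagonalizes_def)
qed

text \<open>A fixed enumeration of the index type; eigenvalue families are compared after sorting them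
  in decreasing order along it.\<close>

definition idx :: "'n::finite \<Rightarrow> nat" where
  "idx = (SOME f. bij_betw f UNIV {..<CARD('n)})"

lemma bij_idx: "bij_betw (idx :: 'n \<Rightarrow> nat) UNIV {..<CARD('n::finite)}"
proof -
  have "\<exists>f. bij_betw f (UNIV :: 'n set) {..<CARD('n)}"
    using ex_bij_betw_finite_nat [of "UNIV :: 'n set"] by (simp add: atLeast0LessThan)
  then show ?thesis unfolding idx_def by (rule someI_ex)
qed

definition sorted_family :: "('n::finite \<Rightarrow> real) \<Rightarrow> bool" where
  "sorted_family d \<longleftrightarrow> (\<forall>i j. idx i \<le> idx j \<longrightarrow> d j \<le> d i)"

lemma sort_family:
  fixes d :: "'n::finite \<Rightarrow> real"
  shows "\<exists>s :: 'n \<Rightarrow> 'n. bij s \<and> sorted_family (d \<circ> s)"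
proof -
  obtain xs :: "'n list" where xs: "set xs = UNIV" "distinct xs"
    using finite_distinct_list [of "UNIV :: 'n set"] by auto
  define ys where "ys = sort_key (\<lambda>i. - d i) xs"
  have ys: "set ys = UNIV" "distinct ys" "sorted (map (\<lambda>i. - d i) ys)"
    using xs by (simp_all add: ys_def)
  then have len: "length ys = CARD('n)" by (metis distinct_card)
  have b1: "bij_betw ((!) ys) {..<CARD('n)} UNIV"
    using bij_betw_nth [of ys "{..<CARD('n)}" UNIV] ys len by simp
  have "bij ((!) ys \<circ> (idx :: 'n \<Rightarrow> nat))" using bij_betw_trans [OF bij_idx b1] .
  moreover have "sorted_family (d \<circ> ((!) ys \<circ> (idx :: 'n \<Rightarrow> nat)))"
    unfolding sorted_family_def
  proof (intro allI impI)
    fix i j :: 'n assume ij: "idx i \<le> idx j"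
    have "idx j < length ys" using bij_idx len by (auto simp: bij_betw_def)
    with ij sorted_nth_mono [OF ys(3), of "idx i" "idx j"]
    show "(d \<circ> ((!) ys \<circ> idx)) j \<le> (d \<circ> ((!) ys \<circ> idx)) i" by simp
  qed
  ultimately show ?thesis by blast
qed

corollary hermitian_diagonalizes_sorted:
  assumes "hermitian X"
  shows "\<exists>U d. diagonalizes U d X \<and> sorted_family d"
  by (meson assms diagonalizes_permute hermitian_diagonalizes sort_family)

section \<open>Elementary symmetric polynomials\<close>

definition esum :: "'a set \<Rightarrow> nat \<Rightarrow> ('a \<Rightarrow> real) \<Rightarrow> real" where
  "esum S k x = (\<Sum>I | I \<subseteq> S \<and> card I = k. \<Prod>i\<in>I. x i)"

text \<open>This is \<open>x a\<close> times the partial derivative of \<open>esum S k\<close> in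
  \<open>x a\<close>, in other words the derivative in \<open>ln (x a)\<close>.\<close>

definition wsum :: "'a set \<Rightarrow> nat \<Rightarrow> ('a \<Rightarrow> real) \<Rightarrow> 'a \<Rightarrow> real" where
  "wsum S k x a = (\<Sum>I | I \<subseteq> S \<and> card I = k \<and> a \<in> I. \<Prod>i\<in>I. x i)"

lemma esum_0 [simp]: "finite S \<Longrightarrow> esum S 0 x = 1"
proof -
  assume S: "finite S"
  have "{I. I \<subseteq> S \<and> card I = 0} = {{}}" using S by (auto dest: finite_subset)
  then show ?thesis by (simp add: esum_def)
qed

lemma wsum_remove:
  assumes S: "finite S" and a: "a \<in> S"
  shows "wsum S (Suc k) x a = x a * esum (S - {a}) k x"
proof -
  have "{I. I \<subseteq> S \<and> card I = Suc k \<and> a \<in> I} = insert a ` {I. I \<subseteq> S - {a} \<and> card I = k}" (is "?L = ?R")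
  proof
    show "?L \<subseteq> ?R"
    proof
      fix I assume I: "I \<in> ?L"
      then have "I = insert a (I - {a})" "I - {a} \<subseteq> S - {a}" "card (I - {a}) = k"
        using S by (auto simp: insert_absorb)
      then show "I \<in> ?R" by blast
    qed
    have "card (insert a I) = Suc (card I)" if "I \<subseteq> S - {a}" for I
      using that S by (metis Diff_iff card_insert_disjoint finite_Diff finite_subset insertI1 subsetD)
    then show "?R \<subseteq> ?L" using a by auto
  qed
  moreover have "inj_on (insert a) {I. I \<subseteq> S - {a} \<and> card I = k}"
    by (rule inj_onI) (metis (no_types, lifting) Diff_insert_absorb Diff_iff insertI1 mem_Collect_eq subsetD)
  moreover have "prod x (insert a I) = x a * prod x I" if "I \<subseteq> S - {a}" for I
    using that S by (metis Diff_iff finite_Diff finite_subset insertI1 prod.insert subsetD)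
  ultimately show ?thesis
    unfolding wsum_def esum_def by (simp add: sum.reindex sum_distrib_left)
qed

lemma esum_remove:
  assumes S: "finite S" and a: "a \<in> S"
  shows "esum S (Suc k) x = esum (S - {a}) (Suc k) x + x a * esum (S - {a}) k x"
proof -
  have "{I. I \<subseteq> S \<and> card I = Suc k} = {I. I \<subseteq> S - {a} \<and> card I = Suc k}
      \<union> {I. I \<subseteq> S \<and> card I = Suc k \<and> a \<in> I}" using a by auto
  moreover have "{I. I \<subseteq> S - {a} \<and> card I = Suc k}
      \<inter> {I. I \<subseteq> S \<and> card I = Suc k \<and> a \<in> I} = {}" by auto
  ultimately show ?thesis
    using S by (simp add: esum_def sum.union_disjoint wsum_remove [OF assms, unfolded wsum_def esum_def])
qed

text \<open>Double counting. The left side is the derivative at \<open>t = 0\<close> of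
  \<open>esum\<close> along \<open>x i * exp (t * c i)\<close>, which is how it arises in both the
  tangent inequality and the majorization argument.\<close>

lemma sum_weighted_subsets:
  assumes "finite S"
  shows "(\<Sum>I | I \<subseteq> S \<and> card I = k. (\<Prod>i\<in>I. x i) * (\<Sum>i\<in>I. c i)) = (\<Sum>i\<in>S. c i * wsum S k x i)"
proof -
  have "(\<Sum>I | I \<subseteq> S \<and> card I = k. (\<Prod>i\<in>I. x i) * (\<Sum>i\<in>I. c i))
      = (\<Sum>I | I \<subseteq> S \<and> card I = k. \<Sum>i | i \<in> S \<and> i \<in> I. c i * (\<Prod>i\<in>I. x i))"
    by (rule sum.cong [OF refl], subst sum_distrib_right [symmetric])
      (auto intro!: sum.cong simp: mult.commute)
  also have "\<dots> = (\<Sum>i\<in>S. \<Sum>I | I \<in> {I. I \<subseteq> S \<and> card I = k} \<and> i \<in> I. c i * (\<Prod>i\<in>I. x i))"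
    using assms by (intro sum.swap_restrict) simp_all
  finally show ?thesis by (simp add: wsum_def sum_distrib_left conj_assoc)
qed

text \<open>Euler's identity for a homogeneous polynomial of degree \<open>k\<close>.\<close>

lemma sum_wsum: "finite S \<Longrightarrow> (\<Sum>i\<in>S. wsum S k x i) = real k * esum S k x"
proof -
  assume S: "finite S"
  have "(\<Sum>i\<in>S. wsum S k x i) = (\<Sum>I | I \<subseteq> S \<and> card I = k. (\<Prod>i\<in>I. x i) * (\<Sum>i\<in>I. 1))"
    using sum_weighted_subsets [OF S, where c = "\<lambda>_. 1"] by simp
  also have "\<dots> = real k * esum S k x"
    by (simp add: esum_def sum_distrib_left mult.commute)
  finally show ?thesis .
qed

lemma esum_pos:
  assumes "finite S" "k \<le> card S" "\<And>i. i \<in> S \<Longrightarrow> 0 < x i"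
  shows "0 < esum S k x"
proof -
  obtain I where "I \<subseteq> S" "card I = k" using assms obtain_subset_with_card_n by metis
  then show ?thesis
    unfolding esum_def using assms by (intro sum_pos) (auto intro!: prod_pos)
qed

lemma esum_nonneg: "(\<And>i. i \<in> S \<Longrightarrow> 0 \<le> x i) \<Longrightarrow> 0 \<le> esum S k x"
  unfolding esum_def by (auto intro!: sum_nonneg prod_nonneg)

lemma esum_mono: "(\<And>i. i \<in> S \<Longrightarrow> 0 \<le> x i) \<Longrightarrow> (\<And>i. i \<in> S \<Longrightarrow> x i \<le> y i) \<Longrightarrow> esum S k x \<le> esum S k y"
  unfolding esum_def by (auto intro!: sum_mono prod_mono)

lemma esum_scale: "finite S \<Longrightarrow> esum S k (\<lambda>i. c * x i) = c ^ k * esum S k x"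
  unfolding esum_def sum_distrib_left
  by (rule sum.cong) (auto simp: prod.distrib)

section \<open>Ratios of consecutive elementary symmetric polynomials; concavity of the
  \<open>k\<close>-th root\<close>

definition eratio :: "'a set \<Rightarrow> nat \<Rightarrow> ('a \<Rightarrow> real) \<Rightarrow> real" where
  "eratio S k x = esum S (Suc k) x / esum S k x"

text \<open>Parallel sum, half the harmonic mean. If both arguments are zero, division by zero gives
  the appropriate value 0. It serves both the ratios here and the quadratic forms in Lieb's
  theorem.\<close>

definition par :: "real \<Rightarrow> real \<Rightarrow> real" where
  "par a b = a * b / (a + b)"

lemma par_superadditive:
  assumes "0 < a" "0 < b" "0 < c" "0 < d"
  shows "par a b + par c d \<le> par (a + c) (b + d)"
proof -
  have "par (a + c) (b + d) - (par a b + par c d)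
      = (a * d - b * c)\<^sup>2 / ((a + b) * (c + d) * (a + c + (b + d)))"
    using assms by (simp add: par_def divide_simps add_pos_pos power2_eq_square) algebra
  also have "\<dots> \<ge> 0" using assms by simp
  finally show ?thesis by simp
qed

lemma par_mono: "0 < a \<Longrightarrow> 0 < b \<Longrightarrow> b \<le> c \<Longrightarrow> par a b \<le> par a c"
  by (simp add: par_def divide_simps mult.commute) (simp add: algebra_simps)

text \<open>By Marcus and Lopes, \<open>k + 2\<close> times the ratio of order \<open>k + 1\<close> is the sum over \<open>i\<close> of the
  parallel sums of \<open>x i\<close> with the ratio of order \<open>k\<close> of the remaining variables.\<close>

lemma eratio_superadditive:
  assumes "finite S" "Suc k \<le> card S" "\<And>i. i \<in> S \<Longrightarrow> 0 < x i" "\<And>i. i \<in> S \<Longrightarrow> 0 < y i"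
  shows "eratio S k x + eratio S k y \<le> eratio S k (\<lambda>i. x i + y i)"
  using assms
proof (induction k arbitrary: S)
  case 0
  have "eratio S 0 z = sum z S" for z :: "'a \<Rightarrow> real"
  proof -
    have "eratio S 0 z = (\<Sum>i\<in>S. wsum S (Suc 0) z i)"
      using 0 sum_wsum [of S "Suc 0" z] by (simp add: eratio_def)
    then show ?thesis using 0 by (simp add: wsum_remove)
  qed
  then show ?case by (simp add: sum.distrib)
next
  case (Suc k)
  have card: "Suc k \<le> card (S - {i})" if "i \<in> S" for i
    using Suc.prems that by simp
  have rpos: "0 < eratio (S - {i}) k z" if "i \<in> S" "\<And>i. i \<in> S \<Longrightarrow> 0 < z i" for i z
    unfolding eratio_def using Suc.prems that card [OF that(1)] by (intro divide_pos_pos esum_pos) auto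
  have eq: "real (k + 2) * eratio S (Suc k) z = (\<Sum>i\<in>S. par (z i) (eratio (S - {i}) k z))"
    if z: "\<And>i. i \<in> S \<Longrightarrow> 0 < z i" for z
  proof -
    have "real (k + 2) * eratio S (Suc k) z = (\<Sum>i\<in>S. wsum S (Suc (Suc k)) z i / esum S (Suc k) z)"
      using sum_wsum [of S "Suc (Suc k)" z] Suc.prems(1)
      by (simp add: eratio_def flip: sum_divide_distrib)
    also have "\<dots> = (\<Sum>i\<in>S. par (z i) (eratio (S - {i}) k z))"
    proof (rule sum.cong)
      fix i assume i: "i \<in> S"
      \<comment> \<open>Splitting off \<open>i\<close> in numerator and denominator and dividing
        both by \<open>esum (S - {i}) k z\<close> gives \<open>z i * r / (r + z i)\<close> with
        \<open>r = eratio (S - {i}) k z\<close>.\<close>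
      have "0 < esum (S - {i}) k z" "0 < esum (S - {i}) (Suc k) z" "0 < z i"
        using Suc.prems z i card [OF i] by (auto intro!: esum_pos)
      then show "wsum S (Suc (Suc k)) z i / esum S (Suc k) z = par (z i) (eratio (S - {i}) k z)"
        using i Suc.prems(1)
        by (simp add: wsum_remove esum_remove [of S i k] par_def eratio_def divide_simps
            add_pos_pos add_nonneg_eq_0_iff)
    qed simp
    finally show ?thesis .
  qed
  have "real (k + 2) * (eratio S (Suc k) x + eratio S (Suc k) y)
      = (\<Sum>i\<in>S. par (x i) (eratio (S - {i}) k x) + par (y i) (eratio (S - {i}) k y))"
    using Suc.prems by (simp only: distrib_left eq sum.distrib)
  also have "\<dots> \<le> (\<Sum>i\<in>S. par (x i + y i) (eratio (S - {i}) k (\<lambda>i. x i + y i)))"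
  proof (rule sum_mono)
    fix i assume i: "i \<in> S"
    have "par (x i) (eratio (S - {i}) k x) + par (y i) (eratio (S - {i}) k y)
        \<le> par (x i + y i) (eratio (S - {i}) k x + eratio (S - {i}) k y)"
      using Suc.prems i rpos by (intro par_superadditive) auto
    also have "\<dots> \<le> par (x i + y i) (eratio (S - {i}) k (\<lambda>i. x i + y i))"
      using Suc.prems i rpos card [OF i]
      by (intro par_mono add_pos_pos Suc.IH) auto
    finally show "par (x i) (eratio (S - {i}) k x) + par (y i) (eratio (S - {i}) k y)
      \<le> par (x i + y i) (eratio (S - {i}) k (\<lambda>i. x i + y i))" .
  qed
  also have "\<dots> = real (k + 2) * eratio S (Suc k) (\<lambda>i. x i + y i)"
    using Suc.prems by (subst eq) (auto intro: add_pos_pos)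
  finally show ?case by simp
qed

text \<open>Arithmetic-geometric mean inequality, from \<open>1 + x \<le> exp x\<close> at
  \<open>x = c i / A - 1\<close>: these numbers sum to zero when \<open>A\<close> is the
  average.\<close>

lemma prod_le_avg_power:
  fixes c :: "'a \<Rightarrow> real"
  assumes "finite T" "T \<noteq> {}" "\<And>i. i \<in> T \<Longrightarrow> 0 < c i"
  shows "(\<Prod>i\<in>T. c i) \<le> ((\<Sum>i\<in>T. c i) / card T) ^ card T"
proof -
  define A where "A = (\<Sum>i\<in>T. c i) / card T"
  have n: "0 < card T" using assms by (simp add: card_gt_0_iff)
  have A: "0 < A" unfolding A_def using assms n by (intro divide_pos_pos sum_pos) auto
  have "c i / A \<le> exp (c i / A - 1)" for i using exp_ge_add_one_self [of "c i / A - 1"] by simp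
  then have "(\<Prod>i\<in>T. c i / A) \<le> (\<Prod>i\<in>T. exp (c i / A - 1))"
    using assms A by (intro prod_mono) (auto intro: less_imp_le)
  also have "\<dots> = exp (\<Sum>i\<in>T. c i / A - 1)" using assms by (simp add: exp_sum)
  also have "(\<Sum>i\<in>T. c i / A - 1) = 0"
  proof -
    have "(\<Sum>i\<in>T. c i) = A * card T" using n by (simp add: A_def)
    then show ?thesis using A by (simp add: sum_subtractf flip: sum_divide_distrib)
  qed
  finally show ?thesis using A by (simp add: prod_dividef divide_le_eq flip: A_def)
qed

lemma one_plus_sum_le_prod:
  fixes c :: "'a \<Rightarrow> real"
  assumes "finite T" "\<And>i. i \<in> T \<Longrightarrow> 0 \<le> c i"
  shows "1 + (\<Sum>i\<in>T. c i) \<le> (\<Prod>i\<in>T. 1 + c i)"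
  using assms
proof (induction T rule: finite_induct)
  case (insert a T)
  have "1 + (c a + sum c T) \<le> (1 + c a) * (1 + sum c T)"
    using insert.prems by (simp add: algebra_simps sum_nonneg)
  also have "\<dots> \<le> (1 + c a) * (\<Prod>i\<in>T. 1 + c i)"
    using insert by (intro mult_left_mono) auto
  finally show ?case using insert.hyps by simp
qed simp

lemma slope_le_deriv:
  fixes g :: "real \<Rightarrow> real"
  assumes D: "(g has_real_derivative D) (at 0)" and le: "\<And>t. 0 < t \<Longrightarrow> g 0 + t * C \<le> g t"
  shows "C \<le> D"
proof (rule ccontr)
  assume "\<not> C \<le> D"
  moreover have "((\<lambda>t. g t - t * C) has_real_derivative D - C) (at 0)"
    by (auto intro!: derivative_eq_intros D)
  ultimately obtain d where "0 < d" "\<And>h. 0 < h \<Longrightarrow> h < d \<Longrightarrow> g (0 + h) - (0 + h) * C < g 0 - 0 * C"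
    using DERIV_neg_dec_right [of "\<lambda>t. g t - t * C" "D - C" 0] by auto
  from this(2) [of "d / 2"] this(1) le [of "d / 2"] show False by simp
qed

lemma esum_eq_prod_eratio:
  assumes "finite S" "k \<le> card S" "\<And>i. i \<in> S \<Longrightarrow> 0 < x i"
  shows "esum S k x = (\<Prod>j<k. eratio S j x)"
  using assms
proof (induction k)
  case (Suc k)
  have "0 < esum S k x" using Suc.prems by (intro esum_pos) auto
  then have "esum S (Suc k) x = esum S k x * eratio S k x" by (simp add: eratio_def)
  with Suc show ?case by simp
qed simp

lemma eratio_pos:
  assumes "finite S" "k < card S" "\<And>i. i \<in> S \<Longrightarrow> 0 < x i"
  shows "0 < eratio S k x"
  unfolding eratio_def using assms by (intro divide_pos_pos esum_pos) auto

text \<open>Tangent inequality at \<open>x\<close> for the concave function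
  \<open>root k (esum S k y)\<close> of \<open>y\<close>, with denominators cleared. Superadditivity
  of the ratios bounds \<open>esum\<close> at \<open>x + t y\<close> below by \<open>?e\<close>
  times the product of the \<open>1 + t * c j\<close>; its slope in \<open>t\<close> involves the
  sum of the \<open>c j\<close>, which dominates \<open>k\<close> times their geometric
  mean.\<close>

lemma esum_root_tangent:
  assumes S: "finite S" and k: "0 < k" "k \<le> card S"
    and x: "\<And>i. i \<in> S \<Longrightarrow> 0 < x i" and y: "\<And>i. i \<in> S \<Longrightarrow> 0 < y i"
  shows "root k (esum S k y / esum S k x) * (real k * esum S k x) \<le> (\<Sum>i\<in>S. y i / x i * wsum S k x i)"
proof -
  let ?e = "esum S k x"
  let ?P = "{I. I \<subseteq> S \<and> card I = k}"
  \<comment> \<open>By telescoping, the product of the \<open>c j\<close> over \<open>j < k\<close>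
    is \<open>esum S k y / esum S k x\<close>.\<close>
  define c where "c j = eratio S j y / eratio S j x" for j
  have rp: "0 < eratio S j x" "0 < eratio S j y" if "j < k" for j
    using that S k x y by (auto intro!: eratio_pos)
  have c: "0 < c j" if "j < k" for j using rp [OF that] by (simp add: c_def)
  have e: "0 < ?e" using S k x by (intro esum_pos)
  have prod_c: "(\<Prod>j<k. c j) = esum S k y / ?e"
    using S k x y by (simp add: c_def esum_eq_prod_eratio prod_dividef)
  have kc: "real k * root k (esum S k y / ?e) \<le> (\<Sum>j<k. c j)"
  proof -
    have "root k (\<Prod>j<k. c j) \<le> root k (((\<Sum>j<k. c j) / k) ^ k)"
      using prod_le_avg_power [of "{..<k}" c] k c by (intro real_root_le_mono) auto
    also have "\<dots> = (\<Sum>j<k. c j) / k"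
      using k sum_nonneg [of "{..<k}" c] c by (intro real_root_power_cancel) (auto simp: less_imp_le)
    finally show ?thesis using k by (simp add: prod_c field_simps)
  qed
  \<comment> \<open>An upper bound for \<open>esum\<close> at \<open>x + t y\<close> that agrees
    with it at \<open>t = 0\<close> and has the same slope there; as a sum of exponentials it is
    easy to differentiate.\<close>
  define g where "g t = (\<Sum>I\<in>?P. (\<Prod>i\<in>I. x i) * exp (t * (\<Sum>i\<in>I. y i / x i)))" for t
  have g0: "g 0 = ?e" by (simp add: g_def esum_def)
  have le: "g 0 + t * (?e * (\<Sum>j<k. c j)) \<le> g t" if t: "0 < t" for t
  proof -
    have sc: "eratio S j (\<lambda>i. t * y i) = t * eratio S j y" for j
      using S t by (simp add: eratio_def esum_scale)
    have "?e * (1 + (\<Sum>j<k. t * c j)) \<le> ?e * (\<Prod>j<k. 1 + t * c j)"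
      using e t c by (intro mult_left_mono one_plus_sum_le_prod) (auto intro: less_imp_le)
    also have "\<dots> = (\<Prod>j<k. eratio S j x * (1 + t * c j))"
      using S k x by (simp add: esum_eq_prod_eratio prod.distrib)
    also have "\<dots> = (\<Prod>j<k. eratio S j x + eratio S j (\<lambda>i. t * y i))"
    proof (rule prod.cong)
      fix j assume "j \<in> {..<k}"
      then have "0 < eratio S j x" using rp by simp
      then show "eratio S j x * (1 + t * c j) = eratio S j x + eratio S j (\<lambda>i. t * y i)"
        by (simp add: c_def sc field_simps)
    qed simp
    also have "\<dots> \<le> (\<Prod>j<k. eratio S j (\<lambda>i. x i + t * y i))"
      using rp S k x y t
      by (intro prod_mono conjI eratio_superadditive add_nonneg_nonneg) (auto simp: sc less_imp_le)
    also have "\<dots> = esum S k (\<lambda>i. x i + t * y i)"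
      using S k x y t by (intro esum_eq_prod_eratio [symmetric]) (auto intro: add_pos_pos)
    also have "\<dots> \<le> g t"
      unfolding esum_def g_def
    proof (rule sum_mono)
      fix I assume I: "I \<in> ?P"
      then have fin: "finite I" using S by (auto dest: finite_subset)
      have "(\<Prod>i\<in>I. x i + t * y i) = (\<Prod>i\<in>I. x i * (1 + t * (y i / x i)))"
        using I x by (intro prod.cong) (force simp: field_simps)+
      also have "\<dots> = (\<Prod>i\<in>I. x i) * (\<Prod>i\<in>I. 1 + t * (y i / x i))"
        by (rule prod.distrib)
      also have "\<dots> \<le> (\<Prod>i\<in>I. x i) * (\<Prod>i\<in>I. exp (t * (y i / x i)))"
      proof (intro mult_left_mono prod_mono conjI exp_ge_add_one_self prod_nonneg)
        fix i assume "i \<in> I"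
        then have "0 < x i" "0 < y i" using I x y by auto
        then show "0 \<le> 1 + t * (y i / x i)" "0 \<le> x i" using t by simp_all
      qed
      also have "(\<Prod>i\<in>I. exp (t * (y i / x i))) = exp (t * (\<Sum>i\<in>I. y i / x i))"
        using fin by (simp add: exp_sum sum_distrib_left)
      finally show "(\<Prod>i\<in>I. x i + t * y i) \<le> (\<Prod>i\<in>I. x i) * exp (t * (\<Sum>i\<in>I. y i / x i))" .
    qed
    finally show ?thesis unfolding sum_distrib_left [symmetric] by (simp add: g0 algebra_simps)
  qed
  have "((\<lambda>t. a * exp (t * b)) has_real_derivative b * a) (at 0)" for a b :: real
    by (auto intro!: derivative_eq_intros)
  then have deriv: "(g has_real_derivative (\<Sum>I\<in>?P. (\<Sum>i\<in>I. y i / x i) * (\<Prod>i\<in>I. x i))) (at 0)"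
    unfolding g_def by (intro DERIV_sum)
  have "?e * (\<Sum>j<k. c j) \<le> (\<Sum>I\<in>?P. (\<Sum>i\<in>I. y i / x i) * (\<Prod>i\<in>I. x i))"
    by (rule slope_le_deriv [OF deriv le])
  also have "\<dots> = (\<Sum>I\<in>?P. (\<Prod>i\<in>I. x i) * (\<Sum>i\<in>I. y i / x i))"
    by (simp add: mult.commute)
  also have "\<dots> = (\<Sum>i\<in>S. y i / x i * wsum S k x i)" using S by (rule sum_weighted_subsets)
  finally have up: "?e * (\<Sum>j<k. c j) \<le> (\<Sum>i\<in>S. y i / x i * wsum S k x i)" .
  have "root k (esum S k y / ?e) * (real k * ?e) = ?e * (real k * root k (esum S k y / ?e))" by simp
  also have "\<dots> \<le> ?e * (\<Sum>j<k. c j)" using kc e by (intro mult_left_mono) auto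
  also note up
  finally show ?thesis .
qed

section \<open>Summation by parts and weak log majorization\<close>

lemma abel_nonneg:
  fixes w c :: "nat \<Rightarrow> real"
  assumes "\<And>i j. i \<le> j \<Longrightarrow> j < m \<Longrightarrow> w j \<le> w i" "\<And>i. i < m \<Longrightarrow> 0 \<le> w i"
    and "\<And>j. j \<le> m \<Longrightarrow> 0 \<le> (\<Sum>i<j. c i)"
  shows "0 \<le> (\<Sum>i<m. w i * c i)"
  using assms
proof (induction m arbitrary: w)
  case (Suc m)
  \<comment> \<open>The smallest weight \<open>w m\<close> is split off from all the others. What
    remains is still decreasing and nonnegative, and \<open>w m\<close> multiplies a full partial
    sum.\<close>
  have "0 \<le> (\<Sum>i<m. (w i - w m) * c i)"
    using Suc.prems by (intro Suc.IH) (auto simp: diff_le_mono)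
  moreover have "0 \<le> w m * (\<Sum>i<Suc m. c i)"
    using Suc.prems(2) [of m] Suc.prems(3) [of "Suc m"] by (intro mult_nonneg_nonneg) auto
  ultimately show ?case
    by (simp add: algebra_simps sum_subtractf sum_distrib_left)
qed simp

lemma abel_nonneg_family:
  fixes w c :: "'n::finite \<Rightarrow> real"
  assumes w: "sorted_family w" "\<And>i. 0 \<le> w i"
    and c: "\<And>j. 0 \<le> (\<Sum>i | idx i < j. c i)"
  shows "0 \<le> (\<Sum>i\<in>UNIV. w i * c i)"
proof -
  let ?g = "inv_into (UNIV :: 'n set) idx"
  have b: "bij_betw ?g {..<CARD('n)} UNIV" using bij_idx by (rule bij_betw_inv_into)
  have idx_g: "idx (?g t) = t" if "t < CARD('n)" for t
    using that by (metis bij_betw_inv_into_right bij_idx lessThan_iff)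
  have g_idx: "?g (idx i) = i" for i using bij_idx by (metis UNIV_I bij_betw_inv_into_left)
  have "0 \<le> (\<Sum>t<CARD('n). w (?g t) * c (?g t))"
  proof (rule abel_nonneg)
    fix j assume j: "j \<le> CARD('n)"
    have "{i. idx i < j} = ?g ` {..<j}"
    proof
      show "{i. idx i < j} \<subseteq> ?g ` {..<j}" using g_idx by (metis (no_types, lifting) image_iff lessThan_iff mem_Collect_eq subsetI)
      show "?g ` {..<j} \<subseteq> {i. idx i < j}" using idx_g j by auto
    qed
    moreover have "inj_on ?g {..<j}" using b j by (auto simp: bij_betw_def inj_on_def)
    ultimately show "0 \<le> (\<Sum>i<j. c (?g i))" using c [of j] by (simp add: sum.reindex)
  qed (use w idx_g in \<open>auto simp: sorted_family_def\<close>)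
  also have "\<dots> = (\<Sum>i\<in>UNIV. w i * c i)"
    using b by (rule sum.reindex_bij_betw)
  finally show ?thesis .
qed

lemma wsum_nonneg: "(\<And>i. i \<in> S \<Longrightarrow> 0 \<le> x i) \<Longrightarrow> 0 \<le> wsum S k x a"
  unfolding wsum_def by (auto intro!: sum_nonneg prod_nonneg)

lemma wsum_pos:
  assumes "finite S" "a \<in> S" "0 < k" "k \<le> card S" "\<And>i. i \<in> S \<Longrightarrow> 0 < x i"
  shows "0 < wsum S k x a"
proof -
  obtain k' where "k = Suc k'" using assms(3) by (cases k) auto
  then show ?thesis using assms by (auto simp: wsum_remove intro!: mult_pos_pos esum_pos)
qed

text \<open>Isolates the dependence on two variables: \<open>p\<close> and \<open>q\<close> are the
  elementary symmetric polynomials of orders \<open>k - 1\<close> and \<open>k - 2\<close> in the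
  others, with \<open>q = 0\<close> when \<open>k = 1\<close>.\<close>

lemma wsum_pair:
  assumes S: "finite S" and ab: "a \<in> S" "b \<in> S" "a \<noteq> b" and x: "\<And>i. i \<in> S \<Longrightarrow> 0 \<le> x i"
    and k: "0 < k"
  obtains p q where "0 \<le> p" "0 \<le> q" "wsum S k x a = x a * (p + x b * q)"
    "wsum S k x b = x b * (p + x a * q)"
proof (cases k)
  case (Suc k')
  show ?thesis
  proof (cases k')
    case 0
    show ?thesis by (rule that [of 1 0]) (use S ab Suc 0 in \<open>auto simp: wsum_remove\<close>)
  next
    case Suc': (Suc k'')
    have eq: "S - {b} - {a} = S - {a} - {b}" by blast
    show ?thesis
    proof (rule that)
      show "wsum S k x a = x a * (esum (S - {a} - {b}) k' x + x b * esum (S - {a} - {b}) k'' x)"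
        using S ab by (simp add: Suc Suc' wsum_remove esum_remove [of "S - {a}" b])
      show "wsum S k x b = x b * (esum (S - {a} - {b}) k' x + x a * esum (S - {a} - {b}) k'' x)"
        using S ab by (simp add: Suc Suc' wsum_remove esum_remove [of "S - {b}" a] eq)
    qed (use x in \<open>auto intro!: esum_nonneg\<close>)
  qed
qed (use k in simp)

text \<open>The second inequality says that \<open>x / wsum\<close> increases with \<open>x\<close>,
  without denominators and times a further \<open>x b\<close>, which is cancelled where
  \<open>x b\<close> is known to be positive.\<close>

lemma wsum_mono:
  assumes "finite S" "a \<in> S" "b \<in> S" "\<And>i. i \<in> S \<Longrightarrow> 0 \<le> x i" "0 < k" "x b \<le> x a"
  shows "wsum S k x b \<le> wsum S k x a" "x b * wsum S k x a * x b \<le> x a * wsum S k x b * x b"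
proof -
  have "wsum S k x b \<le> wsum S k x a \<and> x b * wsum S k x a * x b \<le> x a * wsum S k x b * x b"
  proof (cases "a = b")
    case False
    obtain p q where pq: "0 \<le> p" "0 \<le> q" "wsum S k x a = x a * (p + x b * q)"
      "wsum S k x b = x b * (p + x a * q)" using wsum_pair assms False by metis
    have "x b * p \<le> x a * p" using pq assms by (intro mult_right_mono)
    moreover have "x b * wsum S k x a * x b \<le> x a * wsum S k x b * x b"
    proof -
      have "p + x b * q \<le> p + x a * q" using pq assms by (intro add_left_mono mult_right_mono)
      then have "(x a * x b * x b) * (p + x b * q) \<le> (x a * x b * x b) * (p + x a * q)"
        using assms by (intro mult_left_mono mult_nonneg_nonneg) auto
      then show ?thesis by (simp add: pq mult_ac)
    qed
    ultimately show ?thesis by (simp add: pq algebra_simps)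
  qed simp
  then show "wsum S k x b \<le> wsum S k x a" "x b * wsum S k x a * x b \<le> x a * wsum S k x b * x b"
    by auto
qed

lemma wsum_sorted:
  fixes x :: "'n::finite \<Rightarrow> real"
  assumes x: "sorted_family x" "\<And>i. 0 \<le> x i" and k: "0 < k"
  shows "sorted_family (wsum UNIV k x)"
  using assms wsum_mono(1) [of UNIV _ _ x k] unfolding sorted_family_def by simp

text \<open>Together with \<open>wsum_sorted\<close> this says that the logarithmic gradient
  increases with \<open>x\<close>, but no faster than \<open>x\<close> does. The middle factor of
  the Horn inequality is sorted for this reason.\<close>

lemma ratio_wsum_sorted:
  fixes x :: "'n::finite \<Rightarrow> real"
  assumes x: "sorted_family x" "\<And>i. 0 < x i" and k: "0 < k" "k \<le> CARD('n)"
  shows "sorted_family (\<lambda>i. x i / wsum UNIV k x i)"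
  unfolding sorted_family_def
proof (intro allI impI)
  fix i j :: 'n assume "idx i \<le> idx j"
  then have "x j \<le> x i" using x by (simp add: sorted_family_def)
  then have "x j * wsum UNIV k x i * x j \<le> x i * wsum UNIV k x j * x j"
    using x k by (intro wsum_mono) (auto intro: less_imp_le)
  then have "x j * wsum UNIV k x i \<le> x i * wsum UNIV k x j"
    by (rule mult_right_le_imp_le [OF _ x(2)])
  moreover have "0 < wsum UNIV k x l" for l using x k by (intro wsum_pos) auto
  ultimately show "x j / wsum UNIV k x j \<le> x i / wsum UNIV k x i"
    by (simp add: divide_simps)
qed

text \<open>The map \<open>esum\<close> is convex in the logarithms of its variables, with gradient \<open>wsum\<close>.\<close>

lemma esum_weak_log_majorization:
  fixes u v :: "'n::finite \<Rightarrow> real"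
  assumes u: "sorted_family u" "\<And>i. 0 < u i" and v: "\<And>i. 0 < v i" and k: "0 < k"
    and maj: "\<And>j. (\<Prod>i | idx i < j. u i) \<le> (\<Prod>i | idx i < j. v i)"
  shows "esum UNIV k u \<le> esum UNIV k v"
proof -
  let ?c = "\<lambda>i. ln (v i) - ln (u i)"
  have nz: "u i \<noteq> 0" "v i \<noteq> 0" for i using u v by (metis less_irrefl)+
  \<comment> \<open>The gradient at the sorted point \<open>u\<close> is itself sorted, so Abel
    summation asks only for nonnegative prefix sums of \<open>?c\<close>, which are the logarithms
    of \<open>maj\<close>.\<close>
  have "0 \<le> (\<Sum>i\<in>UNIV. wsum UNIV k u i * ?c i)"
  proof (rule abel_nonneg_family)
    fix j
    have "ln (\<Prod>i | idx i < j. u i) \<le> ln (\<Prod>i | idx i < j. v i)"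
      using u v maj [of j] by (subst ln_le_cancel_iff) (auto intro!: prod_pos)
    then show "0 \<le> (\<Sum>i | idx i < j. ?c i)"
      using nz by (simp add: ln_prod sum_subtractf)
  qed (use u k in \<open>auto intro!: wsum_sorted wsum_nonneg simp: less_imp_le\<close>)
  also have "\<dots> = (\<Sum>I | I \<subseteq> UNIV \<and> card I = k. (\<Prod>i\<in>I. u i) * (\<Sum>i\<in>I. ?c i))"
    by (simp add: sum_weighted_subsets [where S = UNIV, simplified] mult.commute)
  also have "\<dots> \<le> (\<Sum>I | I \<subseteq> UNIV \<and> card I = k. (\<Prod>i\<in>I. v i) - (\<Prod>i\<in>I. u i))"
  proof (rule sum_mono)
    fix I :: "'n set"
    have "(\<Sum>i\<in>I. ?c i) = ln (\<Prod>i\<in>I. v i) - ln (\<Prod>i\<in>I. u i)"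
      using nz by (simp add: ln_prod sum_subtractf)
    then have "(\<Prod>i\<in>I. v i) = (\<Prod>i\<in>I. u i) * exp (\<Sum>i\<in>I. ?c i)"
      using u v nz by (simp add: exp_diff prod_pos)
    moreover have "(\<Prod>i\<in>I. u i) * (1 + (\<Sum>i\<in>I. ?c i)) \<le> (\<Prod>i\<in>I. u i) * exp (\<Sum>i\<in>I. ?c i)"
      using u by (intro mult_left_mono exp_ge_add_one_self) (auto intro!: prod_nonneg simp: less_imp_le)
    ultimately show "(\<Prod>i\<in>I. u i) * (\<Sum>i\<in>I. ?c i) \<le> (\<Prod>i\<in>I. v i) - (\<Prod>i\<in>I. u i)"
      by (simp add: algebra_simps)
  qed
  finally show ?thesis by (simp add: esum_def sum_subtractf)
qed

section \<open>Determinants and the inequality of Horn\<close>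

lemma matrix_add_rdistrib: "((A + B) ** C) = (A ** C) + (B ** (C :: complex^'p^'n))"
  by (simp add: vec_eq_iff matrix_matrix_mult_def sum.distrib distrib_right)

lemma matrix_sub_ldistrib: "(A ** (B - C)) = (A ** B) - (A ** (C :: complex^'p^'n))"
  by (simp add: vec_eq_iff matrix_matrix_mult_def sum_subtractf right_diff_distrib)

lemma matrix_sub_rdistrib: "((A - B) ** C) = (A ** C) - (B ** (C :: complex^'p^'n))"
  by (simp add: vec_eq_iff matrix_matrix_mult_def sum_subtractf left_diff_distrib)

lemma invertible_real_diag: "(\<And>i. d i \<noteq> 0) \<Longrightarrow> invertible (real_diag d)"
  using real_diag_inverse [of d] by (auto simp: invertible_def)

lemma invertible_ct: "invertible C \<Longrightarrow> invertible (conj_transpose C)"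
  unfolding invertible_def by (metis ct_mat_1 ct_mult)

lemma det_diagonalizes:
  assumes "diagonalizes U d X"
  shows "det X = of_real (\<Prod>i\<in>UNIV. d i)"
proof -
  have U: "unitary U" and X: "X = U ** real_diag d ** conj_transpose U"
    using assms by (auto simp: diagonalizes_def)
  have "det X = det (U ** conj_transpose U) * det (real_diag d)"
    by (simp add: X det_mul)
  also have "\<dots> = det (real_diag d)" using U by (simp add: unitaryD)
  also have "\<dots> = (\<Prod>i\<in>UNIV. real_diag d $ i $ i)"
    by (rule det_diagonal) (simp add: real_diag_def)
  finally show ?thesis by (simp add: real_diag_def)
qed

lemma det_real_diag: "det (real_diag d) = of_real (\<Prod>i\<in>UNIV. d i)"
  using det_diagonalizes [of "mat 1" d "real_diag d"] by (simp add: diagonalizes_def)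

lemma det_ct: "det (conj_transpose X) = cnj (det X)"
proof -
  have "det (conj_transpose X) = det (transpose (conj_transpose X))" by simp
  also have "\<dots> = cnj (det X)"
    by (simp add: det_def transpose_def)
  finally show ?thesis .
qed

lemma det_pos_def:
  assumes "pos_def X" shows "det X = of_real (Re (det X))" "0 < Re (det X)"
proof -
  obtain U d where d: "diagonalizes U d X"
    using assms hermitian_diagonalizes pos_def_def by blast
  then show "det X = of_real (Re (det X))" by (simp add: det_diagonalizes)
  show "0 < Re (det X)"
    using diagonalizes_pos [OF d assms] by (simp add: det_diagonalizes [OF d] prod_pos flip: of_real_prod)
qed

lemma det_1_add_psd:
  assumes "pos_semidef D" shows "1 \<le> Re (det (mat 1 + D))"
proof -
  obtain U d where d: "diagonalizes U d D"
    using assms hermitian_diagonalizes pos_semidef_inner by blast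
  then have "diagonalizes U (\<lambda>i. 1 + d i) (mat 1 + D)"
    by (simp add: diagonalizes_def unitaryD matrix_add_ldistrib matrix_add_rdistrib flip: real_diag_add)
  then have "Re (det (mat 1 + D)) = (\<Prod>i\<in>UNIV. 1 + d i)"
    by (simp only: det_diagonalizes Re_complex_of_real)
  also have "\<dots> \<ge> 1" using diagonalizes_nonneg [OF d assms] by (intro prod_ge_1) simp
  finally show ?thesis .
qed

lemma pos_def_whitening:
  fixes X :: "complex^'n^'n"
  assumes "pos_def X"
  shows "\<exists>R :: complex^'n^'n. invertible R \<and> conj_transpose R ** X ** R = mat 1"
proof -
  obtain U d where d: "diagonalizes U d X"
    using assms hermitian_diagonalizes pos_def_def by blast
  have pos: "0 < d i" for i using diagonalizes_pos [OF d assms] .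
  have U: "unitary U" and X: "X = U ** real_diag d ** conj_transpose U"
    using d by (auto simp: diagonalizes_def)
  define R where "R = U ** real_diag (\<lambda>i. 1 / sqrt (d i))"
  have nz: "d i \<noteq> 0" for i using pos [of i] by simp
  have "invertible R" unfolding R_def
    by (intro invertible_mult unitary_invertible [OF U] invertible_real_diag) (simp add: nz)
  moreover have "conj_transpose R ** X ** R = real_diag (\<lambda>i. 1 / sqrt (d i)) ** (conj_transpose U ** U)
      ** real_diag d ** (conj_transpose U ** U) ** real_diag (\<lambda>i. 1 / sqrt (d i))"
    by (simp add: R_def X ct_mult matrix_mul_assoc)
  moreover have "\<dots> = real_diag (\<lambda>i. 1 / sqrt (d i) * d i * (1 / sqrt (d i)))"
    using U by (simp add: unitaryD real_diag_mult)
  moreover have "1 / sqrt (d i) * d i * (1 / sqrt (d i)) = 1" for i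
    using pos [of i] by (simp add: field_simps)
  ultimately show ?thesis by auto
qed

text \<open>A congruence by \<open>R\<close> turns \<open>P\<close> into the identity, where
  \<open>det_1_add_psd\<close> applies; both determinants change by the same factor, the squared
  modulus of \<open>det R\<close>.\<close>

lemma det_mono:
  fixes P D :: "complex^'n^'n"
  assumes P: "pos_def P" and D: "pos_semidef D"
  shows "Re (det P) \<le> Re (det (P + D))"
proof -
  obtain R :: "complex^'n^'n" where R: "invertible R" "conj_transpose R ** P ** R = mat 1"
    using pos_def_whitening [OF P] by blast
  have PD: "pos_def (P + D)" using P D by (rule pos_def_add_psd)
  define c where "c = cmod (det R) ^ 2"
  have cong: "det (conj_transpose R ** X ** R) = of_real c * det X" for X
    by (simp add: det_mul det_ct c_def complex_norm_square mult_ac flip: of_real_power)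
  have "c * Re (det P) = 1" using arg_cong [OF cong [of P], of Re] R by simp
  moreover have "1 \<le> Re (det (mat 1 + conj_transpose R ** D ** R))"
    by (intro det_1_add_psd psd_congruence D)
  moreover have "mat 1 + conj_transpose R ** D ** R = conj_transpose R ** (P + D) ** R"
    using R by (simp add: matrix_add_ldistrib matrix_add_rdistrib)
  ultimately have "c * Re (det P) \<le> c * Re (det (P + D))" by (simp add: cong)
  moreover have "0 < c" using R by (simp add: c_def invertible_det_nz)
  ultimately show ?thesis by simp
qed

text \<open>For idempotent \<open>E\<close>, Sylvester's determinant identity follows by factoring \<open>1 + W E\<close> as
  \<open>(1 + E W E) (1 + 2 N)\<close> with \<open>2 N = (1 - E) W E\<close>. Here \<open>1 + 2 N = (1 + N)\<^sup>2\<close>, and \<open>1 + N\<close> is conjugate to its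
  own inverse \<open>1 - N\<close> by \<open>1 - 2 E\<close>.\<close>

lemma det_1_add_square_zero:
  fixes E W :: "complex^'n^'n"
  assumes E: "E ** E = E"
  shows "det (mat 1 + (mat 1 - E) ** W ** E) = 1"
proof -
  define N where "N = (1 / 2) *\<^sub>R ((mat 1 - E) ** W ** E)"
  define F where "F = mat 1 - E - E"
  have EF: "E ** (mat 1 - E) = 0" using E by (simp add: matrix_sub_ldistrib)
  have "E ** ((mat 1 - E) ** W ** E) = 0"
    by (simp add: matrix_mul_assoc EF)
  then have EN: "E ** N = 0" by (simp add: N_def scaleR_mat_mult_right)
  have NE: "N ** E = N" using E by (simp add: N_def scaleR_mat_mult_left flip: matrix_mul_assoc)
  have NN: "N ** N = 0" by (metis EN NE matrix_mul_assoc times0_right)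
  have FF: "F ** F = mat 1"
    by (simp only: F_def matrix_sub_ldistrib matrix_sub_rdistrib E matrix_mul_lid matrix_mul_rid) simp
  have FN: "F ** N = N" by (simp only: F_def matrix_sub_rdistrib EN matrix_mul_lid) simp
  have NF: "N ** F = - N" by (simp only: F_def matrix_sub_ldistrib NE matrix_mul_rid) simp
  have "F ** (mat 1 + N) ** F = F ** F + F ** N ** F"
    by (simp add: matrix_add_ldistrib matrix_add_rdistrib)
  also have "\<dots> = mat 1 - N" by (simp add: FF FN NF)
  finally have "F ** (mat 1 + N) ** F = mat 1 - N" .
  then have "det (mat 1 - N) = det F * det (mat 1 + N) * det F" by (metis det_mul)
  also have "\<dots> = det (F ** F) * det (mat 1 + N)" by (simp add: det_mul)
  finally have eq: "det (mat 1 - N) = det (mat 1 + N)" by (simp add: FF)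
  have "(mat 1 + N) ** (mat 1 - N) = mat 1"
    by (simp add: NN matrix_sub_ldistrib matrix_add_rdistrib)
  then have "det (mat 1 + N) * det (mat 1 - N) = 1" by (metis det_I det_mul)
  moreover have "(mat 1 + N) ** (mat 1 + N) = mat 1 + (mat 1 - E) ** W ** E"
    by (simp add: NN matrix_add_ldistrib matrix_add_rdistrib)
      (simp add: N_def flip: scaleR_add_left)
  ultimately show ?thesis by (metis det_mul eq)
qed

lemma det_sylvester_idempotent:
  fixes E W :: "complex^'n^'n"
  assumes E: "E ** E = E"
  shows "det (mat 1 + E ** W ** E) = det (mat 1 + W ** E)"
proof -
  have EF: "E ** (mat 1 - E) = 0" using E by (simp add: matrix_sub_ldistrib)
  have "(mat 1 + E ** W ** E) ** (mat 1 + (mat 1 - E) ** W ** E)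
      = mat 1 + E ** W ** E + (mat 1 - E) ** W ** E + E ** W ** (E ** (mat 1 - E)) ** W ** E"
    by (simp add: matrix_add_ldistrib matrix_add_rdistrib matrix_mul_assoc)
  also have "\<dots> = mat 1 + W ** E"
    by (simp add: EF matrix_sub_rdistrib)
  finally show ?thesis by (metis det_1_add_square_zero [OF E] det_mul mult.right_neutral)
qed

text \<open>For invertible \<open>B\<close> the two matrices are similar by means of
  \<open>B\<close>.\<close>

lemma det_1_add_conj:
  fixes B W :: "complex^'n^'n"
  assumes "invertible B"
  shows "det (mat 1 + B ** W) = det (mat 1 + W ** B)"
proof -
  have "(mat 1 + B ** W) ** B = B ** (mat 1 + W ** B)"
    by (simp add: matrix_add_ldistrib matrix_add_rdistrib matrix_mul_assoc)
  then have "det (mat 1 + B ** W) * det B = det B * det (mat 1 + W ** B)" by (metis det_mul)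
  then show ?thesis using assms by (simp add: invertible_det_nz)
qed

section \<open>Principal minors under congruence\<close>

definition proj :: "'n set \<Rightarrow> complex^'n^'n" where
  "proj J = real_diag (\<lambda>i. if i \<in> J then 1 else 0)"

text \<open>The determinant of \<open>minor J S\<close> is the principal minor of \<open>S\<close> on \<open>J\<close>, without changing the
  dimension.\<close>

definition minor :: "'n set \<Rightarrow> complex^'n^'n \<Rightarrow> complex^'n^'n" where
  "minor J S = proj J ** S ** proj J + (mat 1 - proj J)"

lemma proj_idem: "proj J ** proj J = proj J"
  by (simp add: proj_def real_diag_mult if_distrib cong: if_cong)

lemma ct_proj [simp]: "conj_transpose (proj J) = proj J"
  by (simp add: proj_def)

lemma psd_proj_compl: "pos_semidef (mat 1 - proj J)"
proof -
  have "mat 1 - proj J = real_diag (\<lambda>i. if i \<in> J then 0 else 1)"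
    by (simp add: vec_eq_iff proj_def real_diag_def mat_def)
  then show ?thesis by (simp add: psd_real_diag)
qed

lemma minor_real_diag: "minor J (real_diag d) = real_diag (\<lambda>i. if i \<in> J then d i else 1)"
  by (auto simp: minor_def proj_def real_diag_mult real_diag_diff real_diag_add if_distrib
      simp flip: real_diag_1 intro!: arg_cong [where f = real_diag])

lemma det_minor_real_diag: "det (minor J (real_diag d)) = of_real (\<Prod>i\<in>J. d i)"
  by (simp add: minor_real_diag det_real_diag prod.If_cases)

lemma pos_def_minor:
  assumes X: "pos_def X" shows "pos_def (minor J X)"
proof -
  have herm: "hermitian (minor J X)"
    using X psd_proj_compl [of J] unfolding minor_def pos_def_def pos_semidef_inner
    by (metis ct_proj hermitian_add hermitian_congruence)
  have "0 < v \<bullet> (minor J X *v v)" if v: "v \<noteq> 0" for v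
  proof -
    let ?a = "proj J *v v"
    have eq: "v \<bullet> (minor J X *v v) = ?a \<bullet> (X *v ?a) + v \<bullet> ((mat 1 - proj J) *v v)"
      using congruence_inner [of v "proj J" X]
      by (simp add: minor_def matrix_vector_mult_add_rdistrib inner_add_right)
    have "0 \<le> v \<bullet> ((mat 1 - proj J) *v v)" using psd_proj_compl unfolding pos_semidef_inner by blast
    moreover have "0 < ?a \<bullet> (X *v ?a)" if "?a \<noteq> 0" using X that by (simp add: pos_def_def)
    moreover have "v \<bullet> ((mat 1 - proj J) *v v) = v \<bullet> v" if "?a = 0"
      using that by (simp add: matrix_vector_mult_diff_rdistrib)
    ultimately show ?thesis using v by (cases "?a = 0") (auto simp: eq)
  qed
  then show ?thesis using herm by (simp add: pos_def_def)
qed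

lemma det_minor_mono:
  assumes X: "pos_def X" and D: "pos_semidef D"
  shows "Re (det (minor J X)) \<le> Re (det (minor J (X + D)))"
proof -
  have "minor J (X + D) = minor J X + conj_transpose (proj J) ** D ** proj J"
    by (simp add: minor_def matrix_add_ldistrib matrix_add_rdistrib)
  then show ?thesis by (simp only: det_mono pos_def_minor X psd_congruence D)
qed

lemma hermitian_idempotent_psd:
  assumes "hermitian Q" "Q ** Q = Q" shows "pos_semidef (mat 1 - Q)"
proof -
  have h: "conj_transpose (mat 1 - Q) = mat 1 - Q" using assms by (simp add: hermitian_def ct_diff)
  have "(mat 1 - Q) ** (mat 1 - Q) = mat 1 - Q"
    using assms by (simp add: matrix_sub_ldistrib matrix_sub_rdistrib)
  then show ?thesis
    using psd_congruence [of "mat 1" "mat 1 - Q"] pos_def_imp_psd [OF pos_def_mat_1] by (simp add: h)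
qed

text \<open>After \<open>T\<close> is factored out, Sylvester's identity turns the remaining
  determinant into that of \<open>1 + R\<^sup>* Q R\<close>, where \<open>S = R R\<^sup>*\<close>
  and \<open>Q\<close> is an orthogonal projection. Replacing \<open>Q\<close> by the identity can
  only increase it, and gives \<open>det (1 + S)\<close>.\<close>

lemma det_minor_congruence_le:
  fixes C S :: "complex^'n^'n"
  assumes C: "invertible C" and S: "pos_def S"
  shows "Re (det (minor J (conj_transpose C ** (mat 1 + S) ** C)))
    \<le> Re (det (minor J (conj_transpose C ** C))) * Re (det (mat 1 + S))"
proof -
  define E where "E = proj J"
  define T where "T = minor J (conj_transpose C ** C)"
  have E: "E ** E = E" "conj_transpose E = E" by (simp_all add: E_def proj_idem)
  have CC: "pos_def (conj_transpose C ** C)"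
    using pos_def_congruence_invertible [OF pos_def_mat_1 C] by simp
  have Tp: "pos_def T" unfolding T_def using CC by (rule pos_def_minor)
  then obtain V where V: "T ** V = mat 1" "V ** T = mat 1"
    using pos_def_invertible unfolding invertible_def by blast
  have Th: "conj_transpose T = T" using Tp by (simp add: pos_def_def hermitian_def)
  have Vh: "conj_transpose V = V"
    by (metis Th V ct_mat_1 ct_mult matrix_mul_assoc matrix_mul_lid matrix_mul_rid)
  have TE: "T ** E = E ** conj_transpose C ** C ** E"
    using E by (simp add: T_def minor_def E_def [symmetric] matrix_add_rdistrib matrix_sub_rdistrib
        matrix_mul_assoc)
      (metis E matrix_mul_assoc)
  have ET: "E ** T = E ** conj_transpose C ** C ** E"
    using E by (simp add: T_def minor_def E_def [symmetric] matrix_add_ldistrib matrix_sub_ldistrib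
        matrix_mul_assoc)
  have VE: "V ** E = E ** V"
    by (metis ET TE V matrix_mul_assoc matrix_mul_lid matrix_mul_rid)
  \<comment> \<open>The orthogonal projection onto the range of \<open>C ** E\<close>. It is
    idempotent because \<open>V\<close> inverts \<open>T\<close>, which acts on the range of
    \<open>E\<close> as the compression of \<open>C\<^sup>* C\<close>.\<close>
  define Q where "Q = C ** E ** V ** conj_transpose C"
  have Qh: "hermitian Q"
    using E Vh VE by (simp add: hermitian_def Q_def ct_mult matrix_mul_assoc)
  have QQ: "Q ** Q = Q"
  proof -
    have "Q ** Q = C ** V ** (E ** conj_transpose C ** C ** E) ** V ** conj_transpose C"
      by (simp add: Q_def matrix_mul_assoc) (metis VE matrix_mul_assoc)
    also have "\<dots> = C ** (V ** T) ** E ** V ** conj_transpose C"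
      by (simp add: TE [symmetric] matrix_mul_assoc)
    finally show ?thesis by (simp add: V Q_def)
  qed
  obtain U s where s: "diagonalizes U s S" using S hermitian_diagonalizes pos_def_def by blast
  have spos: "0 < s i" for i using diagonalizes_pos [OF s S] .
  have U: "unitary U" using s by (simp add: diagonalizes_def)
  define R where "R = U ** real_diag (\<lambda>i. sqrt (s i))"
  have nz: "s i \<noteq> 0" for i using spos [of i] by simp
  have Ri: "invertible R" unfolding R_def
    by (intro invertible_mult unitary_invertible [OF U] invertible_real_diag) (simp add: nz)
  have RR: "S = R ** conj_transpose R"
  proof -
    have "R ** conj_transpose R = U ** (real_diag (\<lambda>i. sqrt (s i)) ** real_diag (\<lambda>i. sqrt (s i))) ** conj_transpose U"
      by (simp add: R_def ct_mult matrix_mul_assoc)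
    then show ?thesis
      using s spos by (simp add: real_diag_mult diagonalizes_def less_imp_le)
  qed
  have Si: "invertible S" using S by (rule pos_def_invertible)
  have CTi: "invertible (conj_transpose C)"
    using C by (rule invertible_ct)
  have Vi: "invertible V" using V by (auto simp: invertible_def)
  have "minor J (conj_transpose C ** (mat 1 + S) ** C) = T + E ** conj_transpose C ** S ** C ** E"
    by (simp add: T_def minor_def E_def matrix_add_ldistrib matrix_add_rdistrib matrix_mul_assoc)
  also have "\<dots> = T ** (mat 1 + E ** (V ** conj_transpose C ** S ** C) ** E)"
    by (simp add: matrix_add_ldistrib matrix_mul_assoc)
      (metis V VE matrix_mul_assoc matrix_mul_lid)
  finally have "det (minor J (conj_transpose C ** (mat 1 + S) ** C))
      = det T * det (mat 1 + E ** (V ** conj_transpose C ** S ** C) ** E)" by (simp add: det_mul)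
  also have "det (mat 1 + E ** (V ** conj_transpose C ** S ** C) ** E)
      = det (mat 1 + (V ** conj_transpose C ** S) ** (C ** E))"
    using det_sylvester_idempotent [OF E(1), of "V ** conj_transpose C ** S ** C"] by (simp add: matrix_mul_assoc)
  also have "\<dots> = det (mat 1 + (C ** E) ** (V ** conj_transpose C ** S))"
    by (intro det_1_add_conj invertible_mult Vi CTi Si)
  also have "(C ** E) ** (V ** conj_transpose C ** S) = (Q ** R) ** conj_transpose R"
    by (simp add: Q_def RR matrix_mul_assoc)
  also have "det (mat 1 + (Q ** R) ** conj_transpose R) = det (mat 1 + conj_transpose R ** Q ** R)"
    using det_1_add_conj [OF invertible_ct [OF Ri], of "Q ** R"] by (simp add: matrix_mul_assoc)
  finally have eq: "det (minor J (conj_transpose C ** (mat 1 + S) ** C))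
      = det T * det (mat 1 + conj_transpose R ** Q ** R)" .
  have Qpsd: "pos_semidef Q"
    using psd_congruence [of "mat 1" Q] pos_def_imp_psd [OF pos_def_mat_1] QQ Qh
    by (simp add: hermitian_def)
  \<comment> \<open>This is where \<open>Q \<le> 1\<close> is used: adding the positive semidefinite
    \<open>R\<^sup>* (1 - Q) R\<close> increases the determinant.\<close>
  have "Re (det (mat 1 + conj_transpose R ** Q ** R))
      \<le> Re (det ((mat 1 + conj_transpose R ** Q ** R) + conj_transpose R ** (mat 1 - Q) ** R))"
    by (intro det_mono pos_def_add_psd pos_def_mat_1 psd_congruence hermitian_idempotent_psd Qpsd Qh QQ)
  also have "(mat 1 + conj_transpose R ** Q ** R) + conj_transpose R ** (mat 1 - Q) ** R
      = mat 1 + conj_transpose R ** R"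
    by (simp add: matrix_sub_ldistrib matrix_sub_rdistrib)
  also have "det (mat 1 + conj_transpose R ** R) = det (mat 1 + S)"
    using det_1_add_conj [OF Ri, of "conj_transpose R"] by (simp add: RR)
  finally have le: "Re (det (mat 1 + conj_transpose R ** Q ** R)) \<le> Re (det (mat 1 + S))" .
  have "Re (det (minor J (conj_transpose C ** (mat 1 + S) ** C)))
      = Re (det T) * Re (det (mat 1 + conj_transpose R ** Q ** R))"
    unfolding eq by (subst det_pos_def(1) [OF Tp]) simp
  also have "\<dots> \<le> Re (det T) * Re (det (mat 1 + S))"
    using le det_pos_def(2) [OF Tp] by (intro mult_left_mono) auto
  finally show ?thesis by (simp add: T_def)
qed

lemma minor_scaleR: "minor J (r *\<^sub>R X) = minor J (real_diag (\<lambda>i. r)) ** minor J X"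
proof -
  have a: "minor J (real_diag (\<lambda>i. r)) = r *\<^sub>R proj J + (mat 1 - proj J)"
    by (auto simp: minor_def proj_def real_diag_mult real_diag_scaleR intro!: arg_cong [where f = real_diag])
  have "proj J ** (mat 1 - proj J) = 0" "(mat 1 - proj J) ** proj J = 0"
    "(mat 1 - proj J) ** (mat 1 - proj J) = mat 1 - proj J"
    by (simp_all add: matrix_sub_ldistrib matrix_sub_rdistrib proj_idem)
  then show ?thesis
    by (simp add: a minor_def [of J X] minor_def [of J "r *\<^sub>R X"] matrix_add_ldistrib
        matrix_add_rdistrib scaleR_mat_mult_left scaleR_mat_mult_right matrix_mul_assoc proj_idem)
qed

lemma det_minor_scaleR: "det (minor J (r *\<^sub>R X)) = of_real (r ^ card J) * det (minor J X)"
  by (simp add: minor_scaleR det_mul det_minor_real_diag)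

text \<open>The key step for multiplicativity of compressed determinants: \<open>H\<close> is dominated by the matrix
  whose eigenvalues outside \<open>J\<close> are raised to the smallest one inside \<open>J\<close>, which is then a multiple
  of \<open>1 + S\<close>; the factor \<open>1 + \<eta>\<close> makes \<open>S\<close> positive definite.\<close>

lemma det_minor_congruence:
  fixes C H U :: "complex^'n^'n"
  assumes C: "invertible C" and H: "diagonalizes U a H" and a: "\<And>i. 0 < a i"
    and J: "\<And>i l. i \<in> J \<Longrightarrow> l \<notin> J \<Longrightarrow> a l \<le> a i"
  shows "Re (det (minor J (conj_transpose C ** H ** C)))
    \<le> Re (det (minor J (conj_transpose C ** C))) * (\<Prod>i\<in>J. a i)"
proof (cases "J = {}")
  case True
  have "minor J X = mat 1" for X :: "complex^'n^'n"
  proof -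
    have "proj {} = (0 :: complex^'n^'n)" by (simp add: proj_def real_diag_def vec_eq_iff)
    then show ?thesis by (simp add: minor_def True)
  qed
  then show ?thesis by (simp add: True)
next
  case False
  \<comment> \<open>The minimum over the empty set would be unspecified, whence the case
    distinction.\<close>
  define \<mu> where "\<mu> = Min (a ` J)"
  have mu: "0 < \<mu>" "\<And>i. i \<in> J \<Longrightarrow> \<mu> \<le> a i" "\<And>l. l \<notin> J \<Longrightarrow> a l \<le> \<mu>"
    using False a J by (auto simp: \<mu>_def)
  have U: "unitary U" and Hd: "H = U ** real_diag a ** conj_transpose U"
    using H by (auto simp: diagonalizes_def)
  let ?x = "Re (det (minor J (conj_transpose C ** H ** C)))"
  let ?y = "Re (det (minor J (conj_transpose C ** C)))"
  have main: "?x \<le> ?y * (\<Prod>i\<in>J. a i) * (1 + \<eta>) ^ CARD('n)" if eta: "0 < \<eta>" for \<eta>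
  proof -
    define b where "b i = (1 + \<eta>) * (if i \<in> J then a i / \<mu> else 1)" for i
    have b1: "0 < b i - 1" for i
    proof -
      have "1 \<le> (if i \<in> J then a i / \<mu> else 1)" using mu by auto
      then have "(1 + \<eta>) * 1 \<le> b i" unfolding b_def using eta by (intro mult_left_mono) auto
      then show ?thesis using eta by simp
    qed
    have ab: "a i \<le> \<mu> * b i" for i
    proof (cases "i \<in> J")
      case True
      then show ?thesis using mu(1) a [of i] eta by (simp add: b_def)
    next
      case F: False
      have "a i \<le> \<mu> * 1" using mu F by simp
      also have "\<dots> \<le> \<mu> * b i" using mu b1 [of i] by (intro mult_left_mono) auto
      finally show ?thesis .
    qed
    define S where "S = U ** real_diag (\<lambda>i. b i - 1) ** conj_transpose U"
    have dS: "diagonalizes U (\<lambda>i. b i - 1) S" using U by (simp add: S_def diagonalizes_def)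
    then have S: "pos_def S" using b1 by (rule diagonalizes_pos_def)
    have dS1: "diagonalizes U b (mat 1 + S)"
    proof -
      have "real_diag b = mat 1 + real_diag (\<lambda>i. b i - 1)"
        by (simp add: real_diag_add flip: real_diag_1)
      then show ?thesis using U
        by (simp add: diagonalizes_def S_def unitaryD matrix_add_ldistrib matrix_add_rdistrib)
    qed
    define D where "D = U ** real_diag (\<lambda>i. \<mu> * b i - a i) ** conj_transpose U"
    have D: "pos_semidef D"
      using U ab by (intro diagonalizes_psd [of U "\<lambda>i. \<mu> * b i - a i"]) (auto simp: D_def diagonalizes_def)
    have HD: "\<mu> *\<^sub>R (mat 1 + S) = H + D"
    proof -
      have "\<mu> *\<^sub>R (mat 1 + S) = U ** (\<mu> *\<^sub>R real_diag b) ** conj_transpose U"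
        using dS1 by (simp add: diagonalizes_def scaleR_mat_mult_left scaleR_mat_mult_right)
      also have "\<mu> *\<^sub>R real_diag b = real_diag a + real_diag (\<lambda>i. \<mu> * b i - a i)"
        by (simp add: real_diag_scaleR real_diag_add)
      finally show ?thesis by (simp add: Hd D_def matrix_add_ldistrib matrix_add_rdistrib)
    qed
    have Hp: "pos_def H" using H a by (rule diagonalizes_pos_def)
    have "?x \<le> Re (det (minor J (conj_transpose C ** H ** C + conj_transpose C ** D ** C)))"
      by (intro det_minor_mono pos_def_congruence_invertible psd_congruence Hp C D)
    also have "conj_transpose C ** H ** C + conj_transpose C ** D ** C
        = \<mu> *\<^sub>R (conj_transpose C ** (mat 1 + S) ** C)"
      by (simp only: matrix_add_ldistrib [symmetric] matrix_add_rdistrib [symmetric] HD [symmetric]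
          scaleR_mat_mult_left scaleR_mat_mult_right)
    also have "Re (det (minor J (\<mu> *\<^sub>R (conj_transpose C ** (mat 1 + S) ** C))))
        = \<mu> ^ card J * Re (det (minor J (conj_transpose C ** (mat 1 + S) ** C)))"
      by (simp add: det_minor_scaleR flip: of_real_power)
    also have "\<dots> \<le> \<mu> ^ card J * (?y * Re (det (mat 1 + S)))"
      using mu by (intro mult_left_mono det_minor_congruence_le C S) auto
    also have "Re (det (mat 1 + S)) = (\<Prod>i\<in>UNIV. b i)"
      by (simp only: det_diagonalizes [OF dS1] Re_complex_of_real)
    also have "\<dots> = (1 + \<eta>) ^ CARD('n) * (\<Prod>i\<in>J. a i / \<mu>)"
      by (simp add: b_def prod.distrib prod.If_cases)
    also have "(\<Prod>i\<in>J. a i / \<mu>) = (\<Prod>i\<in>J. a i) / \<mu> ^ card J"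
      by (simp add: prod_dividef)
    finally show ?thesis using mu(1) by (simp add: mult_ac)
  qed
  have "((\<lambda>\<eta>. ?y * (\<Prod>i\<in>J. a i) * (1 + \<eta>) ^ CARD('n)) \<longlongrightarrow> ?y * (\<Prod>i\<in>J. a i) * (1 + 0) ^ CARD('n)) (at_right 0)"
    by (intro tendsto_intros)
  then have "?x \<le> ?y * (\<Prod>i\<in>J. a i) * (1 + 0) ^ CARD('n)"
    by (rule tendsto_lowerbound) (auto simp: eventually_at_right_less intro!: eventually_mono [OF eventually_at_right_less] main)
  then show ?thesis by simp
qed

text \<open>In the eigenbasis \<open>UG\<close>, the product of the first \<open>j\<close>
  eigenvalues is a principal minor. Three applications of \<open>det_minor_congruence\<close> peel
  off \<open>X\<close>, then the square of the diagonal factor, then \<open>Y\<^sup>* Y\<close>.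
  Since all three families are sorted along \<open>idx\<close>, the same index set carries the
  largest eigenvalues each time.\<close>

lemma horn_inequality:
  fixes X Y D :: "complex^'n^'n"
  assumes X: "diagonalizes UX a X" "\<And>i. 0 < a i" "sorted_family a"
    and d: "\<And>i. 0 < d i" "sorted_family (\<lambda>i. d i * d i)"
    and Y: "invertible Y" "diagonalizes UY b (conj_transpose Y ** Y)" "\<And>i. 0 < b i" "sorted_family b"
    and g: "diagonalizes UG g (conj_transpose Y ** real_diag d ** X ** real_diag d ** Y)"
  shows "(\<Prod>i | idx i < j. g i) \<le> (\<Prod>i | idx i < j. a i * (d i * d i) * b i)"
proof -
  let ?J = "{i. idx i < j}"
  have top: "c l \<le> c i" if "sorted_family c" "i \<in> ?J" "l \<notin> ?J" for c :: "'n \<Rightarrow> real" and i l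
    using that by (auto simp: sorted_family_def)
  have UG: "unitary UG" using g by (simp add: diagonalizes_def)
  have d0: "d i \<noteq> 0" for i using d(1) [of i] by simp
  have Di: "invertible (real_diag d)"
    using d0 by (rule invertible_real_diag)
  have YUi: "invertible (Y ** UG)" using Y(1) unitary_invertible [OF UG] by (rule invertible_mult)
  have "conj_transpose UG ** (conj_transpose Y ** real_diag d ** X ** real_diag d ** Y) ** UG = real_diag g"
    using g unfolding diagonalizes_def
    by (metis UG matrix_mul_assoc matrix_mul_lid matrix_mul_rid unitaryD(1))
  then have "real_diag g = conj_transpose (real_diag d ** Y ** UG) ** X ** (real_diag d ** Y ** UG)"
    by (simp add: ct_mult matrix_mul_assoc)
  then have "(\<Prod>i\<in>?J. g i)
      = Re (det (minor ?J (conj_transpose (real_diag d ** Y ** UG) ** X ** (real_diag d ** Y ** UG))))"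
    by (metis Re_complex_of_real det_minor_real_diag)
  also have "\<dots> \<le> Re (det (minor ?J (conj_transpose (real_diag d ** Y ** UG) ** (real_diag d ** Y ** UG))))
      * (\<Prod>i\<in>?J. a i)"
    using X top Di YUi by (intro det_minor_congruence) (auto simp: matrix_mul_assoc [symmetric] intro!: invertible_mult)
  also have "\<dots> \<le> (\<Prod>i\<in>?J. b i) * (\<Prod>i\<in>?J. d i * d i) * (\<Prod>i\<in>?J. a i)"
  proof (intro mult_right_mono)
    have "conj_transpose (real_diag d ** Y ** UG) ** (real_diag d ** Y ** UG)
        = conj_transpose (Y ** UG) ** real_diag (\<lambda>i. d i * d i) ** (Y ** UG)"
      by (simp add: ct_mult matrix_mul_assoc flip: real_diag_mult)
    then have "Re (det (minor ?J (conj_transpose (real_diag d ** Y ** UG) ** (real_diag d ** Y ** UG))))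
        \<le> Re (det (minor ?J (conj_transpose (Y ** UG) ** (Y ** UG)))) * (\<Prod>i\<in>?J. d i * d i)"
      using d top YUi
      by (simp only:) (intro det_minor_congruence [where U = "mat 1"], auto simp: diagonalizes_def)
    also have "conj_transpose (Y ** UG) ** (Y ** UG) = conj_transpose UG ** (conj_transpose Y ** Y) ** UG"
      by (simp add: ct_mult matrix_mul_assoc)
    also have "Re (det (minor ?J \<dots>)) * (\<Prod>i\<in>?J. d i * d i)
        \<le> (Re (det (minor ?J (conj_transpose UG ** UG))) * (\<Prod>i\<in>?J. b i)) * (\<Prod>i\<in>?J. d i * d i)"
      using Y top UG by (intro mult_right_mono det_minor_congruence unitary_invertible prod_nonneg) auto
    also have "conj_transpose UG ** UG = real_diag (\<lambda>i. 1)" using UG by (simp add: unitaryD)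
    also have "Re (det (minor ?J (real_diag (\<lambda>i. 1)))) = 1"
      by (subst det_minor_real_diag) simp
    finally show "Re (det (minor ?J (conj_transpose (real_diag d ** Y ** UG) ** (real_diag d ** Y ** UG))))
        \<le> (\<Prod>i\<in>?J. b i) * (\<Prod>i\<in>?J. d i * d i)" by simp
  qed (use X in \<open>auto intro!: prod_nonneg simp: less_imp_le\<close>)
  finally show ?thesis by (simp add: prod.distrib mult_ac)
qed

section \<open>The concavity theorems of Lieb and Epstein\<close>

definition rtr :: "complex^'n^'n \<Rightarrow> real" where
  "rtr X = Re (trace X)"

lemma rtr_add: "rtr (X + Y) = rtr X + rtr Y"
  by (simp add: rtr_def trace_add)

lemma rtr_scaleR: "rtr (r *\<^sub>R X) = r * rtr X"
  by (simp add: rtr_def trace_def sum_distrib_left)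

lemma rtr_commute:
  fixes A :: "complex^'n^'m" and B :: "complex^'m^'n"
  shows "rtr (A ** B) = rtr (B ** A)"
proof -
  have "(\<Sum>i\<in>UNIV. \<Sum>k\<in>UNIV. A $ i $ k * B $ k $ i) = (\<Sum>k\<in>UNIV. \<Sum>i\<in>UNIV. A $ i $ k * B $ k $ i)"
    by (rule sum.swap)
  then show ?thesis by (simp add: rtr_def trace_def matrix_matrix_mult_def mult.commute)
qed

lemma rtr_real_diag: "rtr (real_diag d) = (\<Sum>i\<in>UNIV. d i)"
  by (simp add: rtr_def trace_def real_diag_def)

lemma rtr_diagonalizes:
  assumes "diagonalizes U d X" shows "rtr X = (\<Sum>i\<in>UNIV. d i)"
proof -
  have "rtr X = rtr (conj_transpose U ** (U ** real_diag d))"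
    using assms rtr_commute [of "U ** real_diag d" "conj_transpose U"] by (simp add: diagonalizes_def)
  then show ?thesis using assms by (simp add: diagonalizes_def unitaryD matrix_mul_assoc rtr_real_diag)
qed

lemma rtr_entries:
  "rtr (conj_transpose l ** real_diag a ** l ** real_diag t)
    = (\<Sum>i\<in>UNIV. \<Sum>j\<in>UNIV. a i * t j * (cmod (l $ i $ j))\<^sup>2)"
proof -
  have "(conj_transpose l ** real_diag a ** l ** real_diag t) $ j $ j
      = (\<Sum>i\<in>UNIV. of_real (a i * t j * (cmod (l $ i $ j))\<^sup>2))" for j
    by (simp only: real_diag_mult_right_nth matrix_matrix_mult_def [of _ l] vec_lambda_beta)
      (simp add: real_diag_mult_right_nth sum_distrib_left complex_norm_square mult_ac del: of_real_power)
  then show ?thesis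
    unfolding rtr_def trace_def by (simp flip: of_real_sum) (rule sum.swap)
qed

text \<open>Once \<open>L\<close> is written in the two eigenbases, the trace form is diagonal in
  its entries, so scalar inequalities and integral formulas in \<open>a i\<close> and
  \<open>t j\<close> transfer term by term.\<close>

lemma rtr_form:
  fixes L :: "complex^'m^'n"
  assumes A: "diagonalizes U a A" and T: "diagonalizes V t T"
  shows "rtr (conj_transpose L ** A ** L ** T)
    = (\<Sum>i\<in>UNIV. \<Sum>j\<in>UNIV. a i * t j * (cmod ((conj_transpose U ** L ** V) $ i $ j))\<^sup>2)"
proof -
  let ?l = "conj_transpose U ** L ** V"
  have "rtr (conj_transpose L ** A ** L ** T)
      = rtr (V ** (real_diag t ** (conj_transpose V ** conj_transpose L ** A ** L)))"
    using rtr_commute [of "conj_transpose L ** A ** L" T] T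
    by (simp add: diagonalizes_def matrix_mul_assoc)
  also have "\<dots> = rtr ((real_diag t ** (conj_transpose V ** conj_transpose L ** A ** L)) ** V)"
    by (rule rtr_commute)
  also have "\<dots> = rtr (real_diag t ** (conj_transpose ?l ** real_diag a ** ?l))"
    using A by (simp add: diagonalizes_def ct_mult matrix_mul_assoc)
  also have "\<dots> = rtr (conj_transpose ?l ** real_diag a ** ?l ** real_diag t)"
    by (rule rtr_commute)
  finally show ?thesis by (simp add: rtr_entries)
qed

section \<open>Matrix powers in an eigenbasis\<close>

definition pw :: "real \<Rightarrow> real \<Rightarrow> real" where
  "pw p t = (if p = 0 then 1 else t powr p)"

lemma psd_power_diagonalizes:
  "diagonalizes U d X \<Longrightarrow> diagonalizes U (\<lambda>i. pw p (d i)) (psd_power X p)"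
  unfolding psd_power_def pw_def by (rule spectral_fun_diagonalizes)

lemma pw_nonneg: "0 \<le> pw p t" by (simp add: pw_def)

lemma pw_pos: "0 < t \<Longrightarrow> 0 < pw p t" by (simp add: pw_def)

lemma psd_diagonalizes:
  assumes "pos_semidef X"
  obtains U d where "diagonalizes U d X" "\<And>i. 0 \<le> d i"
  using assms diagonalizes_nonneg hermitian_diagonalizes pos_semidef_inner by metis

lemma psd_power_psd: "pos_semidef X \<Longrightarrow> pos_semidef (psd_power X p)"
  by (metis diagonalizes_psd psd_diagonalizes psd_power_diagonalizes pw_nonneg)

lemma psd_power_1: "pos_semidef X \<Longrightarrow> psd_power X 1 = X"
proof -
  assume "pos_semidef X"
  then obtain U d where d: "diagonalizes U d X" "\<And>i. 0 \<le> d i" by (rule psd_diagonalizes) blast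
  then have "(\<lambda>i. pw 1 (d i)) = d" by (auto simp: pw_def)
  then show ?thesis using psd_power_diagonalizes [OF d(1), of 1] d(1) by (simp add: diagonalizes_def)
qed

lemma diagonalizes_mat_1: "diagonalizes (mat 1) (\<lambda>i. 1) (mat 1)"
  by (simp add: diagonalizes_def)

lemma psd_power_mat_1: "psd_power (mat 1) p = mat 1"
proof -
  have "pw p 1 = 1" by (simp add: pw_def)
  then show ?thesis
    using psd_power_diagonalizes [OF diagonalizes_mat_1, of p] by (simp add: diagonalizes_def)
qed

lemma psd_power_0: "pos_semidef X \<Longrightarrow> psd_power X 0 = mat 1"
proof -
  assume "pos_semidef X"
  then obtain U d where d: "diagonalizes U d X" by (rule psd_diagonalizes) blast
  show ?thesis using psd_power_diagonalizes [OF d(1), of 0] d(1)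
    by (simp add: diagonalizes_def pw_def unitaryD)
qed

text \<open>The parallel sum gives the least cost of splitting \<open>z\<close> as
  \<open>x + (z - x)\<close> with weights \<open>a\<close> and \<open>b\<close>;
  \<open>par_eq\<close> exhibits an optimal splitting.\<close>

lemma par_le:
  assumes "0 \<le> a" "0 \<le> b"
  shows "par a b * (cmod z)\<^sup>2 \<le> a * (cmod x)\<^sup>2 + b * (cmod (z - x))\<^sup>2"
proof (cases "a + b = 0")
  case False
  then have ab: "0 < a + b" using assms by linarith
  define s t where "s = cmod x" and "t = cmod (z - x)"
  have "cmod z \<le> s + t" using norm_triangle_ineq [of x "z - x"] by (simp add: s_def t_def)
  then have "par a b * (cmod z)\<^sup>2 \<le> par a b * (s + t)\<^sup>2"
    using assms by (intro mult_left_mono power_mono) (auto simp: par_def)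
  also have "\<dots> \<le> a * s\<^sup>2 + b * t\<^sup>2"
  proof -
    have "0 \<le> (a * s - b * t)\<^sup>2" by simp
    then have "a * b * (s + t)\<^sup>2 \<le> (a * s\<^sup>2 + b * t\<^sup>2) * (a + b)"
      by (simp add: power2_eq_square algebra_simps)
    then show ?thesis using ab by (simp add: par_def divide_le_eq)
  qed
  finally show ?thesis by (simp add: s_def t_def)
qed (use assms in \<open>simp add: par_def\<close>)

lemma par_eq:
  fixes z :: complex
  assumes "0 \<le> a" "0 \<le> b"
  shows "\<exists>x. par a b * (cmod z)\<^sup>2 = a * (cmod x)\<^sup>2 + b * (cmod (z - x))\<^sup>2"
proof (cases "a + b = 0")
  case False
  then have ab: "0 < a + b" using assms by linarith
  \<comment> \<open>The stationary point, where \<open>a * x = b * (z - x)\<close>.\<close>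
  let ?x = "of_real (b / (a + b)) * z"
  have "1 - b / (a + b) = a / (a + b)" using ab by (simp add: field_simps)
  moreover have "z - ?x = of_real (1 - b / (a + b)) * z" by (simp add: left_diff_distrib)
  ultimately have "z - ?x = of_real (a / (a + b)) * z" by simp
  then have "cmod (z - ?x) = a / (a + b) * cmod z"
    using assms ab by (simp add: norm_mult norm_divide del: of_real_add of_real_divide)
  moreover have "cmod ?x = b / (a + b) * cmod z"
    using assms ab by (simp add: norm_mult del: of_real_add of_real_divide)
  moreover have "a * (b / (a + b) * n)\<^sup>2 + b * (a / (a + b) * n)\<^sup>2 = par a b * n\<^sup>2" for n
  proof -
    have "a * (b / (a + b) * n)\<^sup>2 + b * (a / (a + b) * n)\<^sup>2 = a * b * (a + b) * n\<^sup>2 / (a + b)\<^sup>2"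
      by (simp add: power_mult_distrib power_divide power2_eq_square algebra_simps add_divide_distrib)
    then show ?thesis using ab by (simp add: par_def power2_eq_square)
  qed
  ultimately have "a * (cmod ?x)\<^sup>2 + b * (cmod (z - ?x))\<^sup>2 = par a b * (cmod z)\<^sup>2"
    by (simp only:)
  then show ?thesis by metis
qed (use assms in \<open>auto simp: par_def intro!: exI [of _ 0]\<close>)

text \<open>For the eigenvalues \<open>a\<close>, \<open>t\<close> of \<open>A\<close>, \<open>T\<close> and \<open>L\<close> written in their eigenbases, this is the parallel
  sum of the quadratic forms \<open>X \<mapsto> tr X\<^sup>* A X\<close> and \<open>X \<mapsto> r tr X T X\<^sup>*\<close> evaluated at \<open>L\<close>. As an infimum of
  functions linear in \<open>(A, T)\<close> it is concave.\<close>

definition par_form :: "real \<Rightarrow> ('n::finite \<Rightarrow> real) \<Rightarrow> ('m::finite \<Rightarrow> real) \<Rightarrow> complex^'m^'n \<Rightarrow> real" where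
  "par_form r a t l = (\<Sum>i\<in>UNIV. \<Sum>j\<in>UNIV. par (a i) (r * t j) * (cmod (l $ i $ j))\<^sup>2)"

lemma quad_form_entries:
  fixes X Y :: "complex^'m^'n"
  assumes A: "diagonalizes U a A" and T: "diagonalizes V t T"
  shows "rtr (conj_transpose X ** A ** X) + r * rtr (conj_transpose Y ** Y ** T)
    = (\<Sum>i\<in>UNIV. \<Sum>j\<in>UNIV. a i * (cmod ((conj_transpose U ** X ** V) $ i $ j))\<^sup>2
        + r * t j * (cmod ((conj_transpose U ** Y ** V) $ i $ j))\<^sup>2)"
proof -
  have U: "unitary U" and V: "unitary V" using A T by (auto simp: diagonalizes_def)
  have V1: "diagonalizes V (\<lambda>i. 1) (mat 1)" using V by (simp add: diagonalizes_def unitaryD)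
  have U1: "diagonalizes U (\<lambda>i. 1) (mat 1)" using U by (simp add: diagonalizes_def unitaryD)
  show ?thesis
    using rtr_form [OF A V1, of X] rtr_form [OF U1 T, of Y]
    by (simp add: sum.distrib sum_distrib_left mult.assoc)
qed

lemma par_form_le:
  fixes X L :: "complex^'m^'n"
  assumes A: "diagonalizes U a A" "\<And>i. 0 \<le> a i" and T: "diagonalizes V t T" "\<And>i. 0 \<le> t i" and r: "0 < r"
  shows "par_form r a t (conj_transpose U ** L ** V)
    \<le> rtr (conj_transpose X ** A ** X) + r * rtr (conj_transpose (L - X) ** (L - X) ** T)"
  unfolding quad_form_entries [OF A(1) T(1)] par_form_def
  by (intro sum_mono order_trans [OF par_le]) (use assms in \<open>auto simp: matrix_sub_ldistrib matrix_sub_rdistrib\<close>)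

lemma par_form_attained:
  fixes L :: "complex^'m^'n"
  assumes A: "diagonalizes U a A" "\<And>i. 0 \<le> a i" and T: "diagonalizes V t T" "\<And>i. 0 \<le> t i" and r: "0 < r"
  shows "\<exists>X. par_form r a t (conj_transpose U ** L ** V)
    = rtr (conj_transpose X ** A ** X) + r * rtr (conj_transpose (L - X) ** (L - X) ** T)"
proof -
  let ?l = "conj_transpose U ** L ** V"
  have U: "unitary U" and V: "unitary V" using A T by (auto simp: diagonalizes_def)
  have "\<exists>x. par (a i) (r * t j) * (cmod (?l $ i $ j))\<^sup>2
      = a i * (cmod x)\<^sup>2 + r * t j * (cmod (?l $ i $ j - x))\<^sup>2" for i j
    using A T r by (intro par_eq) auto
  then obtain x where x: "\<And>i j. par (a i) (r * t j) * (cmod (?l $ i $ j))\<^sup>2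
      = a i * (cmod (x i j))\<^sup>2 + r * t j * (cmod (?l $ i $ j - x i j))\<^sup>2" by metis
  \<comment> \<open>The entries are minimized independently in the eigenbases and the result is
    transformed back.\<close>
  define X where "X = U ** (\<chi> i j. x i j) ** conj_transpose V"
  have "conj_transpose U ** X ** V = (conj_transpose U ** U) ** (\<chi> i j. x i j) ** (conj_transpose V ** V)"
    by (simp add: X_def matrix_mul_assoc)
  then have X: "conj_transpose U ** X ** V = (\<chi> i j. x i j)" using U V by (simp add: unitaryD)
  have "conj_transpose U ** (L - X) ** V = ?l - (\<chi> i j. x i j)"
    using X by (simp add: matrix_sub_ldistrib matrix_sub_rdistrib)
  then have "par_form r a t ?l
    = rtr (conj_transpose X ** A ** X) + r * rtr (conj_transpose (L - X) ** (L - X) ** T)"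
    unfolding quad_form_entries [OF A(1) T(1)] par_form_def by (simp add: X x)
  then show ?thesis by blast
qed

lemma par_form_concave:
  fixes L :: "complex^'m^'n"
  assumes 1: "diagonalizes U1 a1 A1" "\<And>i. 0 \<le> a1 i" "diagonalizes V1 t1 T1" "\<And>i. 0 \<le> t1 i"
    and 2: "diagonalizes U2 a2 A2" "\<And>i. 0 \<le> a2 i" "diagonalizes V2 t2 T2" "\<And>i. 0 \<le> t2 i"
    and m: "diagonalizes U a (u *\<^sub>R A1 + v *\<^sub>R A2)" "\<And>i. 0 \<le> a i"
      "diagonalizes V t (u *\<^sub>R T1 + v *\<^sub>R T2)" "\<And>i. 0 \<le> t i"
    and uv: "0 \<le> u" "0 \<le> v" and r: "0 < r"
  shows "u * par_form r a1 t1 (conj_transpose U1 ** L ** V1) + v * par_form r a2 t2 (conj_transpose U2 ** L ** V2)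
    \<le> par_form r a t (conj_transpose U ** L ** V)"
proof -
  let ?q = "\<lambda>X A T. rtr (conj_transpose X ** A ** X) + r * rtr (conj_transpose (L - X) ** (L - X) ** T)"
  \<comment> \<open>The minimizer of the mixture is admissible for both end points, which bounds
    their minima from above.\<close>
  obtain X where X: "par_form r a t (conj_transpose U ** L ** V)
      = ?q X (u *\<^sub>R A1 + v *\<^sub>R A2) (u *\<^sub>R T1 + v *\<^sub>R T2)"
    using par_form_attained [OF m r] by blast
  have "u * par_form r a1 t1 (conj_transpose U1 ** L ** V1) + v * par_form r a2 t2 (conj_transpose U2 ** L ** V2)
      \<le> u * ?q X A1 T1 + v * ?q X A2 T2"
    using uv par_form_le [OF 1 r] par_form_le [OF 2 r] by (intro add_mono mult_left_mono) auto
  also have "\<dots> = ?q X (u *\<^sub>R A1 + v *\<^sub>R A2) (u *\<^sub>R T1 + v *\<^sub>R T2)"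
    by (simp add: matrix_add_ldistrib matrix_add_rdistrib scaleR_mat_mult_left scaleR_mat_mult_right
        rtr_add rtr_scaleR algebra_simps)
  finally show ?thesis by (simp add: X)
qed

text \<open>Domination by \<open>x powr (p - 1)\<close> on the unit interval, integrable as
  \<open>0 < p\<close>, and by \<open>x powr (p - 2)\<close> beyond it, integrable as
  \<open>p < 1\<close>.\<close>

lemma powr_kernel_integrable:
  assumes p: "0 < p" "p < 1"
  shows "integrable lborel (\<lambda>x::real. indicator {0<..} x * (x powr (p - 1) / (1 + x)))"
proof -
  let ?h = "\<lambda>x::real. x powr (p - 1) / (1 + x)"
  have "(\<lambda>x. x powr (p - 1)) integrable_on {0..1}"
    using p by (intro integrable_on_powr_from_0) auto
  then have a1: "set_integrable lebesgue {0..1} (\<lambda>x. x powr (p - 1))"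
    by (rule nonnegative_absolutely_integrable_1) auto
  have "((\<lambda>x. x powr (p - 2)) has_integral - (1 powr (p - 2 + 1)) / (p - 2 + 1)) {1..}"
    using p by (intro has_integral_powr_to_inf) auto
  then have a2: "set_integrable lebesgue {1..} (\<lambda>x. x powr (p - 2))"
    by (intro nonnegative_absolutely_integrable_1) auto
  let ?g = "\<lambda>x::real. indicator {0..1} x *\<^sub>R x powr (p - 1) + indicator {1..} x *\<^sub>R x powr (p - 2)"
  have "integrable lebesgue ?g"
    using a1 a2 unfolding set_integrable_def by (rule Bochner_Integration.integrable_add)
  then have g: "integrable lborel ?g"
    by (subst (asm) integrable_completion) (auto intro!: borel_measurable_add)
  show ?thesis
  proof (rule Bochner_Integration.integrable_bound [OF g])
    show "AE x in lborel. norm (indicator {0<..} x * ?h x) \<le> norm (?g x)"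
    proof (rule AE_I2)
      fix x :: real
      show "norm (indicator {0<..} x * ?h x) \<le> norm (?g x)"
      proof (cases "0 < x")
        case True
        have "?h x \<le> ?g x"
        proof (cases "x \<le> 1")
          case x: True
          have "?h x \<le> x powr (p - 1) / 1" using True by (intro divide_left_mono) auto
          also have "\<dots> \<le> ?g x" using True x by (simp add: indicator_def)
          finally show ?thesis .
        next
          case x: False
          have "?h x \<le> x powr (p - 1) / x" using True by (intro divide_left_mono) auto
          also have "\<dots> = x powr (p - 2)" using True powr_diff [of x "p - 1" 1] by simp
          also have "\<dots> \<le> ?g x" using True x by (simp add: indicator_def)
          finally show ?thesis .
        qed
        then show ?thesis using True by simp
      qed simp
    qed
  qed measurable
qed

text \<open>Represents \<open>a powr p * t powr (1 - p)\<close> as a positive superposition of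
  parallel sums, by the substitution \<open>x = (t / a) * r\<close> in the integral of the
  kernel.\<close>

lemma powr_par_integral:
  assumes p: "0 < p" "p < 1"
  shows "\<exists>C>0. \<forall>a t. 0 \<le> a \<longrightarrow> 0 \<le> t \<longrightarrow> has_bochner_integral lborel
    (\<lambda>r. indicator {0<..} r * r powr (p - 2) * par a (r * t)) (C * (a powr p * t powr (1 - p)))"
proof -
  define h where "h x = indicator {0<..} x * (x powr (p - 1) / (1 + x))" for x :: real
  have int: "integrable lborel h" unfolding h_def using p by (rule powr_kernel_integrable)
  \<comment> \<open>Only the sign of this constant matters, since both sides of Lieb's inequality
    carry it as a factor.\<close>
  define C where "C = integral\<^sup>L lborel h"
  have hb: "has_bochner_integral lborel h C" using int by (simp add: C_def has_bochner_integral_iff)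
  have nn: "0 \<le> h x" for x by (cases "0 < x") (auto simp: h_def)
  have "C \<noteq> 0"
  proof
    assume "C = 0"
    then have "AE x in lborel. h x = 0"
      using integral_nonneg_eq_0_iff_AE [OF int] nn by (simp add: C_def)
    then have "AE x in lborel. x \<notin> {0<..<1::real}"
      by eventually_elim (auto simp: h_def split: if_splits)
    then have "{0<..<1::real} \<in> null_sets lborel" by (subst AE_iff_null_sets) auto
    then show False by (simp add: null_sets_def)
  qed
  moreover have "0 \<le> C" unfolding C_def using nn by (intro integral_nonneg_AE) auto
  ultimately have C: "0 < C" by simp
  have "has_bochner_integral lborel
      (\<lambda>r. indicator {0<..} r * r powr (p - 2) * par a (r * t)) (C * (a powr p * t powr (1 - p)))"
    if at: "0 \<le> a" "0 \<le> t" for a t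
  proof (cases "a = 0 \<or> t = 0")
    case True
    then have "(\<lambda>r. indicator {0<..} r * r powr (p - 2) * par a (r * t)) = (\<lambda>_. 0)"
      by (auto simp: par_def)
    moreover have "C * (a powr p * t powr (1 - p)) = 0" using True by auto
    ultimately show ?thesis by (simp only: has_bochner_integral_zero)
  next
    case False
    then have a: "0 < a" and t: "0 < t" using at by auto
    \<comment> \<open>With this scale \<open>par a (r * t)\<close> becomes
      \<open>t * r / (1 + c * r)\<close>.\<close>
    define c where "c = t / a"
    have c: "0 < c" using a t by (simp add: c_def)
    have "has_bochner_integral lborel (\<lambda>r. h (0 + c * r)) (C /\<^sub>R \<bar>c\<bar>)"
      using hb c by (subst (asm) lborel_has_bochner_integral_real_affine_iff [of c _ _ 0]) auto
    then have "has_bochner_integral lborel (\<lambda>r. t * c powr (1 - p) * h (0 + c * r)) (t * c powr (1 - p) * (C /\<^sub>R \<bar>c\<bar>))"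
      by (rule has_bochner_integral_mult_right)
    moreover have "t * c powr (1 - p) * h (0 + c * r) = indicator {0<..} r * r powr (p - 2) * par a (r * t)" for r
    proof (cases "0 < r")
      case True
      have "h (c * r) = c powr (p - 1) * r powr (p - 1) / (1 + c * r)"
        using True c by (simp add: h_def powr_mult)
      moreover have "c powr (1 - p) * c powr (p - 1) = 1" using c by (simp flip: powr_add)
      ultimately have "t * c powr (1 - p) * h (c * r) = t * r powr (p - 1) / (1 + c * r)"
        by (metis (no_types, opaque_lifting) mult.assoc mult.right_neutral mult.left_commute times_divide_eq_right)
      also have "r powr (p - 1) = r powr (p - 2) * r" using True powr_add [of r "p - 2" 1] by simp
      also have "t * (r powr (p - 2) * r) / (1 + c * r) = r powr (p - 2) * par a (r * t)"
        using a t True by (simp add: par_def c_def field_simps)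
      finally show ?thesis using True by simp
    qed (use c in \<open>simp add: h_def zero_less_mult_iff\<close>)
    moreover have "t * c powr (1 - p) * (C /\<^sub>R \<bar>c\<bar>) = C * (a powr p * t powr (1 - p))"
    proof -
      have "c powr (1 - p) / c = c powr (- p)" using c powr_diff [of c "1 - p" 1] by simp
      also have "\<dots> = a powr p * t powr (- p)"
        using a t by (simp add: c_def powr_divide powr_minus field_simps)
      finally have "t * (c powr (1 - p) / c) = a powr p * t powr (1 - p)"
        using t powr_add [of t 1 "- p"] by (simp add: mult_ac)
      then show ?thesis using c by (simp add: divide_inverse mult_ac)
    qed
    ultimately show ?thesis by (simp only:)
  qed
  with C show ?thesis by blast
qed

theorem lieb_concavity:
  fixes L :: "complex^'m^'n"
  assumes p: "0 < p" "p < 1"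
    and psd: "pos_semidef A1" "pos_semidef A2" "pos_semidef T1" "pos_semidef T2"
    and uv: "0 \<le> u" "0 \<le> v"
  shows "u * rtr (conj_transpose L ** psd_power A1 p ** L ** psd_power T1 (1 - p))
      + v * rtr (conj_transpose L ** psd_power A2 p ** L ** psd_power T2 (1 - p))
    \<le> rtr (conj_transpose L ** psd_power (u *\<^sub>R A1 + v *\<^sub>R A2) p ** L
          ** psd_power (u *\<^sub>R T1 + v *\<^sub>R T2) (1 - p))"
proof -
  obtain C where C: "0 < C" and int: "\<And>a t. 0 \<le> a \<Longrightarrow> 0 \<le> t \<Longrightarrow> has_bochner_integral lborel
    (\<lambda>r. indicator {0<..} r * r powr (p - 2) * par a (r * t)) (C * (a powr p * t powr (1 - p)))"
    using powr_par_integral [OF p] by blast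
  \<comment> \<open>The scalar representation is applied to each pair of eigenvalues and summed with
    the weights from \<open>rtr_form\<close>.\<close>
  have key: "has_bochner_integral lborel
      (\<lambda>r. indicator {0<..} r * r powr (p - 2) * par_form r a t (conj_transpose U ** L ** V))
      (C * rtr (conj_transpose L ** psd_power A p ** L ** psd_power T (1 - p)))"
    if "diagonalizes U a A" "\<And>i. 0 \<le> a i" "diagonalizes V t T" "\<And>i. 0 \<le> t i" for U V a t A T
  proof -
    let ?l = "conj_transpose U ** L ** V"
    have "has_bochner_integral lborel
        (\<lambda>r. \<Sum>i\<in>UNIV. \<Sum>j\<in>UNIV. indicator {0<..} r * r powr (p - 2) * par (a i) (r * t j) * (cmod (?l $ i $ j))\<^sup>2)
        (\<Sum>i\<in>UNIV. \<Sum>j\<in>UNIV. C * (a i powr p * t j powr (1 - p)) * (cmod (?l $ i $ j))\<^sup>2)"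
      using that by (intro has_bochner_integral_sum has_bochner_integral_mult_left int) auto
    moreover have "rtr (conj_transpose L ** psd_power A p ** L ** psd_power T (1 - p))
        = (\<Sum>i\<in>UNIV. \<Sum>j\<in>UNIV. a i powr p * t j powr (1 - p) * (cmod (?l $ i $ j))\<^sup>2)"
      using p by (subst rtr_form [OF psd_power_diagonalizes [OF that(1)] psd_power_diagonalizes [OF that(3)]])
        (simp add: pw_def)
    ultimately show ?thesis
      by (simp add: par_form_def sum_distrib_left mult.assoc)
  qed
  have psd': "pos_semidef (u *\<^sub>R A1 + v *\<^sub>R A2)" "pos_semidef (u *\<^sub>R T1 + v *\<^sub>R T2)"
    using psd uv by (simp_all add: psd_add psd_scaleR)
  obtain U1 a1 where 1: "diagonalizes U1 a1 A1" "\<And>i. 0 \<le> a1 i" using psd(1) by (rule psd_diagonalizes) blast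
  obtain U2 a2 where 2: "diagonalizes U2 a2 A2" "\<And>i. 0 \<le> a2 i" using psd(2) by (rule psd_diagonalizes) blast
  obtain V1 t1 where 3: "diagonalizes V1 t1 T1" "\<And>i. 0 \<le> t1 i" using psd(3) by (rule psd_diagonalizes) blast
  obtain V2 t2 where 4: "diagonalizes V2 t2 T2" "\<And>i. 0 \<le> t2 i" using psd(4) by (rule psd_diagonalizes) blast
  obtain U a where 5: "diagonalizes U a (u *\<^sub>R A1 + v *\<^sub>R A2)" "\<And>i. 0 \<le> a i"
    using psd'(1) by (rule psd_diagonalizes) blast
  obtain V t where 6: "diagonalizes V t (u *\<^sub>R T1 + v *\<^sub>R T2)" "\<And>i. 0 \<le> t i"
    using psd'(2) by (rule psd_diagonalizes) blast
  let ?k = "\<lambda>r::real. indicator {0<..} r * r powr (p - 2)"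
  have "has_bochner_integral lborel
      (\<lambda>r. u * (?k r * par_form r a1 t1 (conj_transpose U1 ** L ** V1))
        + v * (?k r * par_form r a2 t2 (conj_transpose U2 ** L ** V2)))
      (u * (C * rtr (conj_transpose L ** psd_power A1 p ** L ** psd_power T1 (1 - p)))
      + v * (C * rtr (conj_transpose L ** psd_power A2 p ** L ** psd_power T2 (1 - p))))"
    by (intro has_bochner_integral_add has_bochner_integral_mult_right key 1 2 3 4)
  moreover have "u * (?k r * par_form r a1 t1 (conj_transpose U1 ** L ** V1))
        + v * (?k r * par_form r a2 t2 (conj_transpose U2 ** L ** V2))
      \<le> ?k r * par_form r a t (conj_transpose U ** L ** V)" for r
  proof (cases "0 < r")
    case True
    have "?k r * (u * par_form r a1 t1 (conj_transpose U1 ** L ** V1)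
        + v * par_form r a2 t2 (conj_transpose U2 ** L ** V2))
      \<le> ?k r * par_form r a t (conj_transpose U ** L ** V)"
      by (intro mult_left_mono par_form_concave [OF 1 3 2 4 5 6 uv True]) simp
    then show ?thesis by (simp add: algebra_simps)
  qed simp
  ultimately have "u * (C * rtr (conj_transpose L ** psd_power A1 p ** L ** psd_power T1 (1 - p)))
      + v * (C * rtr (conj_transpose L ** psd_power A2 p ** L ** psd_power T2 (1 - p)))
    \<le> C * rtr (conj_transpose L ** psd_power (u *\<^sub>R A1 + v *\<^sub>R A2) p ** L
          ** psd_power (u *\<^sub>R T1 + v *\<^sub>R T2) (1 - p))"
    using key [OF 5 6] unfolding has_bochner_integral_iff by (metis (no_types, lifting) integral_mono)
  then have "C * (u * rtr (conj_transpose L ** psd_power A1 p ** L ** psd_power T1 (1 - p))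
      + v * rtr (conj_transpose L ** psd_power A2 p ** L ** psd_power T2 (1 - p)))
    \<le> C * rtr (conj_transpose L ** psd_power (u *\<^sub>R A1 + v *\<^sub>R A2) p ** L
          ** psd_power (u *\<^sub>R T1 + v *\<^sub>R T2) (1 - p))"
    by (simp add: algebra_simps)
  then show ?thesis using C by simp
qed

text \<open>Scalar Young inequality for each pair of eigenvalues, averaged with the squared moduli
  of the entries of the unitary \<open>?y\<close>; these are doubly stochastic, so the two separate
  terms sum to traces.\<close>

lemma trace_young:
  fixes P T :: "complex^'m^'m"
  assumes p: "0 < p" "p < 1" and P: "diagonalizes U a P" "\<And>i. 0 \<le> a i" and T: "pos_semidef T"
  shows "rtr (P ** psd_power T (1 - p)) \<le> p * (\<Sum>i\<in>UNIV. a i powr (1 / p)) + (1 - p) * rtr T"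
proof -
  obtain V t where t: "diagonalizes V t T" "\<And>i. 0 \<le> t i" using T by (rule psd_diagonalizes) blast
  let ?y = "conj_transpose U ** V"
  have U: "unitary U" and V: "unitary V" using P t by (auto simp: diagonalizes_def)
  have y: "unitary ?y" using U V by (simp add: unitary_mult unitary_ct)
  have row: "(\<Sum>j\<in>UNIV. (cmod (?y $ i $ j))\<^sup>2) = 1" for i
  proof -
    have "of_real (\<Sum>j\<in>UNIV. (cmod (?y $ i $ j))\<^sup>2) = (?y ** conj_transpose ?y) $ i $ i"
      by (simp add: matrix_matrix_mult_def [of _ "conj_transpose ?y"] complex_norm_square del: of_real_power)
    then show ?thesis using y by (simp add: unitaryD mat_def del: of_real_sum of_real_power)
  qed
  have col: "(\<Sum>i\<in>UNIV. (cmod (?y $ i $ j))\<^sup>2) = 1" for j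
  proof -
    have "of_real (\<Sum>i\<in>UNIV. (cmod (?y $ i $ j))\<^sup>2) = (conj_transpose ?y ** ?y) $ j $ j"
      by (simp add: matrix_matrix_mult_def [of "conj_transpose ?y"] complex_norm_square mult.commute del: of_real_power)
    then show ?thesis using y by (simp add: unitaryD mat_def del: of_real_sum of_real_power)
  qed
  have "rtr (P ** psd_power T (1 - p)) = (\<Sum>i\<in>UNIV. \<Sum>j\<in>UNIV. a i * t j powr (1 - p) * (cmod (?y $ i $ j))\<^sup>2)"
    using rtr_form [OF P(1) psd_power_diagonalizes [OF t(1)], of "mat 1"] p by (simp add: pw_def)
  also have "\<dots> \<le> (\<Sum>i\<in>UNIV. \<Sum>j\<in>UNIV. (p * a i powr (1 / p) + (1 - p) * t j) * (cmod (?y $ i $ j))\<^sup>2)"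
  proof (intro sum_mono mult_right_mono)
    fix i j
    have "a i * t j powr (1 - p) = (a i powr (1 / p)) powr p * t j powr (1 - p)"
      using p P(2) [of i] by (simp add: powr_powr)
    also have "\<dots> \<le> p * a i powr (1 / p) + (1 - p) * t j"
    proof (cases "a i = 0 \<or> t j = 0")
      case True
      then show ?thesis using p P(2) [of i] t(2) [of j] by auto
    next
      case False
      then have "0 < a i" "0 < t j" using P(2) [of i] t(2) [of j] by auto
      then show ?thesis using p by (intro Youngs_inequality_0) auto
    qed
    finally show "a i * t j powr (1 - p) \<le> p * a i powr (1 / p) + (1 - p) * t j" .
  qed simp
  also have "\<dots> = p * (\<Sum>i\<in>UNIV. a i powr (1 / p) * (\<Sum>j\<in>UNIV. (cmod (?y $ i $ j))\<^sup>2))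
      + (1 - p) * (\<Sum>j\<in>UNIV. t j * (\<Sum>i\<in>UNIV. (cmod (?y $ i $ j))\<^sup>2))"
  proof -
    have "(\<Sum>i\<in>UNIV. \<Sum>j\<in>UNIV. t j * (cmod (?y $ i $ j))\<^sup>2) = (\<Sum>j\<in>UNIV. \<Sum>i\<in>UNIV. t j * (cmod (?y $ i $ j))\<^sup>2)"
      by (rule sum.swap)
    then show ?thesis by (simp add: distrib_right sum.distrib mult.assoc flip: sum_distrib_left)
  qed
  also have "\<dots> = p * (\<Sum>i\<in>UNIV. a i powr (1 / p)) + (1 - p) * rtr T"
    by (simp only: row col mult_1_right rtr_diagonalizes [OF t(1)])
  finally show ?thesis .
qed

lemma trace_young_eq:
  fixes P :: "complex^'m^'m"
  assumes p: "0 < p" "p < 1" and P: "diagonalizes U a P" "\<And>i. 0 \<le> a i"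
  shows "\<exists>T. pos_semidef T \<and> rtr (P ** psd_power T (1 - p)) = (\<Sum>i\<in>UNIV. a i powr (1 / p))
    \<and> rtr T = (\<Sum>i\<in>UNIV. a i powr (1 / p))"
proof -
  have U: "unitary U" using P by (simp add: diagonalizes_def)
  define T where "T = U ** real_diag (\<lambda>i. a i powr (1 / p)) ** conj_transpose U"
  have T: "diagonalizes U (\<lambda>i. a i powr (1 / p)) T" using U by (simp add: T_def diagonalizes_def)
  have "P ** psd_power T (1 - p) = U ** (real_diag a ** (conj_transpose U ** U)
      ** real_diag (\<lambda>i. pw (1 - p) (a i powr (1 / p)))) ** conj_transpose U"
    using P psd_power_diagonalizes [OF T, of "1 - p"] by (simp add: diagonalizes_def matrix_mul_assoc)
  also have "\<dots> = T"
  proof -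
    have "a i * pw (1 - p) (a i powr (1 / p)) = a i powr (1 / p)" for i
    proof (cases "a i = 0")
      case False
      then have "0 < a i" using P(2) [of i] by simp
      then have "a i * a i powr ((1 - p) / p) = a i powr (1 + (1 - p) / p)" by (simp add: powr_add)
      also have "1 + (1 - p) / p = 1 / p" using p by (simp add: field_simps)
      finally show ?thesis using p by (simp add: pw_def powr_powr)
    qed simp
    then show ?thesis using U by (simp add: unitaryD real_diag_mult T_def)
  qed
  finally have PT: "P ** psd_power T (1 - p) = T" .
  have "pos_semidef T" using T by (rule diagonalizes_psd) simp
  then show ?thesis using PT rtr_diagonalizes [OF T] by metis
qed

theorem epstein_concavity:
  fixes L :: "complex^'m^'n" and S :: "complex^'m^'m"
  assumes p: "0 < p" "p \<le> 1"
    and psd: "pos_semidef A1" "pos_semidef A2" and uv: "0 \<le> u" "0 \<le> v" "u + v = 1"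
    and P1: "diagonalizes U1 a1 (conj_transpose L ** psd_power A1 p ** L + conj_transpose S ** S)"
    and P2: "diagonalizes U2 a2 (conj_transpose L ** psd_power A2 p ** L + conj_transpose S ** S)"
    and P: "diagonalizes U a (conj_transpose L ** psd_power (u *\<^sub>R A1 + v *\<^sub>R A2) p ** L + conj_transpose S ** S)"
  shows "u * (\<Sum>i\<in>UNIV. a1 i powr (1 / p)) + v * (\<Sum>i\<in>UNIV. a2 i powr (1 / p)) \<le> (\<Sum>i\<in>UNIV. a i powr (1 / p))"
proof -
  define F where "F A = conj_transpose L ** psd_power A p ** L + conj_transpose S ** S" for A
  have psd': "pos_semidef (u *\<^sub>R A1 + v *\<^sub>R A2)" using psd uv by (simp add: psd_add psd_scaleR)
  have SS: "pos_semidef (conj_transpose S ** S)"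
    using psd_congruence [OF pos_def_imp_psd [OF pos_def_mat_1], of S] by simp
  have Fpsd: "pos_semidef (F A)" if "pos_semidef A" for A
    unfolding F_def using that SS by (intro psd_add psd_congruence psd_power_psd)
  have a: "0 \<le> a i" "0 \<le> a1 i" "0 \<le> a2 i" for i
    using diagonalizes_nonneg [OF P] diagonalizes_nonneg [OF P1] diagonalizes_nonneg [OF P2]
      Fpsd psd psd' unfolding F_def by auto
  show ?thesis
  proof (cases "p = 1")
    case True
    have "F (u *\<^sub>R A1 + v *\<^sub>R A2) = u *\<^sub>R F A1 + v *\<^sub>R F A2"
      using uv(3) psd psd' unfolding F_def True
      by (simp add: psd_power_1 matrix_add_ldistrib matrix_add_rdistrib scaleR_mat_mult_left
          scaleR_mat_mult_right scaleR_add_right add_ac flip: scaleR_add_left)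
    then have "rtr (F (u *\<^sub>R A1 + v *\<^sub>R A2)) = u * rtr (F A1) + v * rtr (F A2)"
      by (simp add: rtr_add rtr_scaleR)
    then have "(\<Sum>i\<in>UNIV. a i) = u * (\<Sum>i\<in>UNIV. a1 i) + v * (\<Sum>i\<in>UNIV. a2 i)"
      by (simp add: F_def rtr_diagonalizes [OF P] rtr_diagonalizes [OF P1] rtr_diagonalizes [OF P2])
    then show ?thesis using a by (simp add: True)
  next
    case False
    then have p: "0 < p" "p < 1" using p by auto
    obtain T1 where T1: "pos_semidef T1" "rtr (F A1 ** psd_power T1 (1 - p)) = (\<Sum>i\<in>UNIV. a1 i powr (1 / p))"
      "rtr T1 = (\<Sum>i\<in>UNIV. a1 i powr (1 / p))"
      using trace_young_eq [OF p P1 a(2)] unfolding F_def by blast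
    obtain T2 where T2: "pos_semidef T2" "rtr (F A2 ** psd_power T2 (1 - p)) = (\<Sum>i\<in>UNIV. a2 i powr (1 / p))"
      "rtr T2 = (\<Sum>i\<in>UNIV. a2 i powr (1 / p))"
      using trace_young_eq [OF p P2 a(3)] unfolding F_def by blast
    \<comment> \<open>\<open>T1\<close> and \<open>T2\<close> are optimal at the end points, whereas
      their mixture is only a competitor at \<open>?A\<close>: this is the direction that concavity
      needs.\<close>
    let ?A = "u *\<^sub>R A1 + v *\<^sub>R A2" and ?T = "u *\<^sub>R T1 + v *\<^sub>R T2"
    have Tpsd: "pos_semidef ?T" using T1 T2 uv by (simp add: psd_add psd_scaleR)
    have one: "u *\<^sub>R mat 1 + v *\<^sub>R mat 1 = (mat 1 :: complex^'m^'m)"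
      using uv by (simp flip: scaleR_add_left)
    have I: "pos_semidef (mat 1 :: complex^'m^'m)" by (rule pos_def_imp_psd) simp
    \<comment> \<open>The constant \<open>S\<^sup>* S\<close> still meets the varying
      \<open>T\<close>. Writing it with a power of the identity in place of that of \<open>A\<close>
      makes it another instance of Lieb's theorem.\<close>
    have split: "rtr (F A ** psd_power T (1 - p)) = rtr (conj_transpose L ** psd_power A p ** L ** psd_power T (1 - p))
        + rtr (conj_transpose S ** psd_power (mat 1) p ** S ** psd_power T (1 - p))" for A T
      by (simp add: F_def matrix_add_rdistrib rtr_add psd_power_mat_1)
    have "u * rtr (F A1 ** psd_power T1 (1 - p)) + v * rtr (F A2 ** psd_power T2 (1 - p))
        \<le> rtr (F ?A ** psd_power ?T (1 - p))"
      unfolding split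
      using lieb_concavity [OF p psd T1(1) T2(1) uv(1,2), of L]
        lieb_concavity [OF p I I T1(1) T2(1) uv(1,2), of S]
      by (simp add: one algebra_simps)
    also have "\<dots> \<le> p * (\<Sum>i\<in>UNIV. a i powr (1 / p)) + (1 - p) * rtr ?T"
      unfolding F_def by (rule trace_young [OF p P a(1) Tpsd])
    finally have "p * (u * rtr T1 + v * rtr T2) \<le> p * (\<Sum>i\<in>UNIV. a i powr (1 / p))"
      by (simp add: T1(2) T2(2) rtr_add rtr_scaleR flip: T1(3) T2(3)) (simp add: algebra_simps)
    then show ?thesis using p by (simp add: T1(3) T2(3))
  qed
qed

section \<open>The variational principle\<close>

definition const_mat :: "complex^'n^'m \<Rightarrow> complex poly^'n^'m" where
  "const_mat M = (\<chi> i j. [:M $ i $ j:])"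

lemma const_poly_sum: "[:\<Sum>i\<in>I. f i:] = (\<Sum>i\<in>I. [:f i :: 'a :: comm_monoid_add:])"
proof (induction I rule: infinite_finite_induct)
  case (insert a I)
  have "[:f a + sum f I:] = [:f a:] + [:sum f I:]" by simp
  with insert show ?case by simp
qed simp_all

lemma const_mat_mult: "const_mat (A ** B) = const_mat A ** const_mat B"
  by (simp add: const_mat_def vec_eq_iff matrix_matrix_mult_def const_poly_sum mult.commute)

lemma const_mat_1: "const_mat (mat 1) = mat 1"
  by (simp add: const_mat_def vec_eq_iff mat_def one_pCons)

text \<open>Conjugation is carried out over polynomial matrices, where the indeterminate times the
  identity is central, so multiplicativity of \<open>det\<close> reduces the claim to a diagonal
  matrix.\<close>

lemma charpoly_diagonalizes:
  fixes X :: "complex^'n^'n"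
  assumes "diagonalizes U d X"
  shows "charpoly X = (\<Prod>i\<in>UNIV. [:- of_real (d i), 1:])"
proof -
  let ?x = "(\<chi> i j. if i = j then [:0, 1:] else 0) :: complex poly^'n^'n"
  let ?D = "?x - const_mat (real_diag d)"
  have U: "unitary U" and X: "X = U ** real_diag d ** conj_transpose U"
    using assms by (auto simp: diagonalizes_def)
  have UU: "const_mat U ** const_mat (conj_transpose U) = mat 1"
    using U by (simp add: unitaryD const_mat_1 flip: const_mat_mult)
  have xc: "M ** ?x = ?x ** M" for M :: "complex poly^'n^'n"
    by (simp add: vec_eq_iff matrix_matrix_mult_def if_distrib [where f = "\<lambda>x. x * _"]
        if_distrib [where f = "\<lambda>x. _ * x"] mult.commute cong: if_cong)
  have sub_l: "A ** (B - C) = A ** B - A ** C" and sub_r: "(B - C) ** A = B ** A - C ** A"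
    for A B C :: "complex poly^'n^'n"
    by (simp_all add: vec_eq_iff matrix_matrix_mult_def sum_subtractf algebra_simps)
  have "charpoly X = det (?x - const_mat X)"
    unfolding charpoly_def by (rule arg_cong [where f = det]) (simp add: vec_eq_iff const_mat_def)
  also have "?x - const_mat X = const_mat U ** ?D ** const_mat (conj_transpose U)"
  proof -
    have "const_mat U ** ?x ** const_mat (conj_transpose U) = ?x"
      by (simp add: xc [of "const_mat U"] UU flip: matrix_mul_assoc)
    then show ?thesis by (simp add: X sub_l sub_r const_mat_mult)
  qed
  also have "det \<dots> = det ?D * det (const_mat U ** const_mat (conj_transpose U))"
    by (simp add: det_mul)
  also have "\<dots> = det ?D" by (simp add: UU)
  also have "\<dots> = (\<Prod>i\<in>UNIV. ?D $ i $ i)"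
    by (rule det_diagonal) (simp add: const_mat_def real_diag_def)
  finally show ?thesis by (simp add: const_mat_def real_diag_def)
qed

lemma coeff_prod_linear:
  fixes l :: "'n::finite \<Rightarrow> complex"
  assumes k: "k \<le> CARD('n)"
  shows "coeff (\<Prod>i\<in>UNIV. [:- l i, 1:]) (CARD('n) - k) = (- 1) ^ k * (\<Sum>I | card I = k. \<Prod>i\<in>I. l i)"
proof -
  have "(\<Prod>i\<in>UNIV. [:- l i, 1:]) = (\<Prod>i\<in>UNIV. [:- l i:] + [:0, 1:])" by simp
  also have "\<dots> = (\<Sum>I\<in>Pow UNIV. (\<Prod>i\<in>I. [:- l i:]) * (\<Prod>i\<in>UNIV - I. [:0, 1:]))"
    by (rule prod_add) simp
  also have "\<dots> = (\<Sum>I\<in>UNIV. monom (\<Prod>i\<in>I. - l i) (CARD('n) - card I))"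
  proof (rule sum.cong)
    fix I :: "'n set"
    have "(\<Prod>i\<in>I. [:- l i:]) = [:\<Prod>i\<in>I. - l i:]"
      by (induction I rule: infinite_finite_induct) (auto simp: one_pCons)
    moreover have "card (UNIV - I) = CARD('n) - card I" by (simp add: card_Diff_subset)
    ultimately show "(\<Prod>i\<in>I. [:- l i:]) * (\<Prod>i\<in>UNIV - I. [:0, 1:]) = monom (\<Prod>i\<in>I. - l i) (CARD('n) - card I)"
      by (simp add: monom_altdef)
  qed simp
  finally have "coeff (\<Prod>i\<in>UNIV. [:- l i, 1:]) (CARD('n) - k)
      = (\<Sum>I\<in>UNIV. if CARD('n) - card I = CARD('n) - k then \<Prod>i\<in>I. - l i else 0)"
    by (simp add: coeff_sum)
  also have "\<dots> = (\<Sum>I\<in>UNIV. if card I = k then \<Prod>i\<in>I. - l i else 0)"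
  proof (rule sum.cong)
    fix I :: "'n set"
    have "card I \<le> CARD('n)" by (rule card_mono) auto
    then have "CARD('n) - card I = CARD('n) - k \<longleftrightarrow> card I = k" using k by linarith
    then show "(if CARD('n) - card I = CARD('n) - k then \<Prod>i\<in>I. - l i else 0)
        = (if card I = k then \<Prod>i\<in>I. - l i else 0)" by simp
  qed simp
  also have "\<dots> = (\<Sum>I | card I = k. \<Prod>i\<in>I. - l i)"
    by (simp add: sum.If_cases)
  also have "\<dots> = (\<Sum>I | card I = k. (- 1) ^ k * (\<Prod>i\<in>I. l i))"
    by (rule sum.cong) (auto simp: prod_uminus)
  finally show ?thesis by (simp add: sum_distrib_left)
qed

text \<open>Both \<open>d\<close> and the arbitrary enumeration \<open>eigenvalues\<close> split the
  same polynomial, and \<open>Tr_k\<close> is one of its coefficients up to sign (Vieta).\<close>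

lemma phi_diagonalizes:
  fixes X :: "complex^'n^'n"
  assumes d: "diagonalizes U d X" and k: "k \<le> CARD('n)"
  shows "phi k X = root k (esum UNIV k d)"
proof -
  let ?l = "eigenvalues X" and ?d = "\<lambda>i. complex_of_real (d i)"
  have "charpoly X = (\<Prod>i\<in>UNIV. [:- ?l i, 1:])"
    unfolding eigenvalues_def by (rule someI [of _ ?d]) (rule charpoly_diagonalizes [OF d])
  then have "(\<Prod>i\<in>UNIV. [:- ?l i, 1:]) = (\<Prod>i\<in>UNIV. [:- ?d i, 1:])"
    using charpoly_diagonalizes [OF d] by simp
  then have "(- 1) ^ k * (\<Sum>I | card I = k. \<Prod>i\<in>I. ?l i) = (- 1) ^ k * (\<Sum>I | card I = k. \<Prod>i\<in>I. ?d i)"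
    by (metis coeff_prod_linear [OF k])
  then have "Tr_k k X = of_real (esum UNIV k d)" by (simp add: Tr_k_def esum_def)
  then show ?thesis by (simp add: phi_def)
qed

section \<open>A bound separating the two matrices, sharp at one point\<close>

lemma sorted_family_powr:
  "sorted_family f \<Longrightarrow> (\<And>i. 0 < f i) \<Longrightarrow> 0 \<le> e \<Longrightarrow> sorted_family (\<lambda>i. f i powr e)"
  by (simp add: sorted_family_def powr_mono2 less_imp_le)

lemma sorted_family_mult:
  "sorted_family f \<Longrightarrow> sorted_family g \<Longrightarrow> (\<And>i. 0 < f i) \<Longrightarrow> (\<And>i. 0 < g i) \<Longrightarrow> sorted_family (\<lambda>i. f i * g i)"
  by (simp add: sorted_family_def mult_mono less_imp_le)

text \<open>Singular value decomposition: the columns of \<open>V\<close> are the normalized right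
  singular vectors. The family \<open>b\<close> is kept in the same order, so it stays
  sorted.\<close>

lemma diagonalizes_swap:
  fixes B :: "complex^'n^'n"
  assumes b: "diagonalizes U b (B ** conj_transpose B)" "\<And>i. 0 < b i" and B: "invertible B"
  shows "\<exists>V. diagonalizes V b (conj_transpose B ** B)"
proof -
  define V where "V = conj_transpose B ** U ** real_diag (\<lambda>i. 1 / sqrt (b i))"
  have U: "unitary U" and BB: "B ** conj_transpose B = U ** real_diag b ** conj_transpose U"
    using b by (auto simp: diagonalizes_def)
  have bb: "1 / sqrt (b i) * b i * (1 / sqrt (b i)) = 1" for i
    using b(2) [of i] by (simp add: field_simps)
  have "conj_transpose V ** V = real_diag (\<lambda>i. 1 / sqrt (b i)) ** conj_transpose U
      ** (B ** conj_transpose B) ** U ** real_diag (\<lambda>i. 1 / sqrt (b i))"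
    by (simp add: V_def ct_mult matrix_mul_assoc)
  also have "\<dots> = real_diag (\<lambda>i. 1 / sqrt (b i)) ** (conj_transpose U ** U) ** real_diag b
      ** (conj_transpose U ** U) ** real_diag (\<lambda>i. 1 / sqrt (b i))"
    by (simp only: BB matrix_mul_assoc)
  also have "\<dots> = mat 1" using U bb by (simp add: unitaryD real_diag_mult)
  finally have V: "unitary V" by (rule unitary_if_left)
  have bs: "1 / sqrt (b i) * b i = sqrt (b i)" for i
    using b(2) [of i] by (simp add: real_div_sqrt)
  have "V ** real_diag b ** conj_transpose V = conj_transpose B ** U
      ** (real_diag (\<lambda>i. 1 / sqrt (b i)) ** real_diag b ** real_diag (\<lambda>i. 1 / sqrt (b i)))
      ** conj_transpose U ** B"
    by (simp add: V_def ct_mult matrix_mul_assoc)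
  also have "\<dots> = conj_transpose B ** (U ** conj_transpose U) ** B"
    by (simp only: real_diag_mult bb real_diag_1 matrix_mul_rid matrix_mul_assoc)
  also have "\<dots> = conj_transpose B ** B" using U by (simp add: unitaryD)
  finally show ?thesis using V unfolding diagonalizes_def by metis
qed

lemma diagonalizes_mat_1_unique:
  fixes U :: "complex^'n^'n"
  assumes "diagonalizes U a (mat 1)" shows "a i = 1"
proof -
  have "real_diag a = conj_transpose U ** (U ** real_diag a ** conj_transpose U) ** U"
    using assms unfolding diagonalizes_def
    by (metis matrix_mul_assoc matrix_mul_lid matrix_mul_rid unitaryD(1))
  also have "U ** real_diag a ** conj_transpose U = mat 1" using assms by (simp add: diagonalizes_def)
  also have "conj_transpose U ** mat 1 ** U = mat 1"
    using assms unfolding diagonalizes_def by (metis matrix_mul_rid unitaryD(1))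
  finally have "real_diag a $ i $ i = (mat 1 :: complex^'n^'n) $ i $ i" by simp
  then show ?thesis by (simp add: real_diag_nth mat_def)
qed

text \<open>Weighted arithmetic-geometric mean inequality for \<open>A\<close>, \<open>B\<close> and
  1, using the tangent to the logarithm at the weighted mean \<open>S\<close>.\<close>

lemma young_three:
  fixes A B :: real
  assumes "0 \<le> \<alpha>" "0 \<le> \<beta>" "\<alpha> + \<beta> \<le> 1" "0 < A" "0 < B"
  shows "A powr \<alpha> * B powr \<beta> \<le> \<alpha> * A + \<beta> * B + (1 - \<alpha> - \<beta>)"
proof -
  define S where "S = \<alpha> * A + \<beta> * B + (1 - \<alpha> - \<beta>)"
  have S: "0 < S"
  proof (cases "\<alpha> + \<beta> = 1")
    case True
    then have "0 < \<alpha> \<or> 0 < \<beta>" using assms by linarith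
    moreover have "0 \<le> \<alpha> * A" "0 \<le> \<beta> * B" using assms by simp_all
    moreover have "0 < \<alpha> \<Longrightarrow> 0 < \<alpha> * A" "0 < \<beta> \<Longrightarrow> 0 < \<beta> * B" using assms by simp_all
    ultimately show ?thesis unfolding S_def using True by linarith
  next
    case False
    then show ?thesis unfolding S_def using assms by (intro add_nonneg_pos) auto
  qed
  have ln_le: "ln x \<le> ln S + x / S - 1" if "0 < x" for x
    using ln_le_minus_one [of "x / S"] that S by (simp add: ln_div)
  have "\<alpha> * ln A + \<beta> * ln B + (1 - \<alpha> - \<beta>) * ln 1
      \<le> \<alpha> * (ln S + A / S - 1) + \<beta> * (ln S + B / S - 1) + (1 - \<alpha> - \<beta>) * (ln S + 1 / S - 1)"
    using assms by (intro add_mono mult_left_mono ln_le) auto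
  also have "\<dots> = ln S + (\<alpha> * A + \<beta> * B + (1 - \<alpha> - \<beta>)) / S - 1"
    by (simp add: add_divide_distrib diff_divide_distrib algebra_simps)
  also have "\<dots> = ln S + S / S - 1" by (simp only: S_def)
  finally have "\<alpha> * ln A + \<beta> * ln B \<le> ln S" using S by simp
  then have "exp (\<alpha> * ln A + \<beta> * ln B) \<le> S" using S by (metis exp_le_cancel_iff exp_ln)
  then show ?thesis using assms by (simp add: powr_def exp_add S_def)
qed

text \<open>At the base point \<open>(M0, Y0)\<close> the matrices \<open>Z\<close> and \<open>V\<close> are chosen
  so that \<open>Z\<^sup>* M0 Z\<close>, \<open>V Y0\<^sup>2 V\<^sup>*\<close> are diagonal with entries \<open>w\<^sup>p\<close>, \<open>w\<^sup>q\<close>, where \<open>w\<close> is the logarithmic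
  gradient of \<open>phi\<close>; then Horn, the tangent inequality and the arithmetic-geometric mean inequality
  are simultaneously sharp there.\<close>

lemma variational_bound:
  fixes M0 Y0 :: "complex^'m^'m"
  assumes k: "0 < k" "k \<le> CARD('m)"
    and pq: "0 \<le> p" "0 \<le> q" "0 < s" "s * (p + q) \<le> 1"
    and M0: "pos_def M0" and Y0: "pos_def Y0"
  shows "\<exists>(Z :: complex^'m^'m) (V :: complex^'m^'m) w. (\<forall>i. 0 < w i)
    \<and> phi k (psd_power (Y0 ** M0 ** Y0) s) = (\<Sum>i\<in>UNIV. w i)
    \<and> diagonalizes (mat 1) (\<lambda>i. w i powr p) (conj_transpose Z ** M0 ** Z)
    \<and> diagonalizes (mat 1) (\<lambda>i. w i powr q) (V ** Y0 ** Y0 ** conj_transpose V)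
    \<and> invertible Z \<and> invertible V
    \<and> (\<forall>M Y UA UB a b. pos_def M \<longrightarrow> pos_def Y \<longrightarrow> (p = 0 \<longrightarrow> M = M0) \<longrightarrow> (q = 0 \<longrightarrow> Y = Y0)
        \<longrightarrow> diagonalizes UA a (conj_transpose Z ** M ** Z) \<longrightarrow> sorted_family a
        \<longrightarrow> diagonalizes UB b (V ** Y ** Y ** conj_transpose V) \<longrightarrow> sorted_family b
        \<longrightarrow> phi k (psd_power (Y ** M ** Y) s)
          \<le> s * (p * (\<Sum>i\<in>UNIV. a i powr (1 / p))) + s * (q * (\<Sum>i\<in>UNIV. b i powr (1 / q)))
            + (1 - s * (p + q)) * (\<Sum>i\<in>UNIV. w i))"
proof -
  have herm: "conj_transpose Y = Y" if "pos_def Y" for Y :: "complex^'m^'m"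
    using that by (simp add: pos_def_def hermitian_def)
  have YMY: "pos_def (Y ** M ** Y)" if "pos_def M" "pos_def Y" for M Y :: "complex^'m^'m"
    using pos_def_congruence_invertible [OF that(1) pos_def_invertible [OF that(2)]] herm [OF that(2)]
    by simp
  have phi_eq: "phi k (psd_power H s) = root k (esum UNIV k (\<lambda>i. h i powr s))"
    if "diagonalizes U h H" for U h and H :: "complex^'m^'m"
    using phi_diagonalizes [OF psd_power_diagonalizes [OF that] k(2), of s] pq by (simp add: pw_def)
  obtain U g where g: "diagonalizes U g (Y0 ** M0 ** Y0)" "sorted_family g"
    using hermitian_diagonalizes_sorted YMY [OF M0 Y0] pos_def_def by blast
  have gp: "0 < g i" for i using diagonalizes_pos [OF g(1) YMY [OF M0 Y0]] .
  have U: "unitary U" using g by (simp add: diagonalizes_def)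
  define x where "x i = g i powr s" for i
  have xp: "0 < x i" for i using gp [of i] by (simp add: x_def)
  have xs: "sorted_family x" unfolding x_def using g gp pq by (intro sorted_family_powr) auto
  define e where "e = esum UNIV k x"
  have e: "0 < e" unfolding e_def using k xp by (intro esum_pos) auto
  define c where "c = root k e"
  have c: "0 < c" using e k by (simp add: c_def)
  \<comment> \<open>The derivative of \<open>root k (esum UNIV k x)\<close> in
    \<open>ln (x i)\<close>, as \<open>c / e\<close> is the power of \<open>e\<close> that the chain
    rule produces. By Euler's identity these sum to \<open>c\<close>.\<close>
  define w where "w i = c / (k * e) * wsum UNIV k x i" for i
  have fac: "0 < c / (k * e)" using c e k by simp
  have wp: "0 < w i" for i
    unfolding w_def using k xp fac by (intro mult_pos_pos wsum_pos) auto
  have xwn: "x i \<noteq> 0" "w i \<noteq> 0" for i using xp wp by (metis less_irrefl)+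
  have wsumc: "(\<Sum>i\<in>UNIV. w i) = c"
  proof -
    have "(\<Sum>i\<in>UNIV. w i) = c / (k * e) * (\<Sum>i\<in>UNIV. wsum UNIV k x i)"
      by (simp only: w_def sum_distrib_left)
    then show ?thesis using k e by (simp add: sum_wsum flip: e_def)
  qed
  \<comment> \<open>Chosen so that the Horn bound \<open>a i * (d i * d i) * b i\<close> returns
    \<open>g i\<close> at the base point, where \<open>a i = w i powr p\<close> and
    \<open>b i = w i powr q\<close>.\<close>
  define d where "d i = sqrt (g i) * w i powr (- (p + q) / 2)" for i
  have dp: "0 < d i" for i using gp [of i] wp [of i] by (simp add: d_def)
  have dd: "d i * d i = g i * w i powr (- (p + q))" for i
  proof -
    have "d i * d i = (sqrt (g i) * sqrt (g i)) * (w i powr (- (p + q) / 2) * w i powr (- (p + q) / 2))"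
      by (simp add: d_def mult_ac)
    then show ?thesis using gp [of i] by (simp add: less_imp_le flip: powr_add)
  qed
  have ds: "sorted_family (\<lambda>i. d i * d i)"
  proof -
    \<comment> \<open>Both factors are decreasing, the second because \<open>1 / s - (p + q)\<close>
      is nonnegative.\<close>
    have "d i * d i = (x i / w i) powr (p + q) * x i powr (1 / s - (p + q))" for i
    proof -
      have "x i powr (1 / s) = g i" using gp [of i] pq by (simp add: x_def powr_powr)
      then have "(x i / w i) powr r * x i powr (1 / s - r) = g i * w i powr (- r)" for r
        using xp [of i] wp [of i] by (simp add: powr_divide powr_diff powr_minus) (simp add: field_simps)
      then show ?thesis by (simp only: dd)
    qed
    moreover have "sorted_family (\<lambda>i. (x i / w i) powr (p + q) * x i powr (1 / s - (p + q)))"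
    proof (intro sorted_family_mult sorted_family_powr)
      have "y / (f * z) = (y / z) / f" for y f z :: real by (simp add: mult.commute)
      then have eq: "x i / w i = (x i / wsum UNIV k x i) / (c / (k * e))" for i by (simp only: w_def)
      show "sorted_family (\<lambda>i. x i / w i)"
        unfolding sorted_family_def eq using ratio_wsum_sorted [OF xs xp k]
        by (intro allI impI divide_right_mono less_imp_le [OF fac]) (simp add: sorted_family_def)
      show "0 \<le> 1 / s - (p + q)" using pq by (simp add: field_simps)
    qed (use xs xp wp xwn pq in auto)
    ultimately show ?thesis by simp
  qed
  obtain Yi where Yi: "Y0 ** Yi = mat 1" "Yi ** Y0 = mat 1"
    using pos_def_invertible [OF Y0] unfolding invertible_def by blast
  have Yih: "conj_transpose Yi = Yi"
    by (metis Yi ct_mat_1 ct_mult herm [OF Y0] matrix_mul_assoc matrix_mul_lid matrix_mul_rid)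
  have Yinv: "invertible Y0" "invertible Yi" using Yi by (auto simp: invertible_def)
  \<comment> \<open>Solves \<open>\<zeta> i * g i * \<zeta> i = w i powr p\<close>. With the
    analogous \<open>\<nu>\<close> the diagonal factors satisfy
    \<open>\<zeta> i * d i * \<nu> i = 1\<close>, which makes the factorization
    \<open>Z ** real_diag d ** V = mat 1\<close> possible.\<close>
  define \<zeta> where "\<zeta> i = w i powr (p / 2) / sqrt (g i)" for i
  define \<nu> where "\<nu> i = w i powr (q / 2)" for i
  have zn: "\<zeta> i \<noteq> 0" "\<nu> i \<noteq> 0" for i using wp [of i] gp [of i] by (auto simp: \<zeta>_def \<nu>_def)
  define Z where "Z = Y0 ** U ** real_diag \<zeta>"
  define V where "V = real_diag \<nu> ** conj_transpose U ** Yi"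
  have Zi: "invertible Z" and Vi: "invertible V"
    unfolding Z_def V_def
    by (intro invertible_mult Yinv unitary_invertible unitary_ct U invertible_real_diag zn)+
  have zdn: "\<zeta> i * d i * \<nu> i = 1" for i
  proof -
    have "\<zeta> i * d i * \<nu> i = w i powr (p / 2) * w i powr (- (p + q) / 2) * w i powr (q / 2)"
      using gp [of i] by (simp add: \<zeta>_def d_def \<nu>_def)
    also have "\<dots> = w i powr 0" by (simp add: field_simps flip: powr_add)
    finally show ?thesis using wp [of i] by simp
  qed
  have ZdV: "Z ** real_diag d ** V = mat 1"
  proof -
    have "Z ** real_diag d ** V
        = Y0 ** U ** (real_diag \<zeta> ** real_diag d ** real_diag \<nu>) ** conj_transpose U ** Yi"
      by (simp add: Z_def V_def matrix_mul_assoc)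
    also have "\<dots> = Y0 ** (U ** conj_transpose U) ** Yi"
      by (simp only: real_diag_mult zdn real_diag_1 matrix_mul_rid matrix_mul_assoc)
    finally show ?thesis using U Yi by (simp add: unitaryD)
  qed
  have VdZ: "conj_transpose V ** real_diag d ** conj_transpose Z = mat 1"
    using arg_cong [OF ZdV, of conj_transpose] by (simp add: ct_mult matrix_mul_assoc)
  have Z0: "conj_transpose Z ** M0 ** Z = real_diag (\<lambda>i. w i powr p)"
  proof -
    have "conj_transpose Z ** M0 ** Z = real_diag \<zeta> ** conj_transpose U ** (Y0 ** M0 ** Y0) ** U ** real_diag \<zeta>"
      by (simp add: Z_def ct_mult herm [OF Y0] matrix_mul_assoc)
    also have "\<dots> = real_diag \<zeta> ** (conj_transpose U ** U) ** real_diag g ** (conj_transpose U ** U) ** real_diag \<zeta>"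
      using g(1) by (simp only: diagonalizes_def matrix_mul_assoc)
    also have "\<dots> = real_diag (\<lambda>i. \<zeta> i * g i * \<zeta> i)" using U by (simp add: unitaryD real_diag_mult)
    also have "(\<lambda>i. \<zeta> i * g i * \<zeta> i) = (\<lambda>i. w i powr p)"
    proof
      fix i
      have "\<zeta> i * g i * \<zeta> i = (w i powr (p / 2) * w i powr (p / 2)) * (g i / (sqrt (g i) * sqrt (g i)))"
        by (simp add: \<zeta>_def)
      then show "\<zeta> i * g i * \<zeta> i = w i powr p" using gp [of i] by (simp add: less_imp_le flip: powr_add)
    qed
    finally show ?thesis .
  qed
  have V0: "V ** Y0 ** Y0 ** conj_transpose V = real_diag (\<lambda>i. w i powr q)"
  proof -
    have "V ** Y0 ** Y0 ** conj_transpose V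
        = real_diag \<nu> ** conj_transpose U ** (Yi ** Y0) ** (Y0 ** Yi) ** U ** real_diag \<nu>"
      by (simp add: V_def ct_mult Yih matrix_mul_assoc)
    also have "\<dots> = real_diag \<nu> ** (conj_transpose U ** U) ** real_diag \<nu>"
      by (simp only: Yi matrix_mul_rid matrix_mul_assoc)
    also have "\<dots> = real_diag (\<lambda>i. w i powr q)" using U by (simp add: unitaryD real_diag_mult \<nu>_def flip: powr_add)
    finally show ?thesis .
  qed
  have bound: "phi k (psd_power (Y ** M ** Y) s)
      \<le> s * (p * (\<Sum>i\<in>UNIV. a i powr (1 / p))) + s * (q * (\<Sum>i\<in>UNIV. b i powr (1 / q)))
        + (1 - s * (p + q)) * (\<Sum>i\<in>UNIV. w i)"
    if M: "pos_def M" and Y: "pos_def Y" and p0: "p = 0 \<longrightarrow> M = M0" and q0: "q = 0 \<longrightarrow> Y = Y0"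
      and a: "diagonalizes UA a (conj_transpose Z ** M ** Z)" "sorted_family a"
      and b: "diagonalizes UB b (V ** Y ** Y ** conj_transpose V)" "sorted_family b"
    for M Y UA UB a b
  proof -
    have Yinv: "invertible Y" using Y by (rule pos_def_invertible)
    have ap: "0 < a i" for i
      using diagonalizes_pos [OF a(1) pos_def_congruence_invertible [OF M Zi]] .
    have VYi: "invertible (V ** Y)" using Vi Yinv by (rule invertible_mult)
    have BB: "V ** Y ** Y ** conj_transpose V = (V ** Y) ** conj_transpose (V ** Y)"
      by (simp add: ct_mult herm [OF Y] matrix_mul_assoc)
    have "pos_def ((V ** Y) ** conj_transpose (V ** Y))"
      using pos_def_congruence_invertible [OF pos_def_mat_1 invertible_ct [OF VYi]] by simp
    then have bp: "0 < b i" for i using diagonalizes_pos [OF b(1)] by (simp add: BB)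
    obtain UY where UY: "diagonalizes UY b (conj_transpose (V ** Y) ** (V ** Y))"
      using diagonalizes_swap [OF b(1) [unfolded BB] bp VYi] by blast
    obtain UH h where h: "diagonalizes UH h (Y ** M ** Y)" "sorted_family h"
      using hermitian_diagonalizes_sorted YMY [OF M Y] pos_def_def by blast
    have hp: "0 < h i" for i using diagonalizes_pos [OF h(1) YMY [OF M Y]] .
    then have hn: "h i \<noteq> 0" for i by (metis less_irrefl)
    have "conj_transpose (V ** Y) ** real_diag d ** (conj_transpose Z ** M ** Z) ** real_diag d ** (V ** Y)
        = Y ** (conj_transpose V ** real_diag d ** conj_transpose Z) ** M ** (Z ** real_diag d ** V) ** Y"
      by (simp add: ct_mult herm [OF Y] matrix_mul_assoc)
    then have eq: "conj_transpose (V ** Y) ** real_diag d ** (conj_transpose Z ** M ** Z) ** real_diag d ** (V ** Y)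
        = Y ** M ** Y" by (simp add: ZdV VdZ)
    define v where "v i = (a i * (d i * d i) * b i) powr s" for i
    have vp: "0 < v i" for i using ap [of i] bp [of i] dp [of i] by (simp add: v_def)
    have horn: "(\<Prod>i | idx i < j. h i) \<le> (\<Prod>i | idx i < j. a i * (d i * d i) * b i)" for j
      by (rule horn_inequality [OF a(1) ap a(2) dp ds VYi UY bp b(2) h(1) [folded eq]])
    have "esum UNIV k (\<lambda>i. h i powr s) \<le> esum UNIV k v"
    proof (rule esum_weak_log_majorization)
      fix j
      have pr: "(\<Prod>i | idx i < j. f i powr s) = (\<Prod>i | idx i < j. f i) powr s"
        if "\<And>i. 0 < f i" for f :: "'m \<Rightarrow> real"
        using that by (simp add: prod_powr_distrib less_imp_le)
      have "(\<Prod>i | idx i < j. h i) powr s \<le> (\<Prod>i | idx i < j. a i * (d i * d i) * b i) powr s"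
        using horn [of j] hp pq by (intro powr_mono2) (auto intro!: prod_nonneg simp: less_imp_le)
      then show "(\<Prod>i | idx i < j. h i powr s) \<le> (\<Prod>i | idx i < j. v i)"
        using hp ap bp dp by (simp add: v_def pr)
    qed (use h hp hn pq vp k in \<open>auto intro!: sorted_family_powr simp: less_imp_le\<close>)
    \<comment> \<open>The linearization of \<open>v i\<close> by \<open>young_three\<close>; all
      three means are 1 at the base point, so there \<open>y i = x i\<close>.\<close>
    define y where "y i = x i * (p * s * (a i powr (1 / p) / w i) + q * s * (b i powr (1 / q) / w i)
        + (1 - p * s - q * s))" for i
    have vy: "v i \<le> y i" for i
    proof -
      \<comment> \<open>For \<open>p = 0\<close> division by zero makes both exponents on the left
        0, so its value is 1. The right side agrees because then \<open>M = M0\<close>, and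
        \<open>Z\<^sup>* M0 Z\<close> is the identity.\<close>
      have pas: "(a i powr (1 / p) / w i) powr (p * s) = a i powr s / w i powr (p * s)"
      proof (cases "p = 0")
        case True
        then have "diagonalizes UA a (mat 1)" using a(1) p0 Z0 xwn by simp
        then have "a i = 1" by (rule diagonalizes_mat_1_unique)
        then show ?thesis using True wp [of i] by simp
      next
        case False
        then show ?thesis using ap [of i] wp [of i] by (simp add: powr_divide powr_powr)
      qed
      have qbs: "(b i powr (1 / q) / w i) powr (q * s) = b i powr s / w i powr (q * s)"
      proof (cases "q = 0")
        case True
        then have "diagonalizes UB b (mat 1)" using b(1) q0 V0 xwn by simp
        then have "b i = 1" by (rule diagonalizes_mat_1_unique)
        then show ?thesis using True wp [of i] by simp
      next
        case False
        then show ?thesis using bp [of i] wp [of i] by (simp add: powr_divide powr_powr)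
      qed
      have "v i = a i powr s * (g i powr s * w i powr (- (p + q) * s)) * b i powr s"
        using ap [of i] bp [of i] gp [of i] wp [of i]
        by (simp add: v_def dd powr_mult powr_powr)
      also have "w i powr (- (p + q) * s) = inverse (w i powr (p * s)) * inverse (w i powr (q * s))"
        by (simp add: algebra_simps flip: powr_minus powr_add)
      finally have "v i = x i * ((a i powr s / w i powr (p * s)) * (b i powr s / w i powr (q * s)))"
        by (simp add: x_def divide_inverse mult_ac)
      also have "\<dots> = x i * ((a i powr (1 / p) / w i) powr (p * s) * (b i powr (1 / q) / w i) powr (q * s))"
        by (simp only: pas qbs)
      also have "\<dots> \<le> y i"
        unfolding y_def using pq xp [of i] ap [of i] bp [of i] wp [of i]
        by (intro mult_left_mono young_three) (auto simp: algebra_simps)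
      finally show ?thesis .
    qed
    have yp: "0 < y i" for i using vp [of i] vy [of i] by linarith
    have "phi k (psd_power (Y ** M ** Y) s) = root k (esum UNIV k (\<lambda>i. h i powr s))"
      by (rule phi_eq [OF h(1)])
    also have "\<dots> \<le> root k (esum UNIV k y)"
    proof -
      have "esum UNIV k v \<le> esum UNIV k y" using vp vy by (intro esum_mono) (auto simp: less_imp_le)
      then show ?thesis using k \<open>esum UNIV k (\<lambda>i. h i powr s) \<le> esum UNIV k v\<close> by simp
    qed
    also have "\<dots> = c / (k * e) * (root k (esum UNIV k y / e) * (k * e))"
      using k e by (simp add: c_def real_root_divide)
    also have "\<dots> \<le> c / (k * e) * (\<Sum>i\<in>UNIV. y i / x i * wsum UNIV k x i)"
      using esum_root_tangent [of UNIV k x y] k xp yp fac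
      by (intro mult_left_mono) (auto simp: e_def)
    also have "\<dots> = (\<Sum>i\<in>UNIV. y i / x i * w i)"
      by (simp add: w_def sum_distrib_left mult_ac)
    \<comment> \<open>Here \<open>x i\<close> cancels against the tangent coefficients and
      \<open>w i\<close> against the denominators in \<open>y i\<close>, leaving unweighted
      traces.\<close>
    also have "\<dots> = (\<Sum>i\<in>UNIV. s * (p * a i powr (1 / p)) + s * (q * b i powr (1 / q)) + (1 - s * (p + q)) * w i)"
    proof (rule sum.cong)
      fix i
      show "y i / x i * w i = s * (p * a i powr (1 / p)) + s * (q * b i powr (1 / q)) + (1 - s * (p + q)) * w i"
        using xp [of i] wp [of i] by (simp add: y_def field_simps)
    qed simp
    finally show ?thesis by (simp add: sum.distrib sum_distrib_left)
  qed
  have "phi k (psd_power (Y0 ** M0 ** Y0) s) = (\<Sum>i\<in>UNIV. w i)"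
    using phi_eq [OF g(1)] by (simp add: wsumc c_def e_def x_def [abs_def])
  moreover have "diagonalizes (mat 1) (\<lambda>i. w i powr p) (conj_transpose Z ** M0 ** Z)"
    "diagonalizes (mat 1) (\<lambda>i. w i powr q) (V ** Y0 ** Y0 ** conj_transpose V)"
    by (simp_all add: diagonalizes_def Z0 V0)
  ultimately show ?thesis using wp Zi Vi bound by blast
qed

section \<open>Joint concavity\<close>

lemma psd_power_pos_def: "pos_def X \<Longrightarrow> pos_def (psd_power X p)"
  by (metis diagonalizes_pos diagonalizes_pos_def hermitian_diagonalizes pos_def_def
      psd_power_diagonalizes pw_pos)

lemma psd_power_hermitian: "pos_semidef X \<Longrightarrow> conj_transpose (psd_power X p) = psd_power X p"
  using psd_power_psd unfolding pos_semidef_inner hermitian_def by blast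

lemma psd_power_half_square:
  assumes "pos_semidef X"
  shows "psd_power X (q / 2) ** psd_power X (q / 2) = psd_power X q"
proof -
  obtain U d where d: "diagonalizes U d X" "\<And>i. 0 \<le> d i" using assms by (rule psd_diagonalizes) blast
  have U: "unitary U" using d by (simp add: diagonalizes_def)
  have "psd_power X (q / 2) ** psd_power X (q / 2)
      = U ** real_diag (\<lambda>i. pw (q / 2) (d i)) ** (conj_transpose U ** U)
        ** real_diag (\<lambda>i. pw (q / 2) (d i)) ** conj_transpose U"
    using psd_power_diagonalizes [OF d(1), of "q / 2"] by (simp add: diagonalizes_def matrix_mul_assoc)
  also have "\<dots> = U ** (real_diag (\<lambda>i. pw (q / 2) (d i)) ** real_diag (\<lambda>i. pw (q / 2) (d i)))
        ** conj_transpose U"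
    using U by (simp add: unitaryD matrix_mul_assoc)
  also have "real_diag (\<lambda>i. pw (q / 2) (d i)) ** real_diag (\<lambda>i. pw (q / 2) (d i)) = real_diag (\<lambda>i. pw q (d i))"
  proof -
    have "pw (q / 2) t * pw (q / 2) t = pw q t" for t
      by (simp add: pw_def flip: powr_add)
    then show ?thesis by (simp add: real_diag_mult)
  qed
  also have "U ** real_diag (\<lambda>i. pw q (d i)) ** conj_transpose U = psd_power X q"
    using psd_power_diagonalizes [OF d(1), of q] by (simp add: diagonalizes_def)
  finally show ?thesis .
qed

text \<open>The regularised version of the inner matrix \<open>K\<^sup>* A\<^sup>p K\<close>: the summand \<open>\<delta> I\<close> makes it positive
  definite even when \<open>K\<close> is not injective.\<close>

definition inner_mat :: "real \<Rightarrow> real \<Rightarrow> complex^'m^'n \<Rightarrow> complex^'n^'n \<Rightarrow> complex^'m^'m" where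
  "inner_mat \<delta> p K A = conj_transpose K ** psd_power A p ** K + \<delta> *\<^sub>R mat 1"

lemma inner_mat_pos_def: "pos_semidef A \<Longrightarrow> 0 < \<delta> \<Longrightarrow> pos_def (inner_mat \<delta> p K A)"
  unfolding inner_mat_def
  by (subst add.commute) (intro pos_def_add_psd pos_def_scaleR pos_def_mat_1 psd_congruence psd_power_psd)

text \<open>Brings the regularised term to the form required by \<open>epstein_concavity\<close>,
  with \<open>L = K ** Z\<close> and \<open>S = sqrt \<delta> *\<^sub>R Z\<close>.\<close>

lemma inner_mat_congruence:
  assumes "0 \<le> \<delta>"
  shows "conj_transpose Z ** inner_mat \<delta> p K A ** Z
    = conj_transpose (K ** Z) ** psd_power A p ** (K ** Z)
      + conj_transpose (sqrt \<delta> *\<^sub>R Z) ** (sqrt \<delta> *\<^sub>R Z)"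
  using assms by (simp add: inner_mat_def ct_mult ct_scaleR matrix_add_ldistrib matrix_add_rdistrib
      scaleR_mat_mult_left scaleR_mat_mult_right matrix_mul_assoc)

text \<open>The bound is made sharp at the mixture. The same \<open>Z\<close>, \<open>V\<close> and
  \<open>w\<close> bound both end points from above, and Epstein's theorem compares the averaged
  traces with those at the mixture.\<close>

lemma concave_pos_def:
  fixes K :: "complex^'m^'n"
  assumes k: "0 < k" "k \<le> CARD('m)"
    and pq: "0 \<le> p" "p \<le> 1" "0 \<le> q" "q \<le> 1" "0 < s" "s * (p + q) \<le> 1" and \<delta>: "0 < \<delta>"
    and A: "pos_semidef A1" "pos_semidef A2" and B: "pos_def B1" "pos_def B2"
    and uv: "0 \<le> u" "0 \<le> v" "u + v = 1"
  shows "u * phi k (psd_power (psd_power B1 (q / 2) ** inner_mat \<delta> p K A1 ** psd_power B1 (q / 2)) s)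
      + v * phi k (psd_power (psd_power B2 (q / 2) ** inner_mat \<delta> p K A2 ** psd_power B2 (q / 2)) s)
    \<le> phi k (psd_power (psd_power (u *\<^sub>R B1 + v *\<^sub>R B2) (q / 2) ** inner_mat \<delta> p K (u *\<^sub>R A1 + v *\<^sub>R A2)
          ** psd_power (u *\<^sub>R B1 + v *\<^sub>R B2) (q / 2)) s)"
proof -
  define A where "A = u *\<^sub>R A1 + v *\<^sub>R A2"
  define B where "B = u *\<^sub>R B1 + v *\<^sub>R B2"
  have Apsd: "pos_semidef A" unfolding A_def using A uv by (intro psd_add psd_scaleR)
  have Bpd: "pos_def B"
  proof (cases "u = 0")
    case True
    then show ?thesis using B uv by (simp add: B_def)
  next
    case False
    then show ?thesis unfolding B_def
      using B uv by (intro pos_def_add_psd pos_def_scaleR psd_scaleR pos_def_imp_psd) auto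
  qed
  note Bpsd = pos_def_imp_psd [OF B(1)] pos_def_imp_psd [OF B(2)] pos_def_imp_psd [OF Bpd]
  let ?M = "inner_mat \<delta> p K" and ?Y = "\<lambda>B. psd_power B (q / 2)"
  have M: "pos_def (?M A1)" "pos_def (?M A2)" "pos_def (?M A)"
    using A Apsd \<delta> by (simp_all add: inner_mat_pos_def)
  have Y: "pos_def (?Y B1)" "pos_def (?Y B2)" "pos_def (?Y B)"
    using B Bpd by (simp_all add: psd_power_pos_def)
  obtain Z V :: "complex^'m^'m" and w where w: "\<And>i. 0 < w i"
    and val: "phi k (psd_power (?Y B ** ?M A ** ?Y B) s) = (\<Sum>i\<in>UNIV. w i)"
    and ZM: "diagonalizes (mat 1) (\<lambda>i. w i powr p) (conj_transpose Z ** ?M A ** Z)"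
    and VY: "diagonalizes (mat 1) (\<lambda>i. w i powr q) (V ** ?Y B ** ?Y B ** conj_transpose V)"
    and inv: "invertible Z" "invertible V"
    and bound: "\<And>M Y UA UB a b. pos_def M \<Longrightarrow> pos_def Y \<Longrightarrow> (p = 0 \<longrightarrow> M = ?M A) \<Longrightarrow> (q = 0 \<longrightarrow> Y = ?Y B)
        \<Longrightarrow> diagonalizes UA a (conj_transpose Z ** M ** Z) \<Longrightarrow> sorted_family a
        \<Longrightarrow> diagonalizes UB b (V ** Y ** Y ** conj_transpose V) \<Longrightarrow> sorted_family b
        \<Longrightarrow> phi k (psd_power (Y ** M ** Y) s)
          \<le> s * (p * (\<Sum>i\<in>UNIV. a i powr (1 / p))) + s * (q * (\<Sum>i\<in>UNIV. b i powr (1 / q)))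
            + (1 - s * (p + q)) * (\<Sum>i\<in>UNIV. w i)"
    using variational_bound [OF k pq(1) pq(3) pq(5,6) M(3) Y(3)] by metis
  let ?c = "\<Sum>i\<in>UNIV. w i"
  \<comment> \<open>The form of \<open>epstein_concavity\<close> with \<open>L = V\<^sup>*\<close>
    and no constant term.\<close>
  have VB: "V ** ?Y X ** ?Y X ** conj_transpose V
      = conj_transpose (conj_transpose V) ** psd_power X q ** conj_transpose V + conj_transpose 0 ** (0 :: complex^'m^'m)"
    if "pos_semidef X" for X
    using psd_power_half_square [OF that, of q] by (simp flip: matrix_mul_assoc)
  have hZ: "hermitian (conj_transpose Z ** X ** Z)" if "pos_def X" for X
    using that by (intro hermitian_congruence) (simp add: pos_def_def)
  have hV: "hermitian (V ** ?Y X ** ?Y X ** conj_transpose V)" if "pos_semidef X" for X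
    unfolding VB [OF that] using that
    by (simp add: hermitian_congruence psd_power_psd [unfolded pos_semidef_inner])
      (metis ct_ct hermitian_congruence pos_semidef_inner psd_power_psd)
  obtain U1 a1 where a1: "diagonalizes U1 a1 (conj_transpose Z ** ?M A1 ** Z)" "sorted_family a1"
    using hermitian_diagonalizes_sorted [OF hZ [OF M(1)]] by blast
  obtain U2 a2 where a2: "diagonalizes U2 a2 (conj_transpose Z ** ?M A2 ** Z)" "sorted_family a2"
    using hermitian_diagonalizes_sorted [OF hZ [OF M(2)]] by blast
  obtain V1 b1 where b1: "diagonalizes V1 b1 (V ** ?Y B1 ** ?Y B1 ** conj_transpose V)" "sorted_family b1"
    using hermitian_diagonalizes_sorted [OF hV [OF Bpsd(1)]] by blast
  obtain V2 b2 where b2: "diagonalizes V2 b2 (V ** ?Y B2 ** ?Y B2 ** conj_transpose V)" "sorted_family b2"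
    using hermitian_diagonalizes_sorted [OF hV [OF Bpsd(2)]] by blast
  \<comment> \<open>At the mixture both traces equal \<open>?c\<close>, so that the weights
    \<open>s * p\<close>, \<open>s * q\<close> and \<open>1 - s * (p + q)\<close> recombine to
    \<open>?c\<close> itself.\<close>
  have wpow: "(\<Sum>i\<in>UNIV. (w i powr r) powr (1 / r)) = ?c" if "0 < r" for r
    using that w by (simp add: powr_powr less_imp_le)
  define a1s a2s b1s b2s where "a1s = (\<Sum>i\<in>UNIV. a1 i powr (1 / p))"
    and "a2s = (\<Sum>i\<in>UNIV. a2 i powr (1 / p))" and "b1s = (\<Sum>i\<in>UNIV. b1 i powr (1 / q))"
    and "b2s = (\<Sum>i\<in>UNIV. b2 i powr (1 / q))"
  have eA: "p * (u * a1s + v * a2s) \<le> p * ?c"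
  proof (cases "p = 0")
    case False
    then have p: "0 < p" using pq by simp
    have "u * a1s + v * a2s \<le> ?c"
      unfolding a1s_def a2s_def wpow [OF p, symmetric]
      using a1(1) a2(1) ZM \<delta> unfolding A_def
      by (intro epstein_concavity [OF p pq(2) A uv]) (simp_all add: inner_mat_congruence)
    then show ?thesis using p by simp
  qed simp
  have eB: "q * (u * b1s + v * b2s) \<le> q * ?c"
  proof (cases "q = 0")
    case False
    then have q: "0 < q" using pq by simp
    have "u * b1s + v * b2s \<le> ?c"
      unfolding b1s_def b2s_def wpow [OF q, symmetric]
      using b1(1) [unfolded VB [OF Bpsd(1)]] b2(1) [unfolded VB [OF Bpsd(2)]] VY [unfolded VB [OF Bpsd(3)]]
      unfolding B_def
      by (intro epstein_concavity [OF q pq(4) Bpsd(1,2) uv])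
    then show ?thesis using q by simp
  qed simp
  \<comment> \<open>With exponent zero the matrix does not depend on its argument, so the side
    conditions of \<open>bound\<close> hold in the degenerate cases.\<close>
  have M0: "?M A1 = ?M A" "?M A2 = ?M A" if "p = 0"
    using that A Apsd by (simp_all add: inner_mat_def psd_power_0)
  have Y0: "?Y B1 = ?Y B" "?Y B2 = ?Y B" if "q = 0"
    using that Bpsd by (simp_all add: psd_power_0)
  have "u * phi k (psd_power (?Y B1 ** ?M A1 ** ?Y B1) s) + v * phi k (psd_power (?Y B2 ** ?M A2 ** ?Y B2) s)
      \<le> u * (s * (p * a1s) + s * (q * b1s) + (1 - s * (p + q)) * ?c)
        + v * (s * (p * a2s) + s * (q * b2s) + (1 - s * (p + q)) * ?c)"
    unfolding a1s_def a2s_def b1s_def b2s_def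
    using bound [OF M(1) Y(1) _ _ a1 b1] bound [OF M(2) Y(2) _ _ a2 b2] M0 Y0 uv
    by (intro add_mono mult_left_mono) auto
  also have "\<dots> = s * (p * (u * a1s + v * a2s)) + s * (q * (u * b1s + v * b2s))
      + (u + v) * ((1 - s * (p + q)) * ?c)"
    by (simp add: algebra_simps)
  also have "\<dots> \<le> s * (p * ?c) + s * (q * ?c) + (u + v) * ((1 - s * (p + q)) * ?c)"
    by (intro add_mono order_refl mult_left_mono [OF eA] mult_left_mono [OF eB]) (use pq in auto)
  also have "\<dots> = ?c" using uv by (simp add: algebra_simps)
  finally show ?thesis by (simp only: val flip: A_def B_def)
qed

section \<open>Passage to singular matrices\<close>

lemma tendsto_matrix_mult:
  fixes A :: "nat \<Rightarrow> complex^'n^'m" and B :: "nat \<Rightarrow> complex^'k^'n"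
  assumes "A \<longlonglongrightarrow> a" "B \<longlonglongrightarrow> b"
  shows "(\<lambda>n. A n ** B n) \<longlonglongrightarrow> a ** b"
  unfolding matrix_matrix_mult_def
  by (intro tendsto_vec_lambda tendsto_sum tendsto_mult tendsto_vec_nth assms)

lemma tendsto_ct: "A \<longlonglongrightarrow> a \<Longrightarrow> (\<lambda>n. conj_transpose (A n)) \<longlonglongrightarrow> conj_transpose a"
  unfolding conj_transpose_def
  by (intro tendsto_vec_lambda tendsto_cnj tendsto_vec_nth)

lemma tendsto_real_diag: "(\<And>i. (\<lambda>n. d n i) \<longlonglongrightarrow> e i) \<Longrightarrow> (\<lambda>n. real_diag (d n)) \<longlonglongrightarrow> real_diag e"
  unfolding real_diag_def
  by (intro tendsto_vec_lambda) (auto intro: tendsto_of_real)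

text \<open>For \<open>p = 0\<close> the function is constantly 1, also at zero; for
  \<open>p > 0\<close> the power is continuous from the right at zero.\<close>

lemma tendsto_pw:
  assumes "0 \<le> p" "d \<longlonglongrightarrow> e" "\<And>n. 0 \<le> d n"
  shows "(\<lambda>n. pw p (d n)) \<longlonglongrightarrow> pw p e"
  using assms unfolding pw_def by (auto intro!: tendsto_powr2)

lemma psd_power_tendsto:
  fixes X :: "complex^'n^'n"
  assumes X: "pos_semidef X" and p: "0 \<le> p" and e: "e \<longlonglongrightarrow> 0" "\<And>n. 0 \<le> e n"
  shows "(\<lambda>n. psd_power (X + e n *\<^sub>R mat 1) p) \<longlonglongrightarrow> psd_power X p"
proof -
  obtain U d where d: "diagonalizes U d X" "\<And>i. 0 \<le> d i" using X by (rule psd_diagonalizes) blast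
  have U: "unitary U" using d by (simp add: diagonalizes_def)
  have "diagonalizes U (\<lambda>i. d i + e n) (X + e n *\<^sub>R mat 1)" for n
  proof -
    have "U ** (real_diag d + e n *\<^sub>R real_diag (\<lambda>i. 1)) ** conj_transpose U = X + e n *\<^sub>R mat 1"
      using d(1) U by (simp add: diagonalizes_def matrix_add_ldistrib matrix_add_rdistrib
          scaleR_mat_mult_left scaleR_mat_mult_right unitaryD)
    then show ?thesis
      using U by (simp only: diagonalizes_def real_diag_add real_diag_scaleR mult_1_right)
  qed
  then have eq: "psd_power (X + e n *\<^sub>R mat 1) p = U ** real_diag (\<lambda>i. pw p (d i + e n)) ** conj_transpose U" for n
    using psd_power_diagonalizes unfolding diagonalizes_def by blast
  have eq0: "psd_power X p = U ** real_diag (\<lambda>i. pw p (d i)) ** conj_transpose U"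
    using psd_power_diagonalizes [OF d(1), of p] by (simp add: diagonalizes_def)
  have "(\<lambda>n. pw p (d i + e n)) \<longlonglongrightarrow> pw p (d i)" for i
    using tendsto_pw [OF p tendsto_add [OF tendsto_const e(1)], of "d i"] d(2) e(2) by simp
  then show ?thesis
    unfolding eq eq0 by (intro tendsto_matrix_mult tendsto_real_diag tendsto_const)
qed

lemma unitary_entry_le:
  assumes "unitary U" shows "cmod (U $ i $ j) \<le> 1"
proof -
  have "of_real (\<Sum>k\<in>UNIV. (cmod (U $ i $ k))\<^sup>2) = (U ** conj_transpose U) $ i $ i"
    by (simp add: matrix_matrix_mult_def complex_norm_square del: of_real_power)
  then have "(\<Sum>k\<in>UNIV. (cmod (U $ i $ k))\<^sup>2) = 1"
    using assms by (simp add: unitaryD mat_def del: of_real_sum of_real_power)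
  moreover have "(cmod (U $ i $ j))\<^sup>2 \<le> (\<Sum>k\<in>UNIV. (cmod (U $ i $ k))\<^sup>2)"
    by (rule member_le_sum) auto
  ultimately show ?thesis by (simp add: power2_le_iff_abs_le abs_square_le_1)
qed

lemma unitary_norm_le:
  fixes U :: "complex^'n^'n"
  assumes "unitary U" shows "norm U \<le> real CARD('n) * real CARD('n)"
proof -
  have row: "norm (U $ i) \<le> real CARD('n)" for i
  proof -
    have "norm (U $ i) \<le> (\<Sum>j\<in>UNIV. norm (U $ i $ j))" by (simp add: norm_vec_def L2_set_le_sum)
    also have "\<dots> \<le> (\<Sum>j\<in>(UNIV :: 'n set). 1)" by (intro sum_mono unitary_entry_le assms)
    finally show ?thesis by simp
  qed
  have "norm U \<le> (\<Sum>i\<in>UNIV. norm (U $ i))" by (simp add: norm_vec_def L2_set_le_sum)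
  also have "\<dots> \<le> (\<Sum>i\<in>(UNIV :: 'n set). real CARD('n))" by (intro sum_mono row)
  finally show ?thesis by simp
qed

text \<open>The unitary group is compact, so diagonalizing unitaries converge along a subsequence.\<close>

lemma phi_power_subseq:
  fixes X :: "nat \<Rightarrow> complex^'n^'n"
  assumes k: "k \<le> CARD('n)" and s: "0 \<le> s" and lim: "X \<longlonglongrightarrow> L" and psd: "\<And>n. pos_semidef (X n)"
  shows "\<exists>r. strict_mono r \<and> (\<lambda>n. phi k (psd_power (X (r n)) s)) \<longlonglongrightarrow> phi k (psd_power L s)"
proof -
  have "\<exists>U d. diagonalizes U d (X n) \<and> (\<forall>i. 0 \<le> d i)" for n
    using psd_diagonalizes [OF psd [of n]] by metis
  then obtain U d where U: "\<And>n. diagonalizes (U n) (d n) (X n)" and d: "\<And>n i. 0 \<le> d n i"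
    by metis
  have Uu: "unitary (U n)" for n using U by (simp add: diagonalizes_def)
  have "bounded (range U)"
    using unitary_norm_le [OF Uu] by (auto simp: bounded_iff)
  then obtain V r where r: "strict_mono r" and V: "(U \<circ> r) \<longlonglongrightarrow> V"
    using bounded_imp_convergent_subsequence by blast
  have V': "(\<lambda>n. U (r n)) \<longlonglongrightarrow> V" using V by (simp add: o_def)
  have X': "(\<lambda>n. X (r n)) \<longlonglongrightarrow> L" using LIMSEQ_subseq_LIMSEQ [OF lim r] by (simp add: o_def)
  have "(\<lambda>n. conj_transpose (U (r n)) ** U (r n)) \<longlonglongrightarrow> conj_transpose V ** V"
    by (intro tendsto_matrix_mult tendsto_ct V')
  then have "conj_transpose V ** V = mat 1"
    using Uu by (simp add: unitaryD LIMSEQ_const_iff)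
  then have Vu: "unitary V" by (rule unitary_if_left)
  \<comment> \<open>The eigenvalues are read off as diagonal entries of
    \<open>U\<^sup>* X U\<close>, so they converge along with the unitaries.\<close>
  define e where "e i = Re ((conj_transpose V ** L ** V) $ i $ i)" for i
  have dU: "real_diag (d n) = conj_transpose (U n) ** X n ** U n" for n
  proof -
    have "conj_transpose (U n) ** X n ** U n
        = (conj_transpose (U n) ** U n) ** real_diag (d n) ** (conj_transpose (U n) ** U n)"
      using U [of n] by (simp add: diagonalizes_def matrix_mul_assoc)
    then show ?thesis using Uu [of n] by (simp add: unitaryD)
  qed
  have "(\<lambda>n. conj_transpose (U (r n)) ** X (r n) ** U (r n)) \<longlonglongrightarrow> conj_transpose V ** L ** V"
    by (intro tendsto_matrix_mult tendsto_ct V' X')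
  then have "(\<lambda>n. Re ((conj_transpose (U (r n)) ** X (r n) ** U (r n)) $ i $ i)) \<longlonglongrightarrow> e i" for i
    unfolding e_def by (intro tendsto_Re tendsto_vec_nth)
  then have de: "(\<lambda>n. d (r n) i) \<longlonglongrightarrow> e i" for i by (simp add: real_diag_nth flip: dU)
  have "(\<lambda>n. U (r n) ** real_diag (d (r n)) ** conj_transpose (U (r n))) \<longlonglongrightarrow> V ** real_diag e ** conj_transpose V"
    by (intro tendsto_matrix_mult tendsto_ct V' tendsto_real_diag de)
  then have "(\<lambda>n. X (r n)) \<longlonglongrightarrow> V ** real_diag e ** conj_transpose V"
    using U unfolding diagonalizes_def by simp
  then have "L = V ** real_diag e ** conj_transpose V" using X' LIMSEQ_unique by blast
  then have L: "diagonalizes V e L" using Vu by (simp add: diagonalizes_def)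
  have "(\<lambda>n. phi k (psd_power (X (r n)) s)) = (\<lambda>n. root k (esum UNIV k (\<lambda>i. pw s (d (r n) i))))"
    using phi_diagonalizes [OF psd_power_diagonalizes [OF U] k] by simp
  moreover have "phi k (psd_power L s) = root k (esum UNIV k (\<lambda>i. pw s (e i)))"
    by (rule phi_diagonalizes [OF psd_power_diagonalizes [OF L] k])
  moreover have "(\<lambda>n. root k (esum UNIV k (\<lambda>i. pw s (d (r n) i)))) \<longlonglongrightarrow> root k (esum UNIV k (\<lambda>i. pw s (e i)))"
    unfolding esum_def
    by (intro tendsto_real_root tendsto_sum tendsto_prod tendsto_pw s de d)
  ultimately have "(\<lambda>n. phi k (psd_power (X (r n)) s)) \<longlonglongrightarrow> phi k (psd_power L s)" by simp
  then show ?thesis using r by blast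
qed

lemma concave_psd:
  fixes K :: "complex^'m^'n"
  assumes k: "0 < k" "k \<le> CARD('m)"
    and pq: "0 \<le> p" "p \<le> 1" "0 \<le> q" "q \<le> 1" "0 < s" "s * (p + q) \<le> 1"
    and A: "pos_semidef A1" "pos_semidef A2" and B: "pos_semidef B1" "pos_semidef B2"
    and uv: "0 \<le> u" "0 \<le> v" "u + v = 1"
  shows "u * phi k (psd_power (psd_power B1 (q / 2) ** inner_mat 0 p K A1 ** psd_power B1 (q / 2)) s)
      + v * phi k (psd_power (psd_power B2 (q / 2) ** inner_mat 0 p K A2 ** psd_power B2 (q / 2)) s)
    \<le> phi k (psd_power (psd_power (u *\<^sub>R B1 + v *\<^sub>R B2) (q / 2) ** inner_mat 0 p K (u *\<^sub>R A1 + v *\<^sub>R A2)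
          ** psd_power (u *\<^sub>R B1 + v *\<^sub>R B2) (q / 2)) s)"
proof -
  define \<epsilon> where "\<epsilon> n = inverse (real (Suc n))" for n
  have eps: "\<epsilon> \<longlonglongrightarrow> 0" "\<And>n. 0 < \<epsilon> n" unfolding \<epsilon>_def by (rule LIMSEQ_inverse_real_of_nat) simp
  have I: "pos_def (\<epsilon> n *\<^sub>R mat 1 :: complex^'m^'m)" for n using eps by (intro pos_def_scaleR) auto
  define Bn where "Bn X n = X + \<epsilon> n *\<^sub>R mat 1" for X :: "complex^'m^'m" and n
  have Bn: "pos_def (Bn X n)" if "pos_semidef X" for X n
    unfolding Bn_def by (subst add.commute) (rule pos_def_add_psd [OF I that])
  define H where "H \<delta> A B = psd_power B (q / 2) ** inner_mat \<delta> p K A ** psd_power B (q / 2)"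
    for \<delta> and A :: "complex^'n^'n" and B
  have Hpsd: "pos_semidef (H \<delta> X Y)" if "pos_semidef X" "pos_semidef Y" "0 \<le> \<delta>" for X Y \<delta>
  proof -
    have "pos_semidef (inner_mat \<delta> p K X)" unfolding inner_mat_def
      using that by (intro psd_add psd_congruence psd_power_psd psd_scaleR pos_def_imp_psd [OF pos_def_mat_1])
    then have "pos_semidef (conj_transpose (psd_power Y (q / 2)) ** inner_mat \<delta> p K X ** psd_power Y (q / 2))"
      by (rule psd_congruence)
    then show ?thesis using that by (simp add: H_def psd_power_hermitian)
  qed
  define S where "S X Y n = H (\<epsilon> n) X (Bn Y n)" for X Y n
  have Spsd: "pos_semidef (S X Y n)" if "pos_semidef X" "pos_semidef Y" for X Y n
    unfolding S_def
    by (rule Hpsd [OF that(1) pos_def_imp_psd [OF Bn [OF that(2)]] less_imp_le [OF eps(2)]])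
  have Slim: "S X Y \<longlonglongrightarrow> H 0 X Y" if "pos_semidef X" "pos_semidef Y" for X Y
  proof -
    have "(\<lambda>n. psd_power (Bn Y n) (q / 2)) \<longlonglongrightarrow> psd_power Y (q / 2)"
      unfolding Bn_def using that pq eps by (intro psd_power_tendsto) (auto intro: less_imp_le)
    moreover have "(\<lambda>n. inner_mat (\<epsilon> n) p K X) \<longlonglongrightarrow> inner_mat 0 p K X"
      unfolding inner_mat_def by (intro tendsto_intros eps)
    ultimately show ?thesis
      unfolding S_def H_def by (intro tendsto_matrix_mult)
  qed
  let ?A = "u *\<^sub>R A1 + v *\<^sub>R A2" and ?B = "u *\<^sub>R B1 + v *\<^sub>R B2"
  have AB: "pos_semidef ?A" "pos_semidef ?B" using A B uv by (auto intro!: psd_add psd_scaleR)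
  define f where "f X = phi k (psd_power X s)" for X :: "complex^'m^'m"
  have s: "0 \<le> s" using pq by simp
  obtain r1 where r1: "strict_mono r1" "(\<lambda>n. f (S A1 B1 (r1 n))) \<longlonglongrightarrow> f (H 0 A1 B1)"
    using phi_power_subseq [OF k(2) s Slim [OF A(1) B(1)] Spsd [OF A(1) B(1)]] unfolding f_def by blast
  have l2: "(\<lambda>n. S A2 B2 (r1 n)) \<longlonglongrightarrow> H 0 A2 B2"
    using LIMSEQ_subseq_LIMSEQ [OF Slim [OF A(2) B(2)] r1(1)] by (simp add: o_def)
  \<comment> \<open>Each subsequence is extracted from the previous one, so that in the end all
    three values converge along a common sequence.\<close>
  obtain r2 where r2: "strict_mono r2" "(\<lambda>n. f (S A2 B2 (r1 (r2 n)))) \<longlonglongrightarrow> f (H 0 A2 B2)"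
    using phi_power_subseq [OF k(2) s l2 Spsd [OF A(2) B(2)]] unfolding f_def by blast
  have r12: "strict_mono (\<lambda>n. r1 (r2 n))" using r1 r2 by (simp add: strict_mono_def)
  have l3: "(\<lambda>n. S ?A ?B (r1 (r2 n))) \<longlonglongrightarrow> H 0 ?A ?B"
    using LIMSEQ_subseq_LIMSEQ [OF Slim [OF AB] r12] by (simp add: o_def)
  obtain r3 where r3: "strict_mono r3" "(\<lambda>n. f (S ?A ?B (r1 (r2 (r3 n))))) \<longlonglongrightarrow> f (H 0 ?A ?B)"
    using phi_power_subseq [OF k(2) s l3 Spsd [OF AB]] unfolding f_def by blast
  have r23: "strict_mono (\<lambda>n. r2 (r3 n))" using r2 r3 by (simp add: strict_mono_def)
  have L1: "(\<lambda>n. f (S A1 B1 (r1 (r2 (r3 n))))) \<longlonglongrightarrow> f (H 0 A1 B1)"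
    using LIMSEQ_subseq_LIMSEQ [OF r1(2) r23] by (simp add: o_def)
  have L2: "(\<lambda>n. f (S A2 B2 (r1 (r2 (r3 n))))) \<longlonglongrightarrow> f (H 0 A2 B2)"
    using LIMSEQ_subseq_LIMSEQ [OF r2(2) r3(1)] by (simp add: o_def)
  have ineq: "u * f (S A1 B1 n) + v * f (S A2 B2 n) \<le> f (S ?A ?B n)" for n
  proof -
    \<comment> \<open>Because \<open>u + v = 1\<close>, shifting by a multiple of the identity
      commutes with taking the mixture.\<close>
    have "u *\<^sub>R Bn B1 n + v *\<^sub>R Bn B2 n = ?B + (u + v) *\<^sub>R (\<epsilon> n *\<^sub>R mat 1)"
      by (simp only: Bn_def scaleR_add_right scaleR_add_left add_ac)
    then have "u *\<^sub>R Bn B1 n + v *\<^sub>R Bn B2 n = Bn ?B n" using uv by (simp add: Bn_def)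
    then show ?thesis
      using concave_pos_def [OF k pq eps(2) [of n] A Bn [OF B(1), of n] Bn [OF B(2), of n] uv, where K = K]
      by (simp add: f_def S_def H_def)
  qed
  have "u * f (H 0 A1 B1) + v * f (H 0 A2 B2) \<le> f (H 0 ?A ?B)"
    by (rule LIMSEQ_le [OF tendsto_add [OF tendsto_mult_left [OF L1] tendsto_mult_left [OF L2]] r3(2)])
      (use ineq in blast)
  then show ?thesis by (simp add: f_def H_def)
qed

lemma convex_psd: "convex {X. pos_semidef X}"
  by (auto simp: convex_def intro!: psd_add psd_scaleR)

theorem theorem3p2:
  fixes k :: nat and p q s :: real and K :: "complex^'m^'n"
  assumes "1 \<le> k" and "k \<le> CARD('m)"
    and "p \<in> {0..1}" and "q \<in> {0..1}"
    and "0 \<le> s" and "p + q \<noteq> 0 \<Longrightarrow> s \<le> 1 / (p + q)"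
  shows "concave_on ({A :: complex^'n^'n. pos_semidef A} \<times> {B :: complex^'m^'m. pos_semidef B})
    (\<lambda>(A, B). phi k (psd_power
       (psd_power B (q / 2) ** conj_transpose K ** psd_power A p ** K ** psd_power B (q / 2)) s))"
proof -
  have pq: "0 \<le> p" "p \<le> 1" "0 \<le> q" "q \<le> 1" using assms by auto
  have spq: "s * (p + q) \<le> 1"
  proof (cases "p + q = 0")
    case False
    then show ?thesis using assms(6) pq by (simp add: le_divide_eq)
  qed simp
  have eq: "psd_power B (q / 2) ** conj_transpose K ** psd_power A p ** K ** psd_power B (q / 2)
      = psd_power B (q / 2) ** inner_mat 0 p K A ** psd_power B (q / 2)" for A B
    by (simp add: inner_mat_def matrix_mul_assoc)
  have psd: "pos_semidef (psd_power B (q / 2) ** inner_mat 0 p K A ** psd_power B (q / 2))"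
    if "pos_semidef A" "pos_semidef B" for A B
    using psd_congruence [OF psd_congruence [OF psd_power_psd [OF that(1), of p], of K], of "psd_power B (q / 2)"]
      psd_power_hermitian [OF that(2)] by (simp add: inner_mat_def)
  have main: "u * phi k (psd_power (psd_power B1 (q / 2) ** inner_mat 0 p K A1 ** psd_power B1 (q / 2)) s)
      + v * phi k (psd_power (psd_power B2 (q / 2) ** inner_mat 0 p K A2 ** psd_power B2 (q / 2)) s)
    \<le> phi k (psd_power (psd_power (u *\<^sub>R B1 + v *\<^sub>R B2) (q / 2) ** inner_mat 0 p K (u *\<^sub>R A1 + v *\<^sub>R A2)
          ** psd_power (u *\<^sub>R B1 + v *\<^sub>R B2) (q / 2)) s)"
    if "pos_semidef A1" "pos_semidef A2" "pos_semidef B1" "pos_semidef B2" "0 \<le> u" "0 \<le> v" "u + v = 1"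
    for A1 A2 B1 B2 u v
  proof (cases "s = 0")
    \<comment> \<open>All the matrix powers are the identity, so the function is constant;
      \<open>concave_psd\<close> covers only positive \<open>s\<close>.\<close>
    case True
    have "pos_semidef (u *\<^sub>R A1 + v *\<^sub>R A2)" "pos_semidef (u *\<^sub>R B1 + v *\<^sub>R B2)"
      using that by (auto intro!: psd_add psd_scaleR)
    with that True show ?thesis
      by (simp add: psd_power_0 psd flip: distrib_right)
  next
    case False
    then show ?thesis using assms pq spq that by (intro concave_psd) auto
  qed
  show ?thesis
    unfolding concave_on_iff eq using main
    by (auto intro!: convex_Times convex_psd)
qed

end
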